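(* Assume the data-generating, density, regularity and envelope assumptions stated in the context. For $t\in[T]$ let $(\hat\theta_t,\hat\eta_t,\hat\alpha_t)$ be $\mathcal F_{t-1}$-measurable estimators of $(\theta_{P_e},\eta_{P_e},\alpha_{P_e})$, let $w_t=\pi_e(A_t\mid C_t)/\pi_t(A_t\mid C_t)$ and $\varphi_t=\varphi_{P_e}(Z_t)$, and assume: (i) $\frac1T\sum_{t=1}^T\|\hat\theta_t-\theta_{P_e}\|_\Theta^4=o_p(T^{-1})$, $\frac1T\sum_{t=1}^T\|\hat\eta_t-\eta_{P_e}\|_\Upsilon^4=o_p(T^{-1})$ and $\frac1T\sum_{t=1}^T\|\hat\alpha_t-\alpha_{P_e}\|_\Theta^4=o_p(T^{-1})$; (ii) for every $\varepsilon>0$, $\frac1T\sum_{t=1}^T\mathbb E\left[w_t^2\varphi_t^2\mathbf 1\{|w_t\varphi_t|>\varepsilon\sqrt T\}\mid\mathcal F_{t-1}\right]\to0$ in probability; (iii) $\sup_{t\in[T]}\sup_{(c,a)\in\mathcal C\times\mathcal A}\frac{\pi_e(a\mid c)}{\pi_t(a\mid c)}=O(T^{1/3})$ almost surely. Let $\hat\varphi_s(\cdot):=m_{\hat\theta_s}(\cdot)-\hat\Psi_s-\partial_\theta\ell_{\hat\theta_s,\hat\eta_s}(\cdot)[\hat\alpha_s]$, where $\hat\Psi_s$ is any $\mathcal F_{s-1}$-measurable estimator with $\frac1T\sum_{s=1}^T(\hat\Psi_s-\Psi_e(\theta_{P_e}))^2=o_p(T^{-1/2})$ and $\sup_{s\in[T]}|\hat\Psi_s|=O_p(1)$.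 Let $\hat\sigma_1^2$ be a fixed positive finite constant and for $t\ge2$ $$\hat\sigma_t^2:=\frac1{t-1}\sum_{s=1}^{t-1}\frac{\pi_e^2(A_s\mid C_s)}{\pi_t(A_s\mid C_s)\,\pi_s(A_s\mid C_s)}\,\hat\varphi_s^2(Z_s).$$ Assume there is $c>0$ such that $\min(\sigma_t,\hat\sigma_t)>c$ for all $t\in[T]$ almost surely. Moreover assume that there exists a deterministic, pointwise-separable class of policies $\Pi_T$ such that $\pi_t\in\Pi_T$ almost surely for all $t\in[T]$ and: (iv) there exists $p\in[0,2)$ such that for all $\epsilon\in(0,1)$, $\log N(\epsilon,\log\Pi_T,\|\cdot\|_\infty)\lesssim\log(e/\epsilon)$ if $p=0$, and $\log N(\epsilon,\log\Pi_T,\|\cdot\|_\infty)\lesssim\epsilon^{-p}$ if $p\in(0,2)$, where $\log\Pi_T:=\{(c,a)\mapsto\log\pi(a\mid c):\pi\in\Pi_T\}$; (v) $\sup_{\pi\in\Pi_T}\sup_{(c,a)\in\mathcal C\times\mathcal A}\frac{\pi_e(a\mid c)}{\pi(a\mid c)}=O(T^{1/8})$. Then $\frac1T\sum_{t=1}^T\sigma_t^2/\hat\sigma_t^2\to1$ in probability as $T\to\infty$ (and hence, together with the assumed lower bound on $\hat\sigma_t$, both requirements "$\frac1T\sum_{t=1}^T\sigma_t^2/\hat\sigma_t^2-1=o_p(1)$" and "$\min_{t\in[T]}\hat\sigma_t^2$ is almost surely bounded below by a positive constant" hold).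
   Context: Setup. A contextual bandit runs for $T$ rounds. At round $t$ a context $C_t\in\mathcal C$ is observed, an action $A_t\in\mathcal A$ is drawn from $\Pi_t(\cdot\mid C_t)$, and an outcome $Y_t\in\mathbb R$ is observed; $Z_t=(C_t,A_t,Y_t)\in\mathcal Z=\mathcal C\times\mathcal A\times\mathbb R$, $\mathcal F_{t}=\sigma(Z_1,\dots,Z_{t})$, and the policy $\Pi_t$ is $\mathcal F_{t-1}$-measurable. Asymptotics are as $T\to\infty$; policies and estimators may depend on the horizon $T$ (suppressed in the notation). $[T]=\{1,\dots,T\}$. Data-generating assumption: the $C_t$ are i.i.d. with law $P_C$ and $C_t$ is independent of $\mathcal F_{t-1}$; there is a fixed conditional law $P_Y(\cdot\mid c,a)$ with $Y_t\mid C_t,A_t\sim P_Y(\cdot\mid C_t,A_t)$ and $Y_t$ conditionally independent of $\mathcal F_{t-1}$ given $(C_t,A_t)$. Density assumption: $\Pi_e(\cdot\mid c)$ is a fixed (history-independent) evaluation policy; there is a common dominating measure $\mu(\cdot\mid c)$ with $\Pi_t(\cdot\mid c),\Pi_e(\cdot\mid c)\ll\mu(\cdot\mid c)$ for all $t$, with known densities $\pi_t(\cdot\mid c),\pi_e(\cdot\mid c)$, and $\Pi_e(\cdot\mid c)\ll\Pi_t(\cdot\mid c)$ almost surely. $P_e$ is the law of $Z=(C,A,Y)$ with $C\sim P_C$, $A\mid C\sim\Pi_e(\cdot\mid C)$, $Y\mid C,A\sim P_Y(\cdot\mid C,A)$. Target. $(\Theta,\|\cdot\|_\Theta)$, $(\Upsilon,\|\cdot\|_\Upsilon)$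 are normed linear spaces; $\ell_{\theta,\eta}(z)$ is a real-valued loss indexed by $(\theta,\eta)\in\Theta\times\Upsilon$; $\eta_{P_e}\in\Upsilon$ is a nuisance function; $\theta_{P_e}:=\arg\min_{\theta\in\Theta}\mathbb E_{P_e}[\ell_{\theta,\eta_{P_e}}(Z)]$; $m:\Theta\times\mathcal Z\to\mathbb R$, written $m_\theta(z)$, is measurable; $\Psi_e(\theta):=\mathbb E_{P_e}[m_\theta(Z)]$. Derivatives: $\partial_\theta f_{\theta,\eta}(z)[h]:=\frac{d}{d\epsilon}f_{\theta+\epsilon h,\eta}(z)|_{\epsilon=0}$, $\partial_\theta^2f_{\theta,\eta}(z)[h,u]:=\frac{\partial^2}{\partial\epsilon\,\partial\delta}f_{\theta+\epsilon h+\delta u,\eta}(z)|_{\epsilon=\delta=0}$, $\partial_\eta\partial_\theta f_{\theta,\eta}(z)[h,v]:=\frac{\partial^2}{\partial\delta\,\partial\epsilon}f_{\theta+\epsilon h,\eta+\delta v}(z)|_{\epsilon=\delta=0}$, for $h,u\in\Theta$, $v\in\Upsilon$. Regularity assumption: $\theta_{P_e}$ exists and is unique; (a) $\ell_{\theta,\eta}(z)$ is twice Fréchet differentiable in $\theta$ and $m_\theta(z)$ once Fréchet differentiable in $\theta$ in a neighborhood of $\theta_{P_e}$; (b) $\mathbb E_{P_e}[\partial_\theta\ell_{\theta_{P_e},\eta_{P_e}}(Z)[h]]=0$ for all $h\in\Theta$; (c) $\mathbb E_{P_e}[\partial_\eta\partial_\theta\ell_{\theta_{P_e},\eta_{P_e}}(Z)[h,u]]=0$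 for all $h\in\Theta,u\in\Upsilon$; (d) with $H_{P_e}(u,h):=\mathbb E_{P_e}[\partial_\theta^2\ell_{\theta_{P_e},\eta_{P_e}}(Z)[h,u]]$, there is $c>0$ with $c\|h\|_\Theta^2\le H_{P_e}(h,h)$ for all $h\in\Theta$. Envelope assumption: there are $\epsilon_\Theta,\epsilon_\Upsilon>0$ and measurable $C:\mathcal Z\to\mathbb R_+$ with $\mathbb E_{P_e}[C(Z)^4]<\infty$ such that, whenever $\|\theta-\theta_{P_e}\|_\Theta,\|\theta'-\theta_{P_e}\|_\Theta\le\epsilon_\Theta$ and $\|\eta-\eta_{P_e}\|_\Upsilon,\|\eta'-\eta_{P_e}\|_\Upsilon\le\epsilon_\Upsilon$, for all $z$ and all $h,u\in\Theta$, $v\in\Upsilon$: $|m_\theta(z)|\le C(z)$; $|\partial_\theta m_\theta(z)[h]|\le C(z)\|h\|_\Theta$; $|\partial_\theta\ell_{\theta_{P_e},\eta_{P_e}}(z)[h]|\le C(z)\|h\|_\Theta$; $|\partial_\theta^2\ell_{\theta,\eta}(z)[h,u]|\le C(z)\|h\|_\Theta\|u\|_\Theta$; $|\partial_\eta\partial_\theta\ell_{\theta,\eta}(z)[h,v]|\le C(z)\|h\|_\Theta\|v\|_\Upsilon$; $|\partial_\theta m_\theta(z)[h]-\partial_\theta m_{\theta'}(z)[h]|\le C(z)\|\theta-\theta'\|_\Theta\|h\|_\Theta$; $|\partial_\eta\partial_\theta\ell_{\theta,\eta}(z)[h,v]-\partial_\eta\partial_\theta\ell_{\theta',\eta'}(z)[h,v]|\le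 C(z)(\|\theta-\theta'\|_\Theta+\|\eta-\eta'\|_\Upsilon)\|h\|_\Theta\|v\|_\Upsilon$; $|\partial_\theta^2\ell_{\theta,\eta}(z)[h,u]-\partial_\theta^2\ell_{\theta',\eta'}(z)[h,u]|\le C(z)(\|\theta-\theta'\|_\Theta+\|\eta-\eta'\|_\Upsilon)\|h\|_\Theta\|u\|_\Theta$. Riesz representer and influence function. $\bar\Theta$ is the completion of $\Theta$ in the norm $H_{P_e}(h,h)^{1/2}$; $\|\cdot\|_\Theta$, $H_{P_e}$ and the derivative maps (in their $\Theta$-direction arguments) extend continuously to $\bar\Theta$. $\alpha_{P_e}\in\bar\Theta$ is the unique element with $\mathbb E_{P_e}[\partial_\theta m_{\theta_{P_e}}(Z)[h]]=H_{P_e}(\alpha_{P_e},h)$ for all $h\in\Theta$. $\varphi_{P_e}(z):=m_{\theta_{P_e}}(z)-\Psi_e(\theta_{P_e})-\partial_\theta\ell_{\theta_{P_e},\eta_{P_e}}(z)[\alpha_{P_e}]$, and $\sigma_t^2:=\mathrm{Var}(w_t\varphi_t\mid\mathcal F_{t-1})=\mathbb E[w_t^2\varphi_t^2\mid\mathcal F_{t-1}]$. Estimators satisfy $\hat\theta_t,\hat\alpha_t\in\Theta$, $\hat\eta_t\in\Upsilon$. Policy classes. Elements of $\Pi_T$ are conditional densities $\pi(a\mid c)$ with respect to $\mu(\cdot\mid c)$. $N(\epsilon,\mathcal G,\|\cdot\|_\infty)$ is the $\epsilon$-covering number of $\mathcal G$ in sup norm over $\mathcal C\times\mathcal A$. $\lesssim$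 hides a constant not depending on $\epsilon$ or $T$. Pointwise separable: there is a countable subclass such that every member of the class is a pointwise limit of a sequence from the subclass. *)

theory Defs
  imports "HOL-Probability.Probability"
begin

definition tendsto_in_prob :: "'w measure \<Rightarrow> (nat \<Rightarrow> 'w \<Rightarrow> real) \<Rightarrow> real \<Rightarrow> bool" where
  "tendsto_in_prob M X l \<longleftrightarrow>
     (\<forall>n. X n \<in> borel_measurable M) \<and>
     (\<forall>\<epsilon>>0. (\<lambda>n. measure M {\<omega> \<in> space M. \<epsilon> < \<bar>X n \<omega> - l\<bar>}) \<longlonglongrightarrow> 0)"

definition little_o_prob :: "'w measure \<Rightarrow> (nat \<Rightarrow> 'w \<Rightarrow> real) \<Rightarrow> (nat \<Rightarrow> real) \<Rightarrow> bool" where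
  "little_o_prob M X r \<longleftrightarrow> tendsto_in_prob M (\<lambda>n \<omega>. X n \<omega> / r n) 0"

definition bounded_in_prob :: "'w measure \<Rightarrow> (nat \<Rightarrow> 'w \<Rightarrow> real) \<Rightarrow> bool" where
  "bounded_in_prob M X \<longleftrightarrow>
     (\<forall>n. X n \<in> borel_measurable M) \<and>
     (\<forall>\<epsilon>>0. \<exists>K. \<forall>\<^sub>F n in sequentially. measure M {\<omega> \<in> space M. K < \<bar>X n \<omega>\<bar>} \<le> \<epsilon>)"

definition big_O_ennreal :: "(nat \<Rightarrow> ennreal) \<Rightarrow> (nat \<Rightarrow> real) \<Rightarrow> bool" where
  "big_O_ennreal f r \<longleftrightarrow> (\<exists>K. \<forall>\<^sub>F n in sequentially. f n \<le> ennreal (K * r n))"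

definition cond_variance :: "'w measure \<Rightarrow> 'w measure \<Rightarrow> ('w \<Rightarrow> real) \<Rightarrow> 'w \<Rightarrow> real" where
  "cond_variance M G X = real_cond_exp M G (\<lambda>\<omega>. (X \<omega> - real_cond_exp M G X \<omega>)\<^sup>2)"

definition has_cond_law ::
  "'w measure \<Rightarrow> 'w measure \<Rightarrow> ('w \<Rightarrow> 'x) \<Rightarrow> 'x measure \<Rightarrow> ('w \<Rightarrow> 'x measure) \<Rightarrow> bool" where
  "has_cond_law M G X N K \<longleftrightarrow>
     (\<forall>B\<in>sets N. AE \<omega> in M. real_cond_exp M G (indicator (X -` B)) \<omega> = measure (K \<omega>) B)"

definition cond_indep_of ::
  "'w measure \<Rightarrow> 'w measure \<Rightarrow> ('w \<Rightarrow> 'x) \<Rightarrow> 'x measure \<Rightarrow> 'w measure \<Rightarrow> bool" where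
  "cond_indep_of M G X N H \<longleftrightarrow>
     (\<forall>B\<in>sets N. \<forall>D\<in>sets H. AE \<omega> in M.
        real_cond_exp M G (indicator (X -` B \<inter> D)) \<omega>
        = real_cond_exp M G (indicator (X -` B)) \<omega> * real_cond_exp M G (indicator D) \<omega>)"

definition sigma_of :: "'w measure \<Rightarrow> ('w \<Rightarrow> 'x) \<Rightarrow> 'x measure \<Rightarrow> 'w measure" where
  "sigma_of M X N = vimage_algebra (space M) X N"

text \<open>Pairing with the identity makes this the sigma-algebra generated by \<open>G\<close> and \<open>X\<close> together.\<close>

definition sigma_join :: "'w measure \<Rightarrow> 'w measure \<Rightarrow> ('w \<Rightarrow> 'x) \<Rightarrow> 'x measure \<Rightarrow> 'w measure" where
  "sigma_join M G X N = sigma_of M (\<lambda>\<omega>. (\<omega>, X \<omega>)) (G \<Otimes>\<^sub>M N)"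

definition history :: "'w measure \<Rightarrow> (nat \<Rightarrow> 'w \<Rightarrow> 'x) \<Rightarrow> 'x measure \<Rightarrow> nat \<Rightarrow> 'w measure" where
  "history M X N t = sigma_of M (\<lambda>\<omega>. \<lambda>s\<in>{1..t}. X s \<omega>) (PiM {1..t} (\<lambda>_. N))"

text \<open>Expectation with values in the extended reals, so that risks need not be finite.\<close>

definition ext_expectation :: "'x measure \<Rightarrow> ('x \<Rightarrow> real) \<Rightarrow> ereal" where
  "ext_expectation M f =
     enn2ereal (\<integral>\<^sup>+x. ennreal (f x) \<partial>M) - enn2ereal (\<integral>\<^sup>+x. ennreal (- f x) \<partial>M)"

definition dir_deriv :: "('v::real_normed_vector \<Rightarrow> real) \<Rightarrow> 'v \<Rightarrow> 'v \<Rightarrow> real" where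
  "dir_deriv f x h = deriv (\<lambda>\<epsilon>. f (x + \<epsilon> *\<^sub>R h)) 0"

text \<open>For a loss \<open>l \<theta> \<eta> z\<close>: the maps
  \<open>\<partial>\<^sub>\<theta> l [h]\<close>, \<open>\<partial>\<^sub>\<theta>\<^sup>2 l [h, u]\<close> and \<open>\<partial>\<^sub>\<eta>\<partial>\<^sub>\<theta> l [h, v]\<close>.
  An iterated derivative \<open>\<partial>\<^sup>2 / \<partial>a \<partial>b\<close> differentiates in \<open>b\<close> first.\<close>

definition d_theta ::
  "('th::real_normed_vector \<Rightarrow> 'up \<Rightarrow> 'z \<Rightarrow> real) \<Rightarrow> 'th \<Rightarrow> 'up \<Rightarrow> 'z \<Rightarrow> 'th \<Rightarrow> real" where
  "d_theta l \<theta> \<eta> z h = dir_deriv (\<lambda>\<theta>'. l \<theta>' \<eta> z) \<theta> h"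

definition d2_theta ::
  "('th::real_normed_vector \<Rightarrow> 'up \<Rightarrow> 'z \<Rightarrow> real) \<Rightarrow> 'th \<Rightarrow> 'up \<Rightarrow> 'z \<Rightarrow> 'th \<Rightarrow> 'th \<Rightarrow> real" where
  "d2_theta l \<theta> \<eta> z h u = dir_deriv (\<lambda>\<theta>'. d_theta l \<theta>' \<eta> z u) \<theta> h"

definition d_eta_theta ::
  "('th::real_normed_vector \<Rightarrow> 'up::real_normed_vector \<Rightarrow> 'z \<Rightarrow> real)
    \<Rightarrow> 'th \<Rightarrow> 'up \<Rightarrow> 'z \<Rightarrow> 'th \<Rightarrow> 'up \<Rightarrow> real" where
  "d_eta_theta l \<theta> \<eta> z h v = dir_deriv (\<lambda>\<eta>'. d_theta l \<theta> \<eta>' z h) \<eta> v"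

definition twice_frechet_differentiable_on ::
  "('v::real_normed_vector \<Rightarrow> real) \<Rightarrow> 'v set \<Rightarrow> bool" where
  "twice_frechet_differentiable_on f S \<longleftrightarrow>
     (\<exists>D :: 'v \<Rightarrow> 'v \<Rightarrow>\<^sub>L real. \<forall>x\<in>S.
        (f has_derivative blinfun_apply (D x)) (at x) \<and> D differentiable (at x))"

text \<open>\<open>PC\<close> is the law of the contexts and also carries their sigma-algebra; of \<open>MA\<close> only the
  sigma-algebra matters, and likewise for \<open>obs_space\<close>.\<close>

definition obs_space :: "'c measure \<Rightarrow> 'a measure \<Rightarrow> ('c \<times> 'a \<times> real) measure" where
  "obs_space PC MA = PC \<Otimes>\<^sub>M MA \<Otimes>\<^sub>M borel"

definition policy :: "('c \<Rightarrow> 'a measure) \<Rightarrow> ('c \<Rightarrow> 'a \<Rightarrow> real) \<Rightarrow> 'c \<Rightarrow> 'a measure" where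
  "policy \<mu> p c = density (\<mu> c) (\<lambda>a. ennreal (p c a))"

definition cond_density ::
  "'c measure \<Rightarrow> 'a measure \<Rightarrow> ('c \<Rightarrow> 'a measure) \<Rightarrow> ('c \<Rightarrow> 'a \<Rightarrow> real) \<Rightarrow> bool" where
  "cond_density PC MA \<mu> p \<longleftrightarrow>
     (\<forall>c a. 0 \<le> p c a) \<and>
     (\<lambda>(c, a). p c a) \<in> borel_measurable (PC \<Otimes>\<^sub>M MA) \<and>
     policy \<mu> p \<in> PC \<rightarrow>\<^sub>M prob_algebra MA"

text \<open>The last conjunct is required separately because \<open>c \<mapsto> \<mu> c\<close> is not assumed to be a
  measurable kernel.\<close>

definition random_cond_density ::
  "'w measure \<Rightarrow> 'c measure \<Rightarrow> 'a measure \<Rightarrow> ('c \<Rightarrow> 'a measure)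
    \<Rightarrow> ('w \<Rightarrow> 'c \<Rightarrow> 'a \<Rightarrow> real) \<Rightarrow> bool" where
  "random_cond_density G PC MA \<mu> p \<longleftrightarrow>
     (\<forall>\<omega> c a. 0 \<le> p \<omega> c a) \<and>
     (\<lambda>(\<omega>, c, a). p \<omega> c a) \<in> borel_measurable (G \<Otimes>\<^sub>M PC \<Otimes>\<^sub>M MA) \<and>
     (\<lambda>(\<omega>, c). policy \<mu> (p \<omega>) c) \<in> G \<Otimes>\<^sub>M PC \<rightarrow>\<^sub>M prob_algebra MA"

definition eval_law ::
  "'c measure \<Rightarrow> 'a measure \<Rightarrow> ('c \<Rightarrow> 'a measure) \<Rightarrow> ('c \<Rightarrow> 'a \<Rightarrow> real measure)
    \<Rightarrow> ('c \<Rightarrow> 'a \<Rightarrow> real) \<Rightarrow> ('c \<times> 'a \<times> real) measure" where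
  "eval_law PC MA \<mu> PY pe =
     PC \<bind> (\<lambda>c. policy \<mu> pe c \<bind> (\<lambda>a. PY c a \<bind> (\<lambda>y. return (obs_space PC MA) (c, a, y))))"

text \<open>One experiment with horizon \<open>T\<close>; \<open>F t\<close> is the sigma-algebra of the first \<open>t\<close> rounds
  and \<open>p t\<close> the density of the policy used in round \<open>t\<close>.\<close>

definition data_generating ::
  "'w measure \<Rightarrow> 'c measure \<Rightarrow> 'a measure \<Rightarrow> ('c \<Rightarrow> 'a measure) \<Rightarrow> ('c \<Rightarrow> 'a \<Rightarrow> real measure)
    \<Rightarrow> (nat \<Rightarrow> 'w measure) \<Rightarrow> (nat \<Rightarrow> 'w \<Rightarrow> 'c \<Rightarrow> 'a \<Rightarrow> real)
    \<Rightarrow> (nat \<Rightarrow> 'w \<Rightarrow> 'c) \<Rightarrow> (nat \<Rightarrow> 'w \<Rightarrow> 'a) \<Rightarrow> (nat \<Rightarrow> 'w \<Rightarrow> real) \<Rightarrow> nat \<Rightarrow> bool" where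
  "data_generating M PC MA \<mu> PY F p C A Y T \<longleftrightarrow>
     prob_space.indep_vars M (\<lambda>_. PC) C {1..T} \<and>
     (\<forall>t\<in>{1..T}.
        C t \<in> M \<rightarrow>\<^sub>M PC \<and> A t \<in> M \<rightarrow>\<^sub>M MA \<and> Y t \<in> borel_measurable M \<and>
        distr M PC (C t) = PC \<and>
        prob_space.indep_set M (sets (F (t - 1))) (sets (sigma_of M (C t) PC)) \<and>
        has_cond_law M (sigma_join M (F (t - 1)) (C t) PC) (A t) MA
          (\<lambda>\<omega>. policy \<mu> (p t \<omega>) (C t \<omega>)) \<and>
        has_cond_law M (sigma_of M (\<lambda>\<omega>. (C t \<omega>, A t \<omega>)) (PC \<Otimes>\<^sub>M MA)) (Y t) borel
          (\<lambda>\<omega>. PY (C t \<omega>) (A t \<omega>)) \<and>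
        cond_indep_of M (sigma_of M (\<lambda>\<omega>. (C t \<omega>, A t \<omega>)) (PC \<Otimes>\<^sub>M MA)) (Y t) borel (F (t - 1)))"

definition overlap ::
  "'w measure \<Rightarrow> 'c measure \<Rightarrow> ('c \<Rightarrow> 'a measure) \<Rightarrow> ('c \<Rightarrow> 'a \<Rightarrow> real)
    \<Rightarrow> (nat \<Rightarrow> 'w \<Rightarrow> 'c \<Rightarrow> 'a \<Rightarrow> real) \<Rightarrow> nat \<Rightarrow> bool" where
  "overlap M PC \<mu> pe p T \<longleftrightarrow>
     (\<forall>t\<in>{1..T}. AE \<omega> in M. AE c in PC. absolutely_continuous (policy \<mu> (p t \<omega>) c) (policy \<mu> pe c))"

text \<open>The supremum is over whole types: context and action space are taken to be \<open>UNIV\<close>.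
  In \<^typ>\<open>ennreal\<close>, \<open>x / 0 = \<infinity>\<close> for \<open>x > 0\<close> and \<open>0 / 0 = 0\<close>, so a finite supremum forces
  \<open>p > 0\<close> wherever \<open>pe > 0\<close>.\<close>

definition sup_ratio :: "('c \<Rightarrow> 'a \<Rightarrow> real) \<Rightarrow> ('c \<Rightarrow> 'a \<Rightarrow> real) \<Rightarrow> ennreal" where
  "sup_ratio pe p = (SUP c. SUP a. ennreal (pe c a) / ennreal (p c a))"

definition hessian ::
  "'z measure \<Rightarrow> ('th::real_normed_vector \<Rightarrow> 'up \<Rightarrow> 'z \<Rightarrow> real) \<Rightarrow> 'th \<Rightarrow> 'up \<Rightarrow> 'th \<Rightarrow> 'th \<Rightarrow> real" where
  "hessian P l \<theta>0 \<eta>0 u h = (\<integral>z. d2_theta l \<theta>0 \<eta>0 z h u \<partial>P)"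

text \<open>The third conjunct makes explicit that the mixed derivatives occurring in the orthogonality
  and envelope conditions exist near the truth: \<^const>\<open>deriv\<close> is a total function.\<close>

definition regularity ::
  "'z measure \<Rightarrow> ('th::real_normed_vector \<Rightarrow> 'up::real_normed_vector \<Rightarrow> 'z \<Rightarrow> real)
    \<Rightarrow> ('th \<Rightarrow> 'z \<Rightarrow> real) \<Rightarrow> 'th \<Rightarrow> 'up \<Rightarrow> bool" where
  "regularity P l m \<theta>0 \<eta>0 \<longleftrightarrow>
     (\<forall>\<theta>. is_arg_min (\<lambda>\<theta>'. ext_expectation P (l \<theta>' \<eta>0)) (\<lambda>_. True) \<theta> \<longleftrightarrow> \<theta> = \<theta>0) \<and>
     (\<exists>r>0. (\<forall>\<eta> z. twice_frechet_differentiable_on (\<lambda>\<theta>. l \<theta> \<eta> z) (ball \<theta>0 r)) \<and>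
            (\<forall>z. \<forall>\<theta>\<in>ball \<theta>0 r. (\<lambda>\<theta>. m \<theta> z) differentiable (at \<theta>))) \<and>
     (\<exists>r>0. \<forall>\<theta>\<in>ball \<theta>0 r. \<forall>\<eta>\<in>ball \<eta>0 r. \<forall>z h v.
            (\<lambda>\<delta>::real. d_theta l \<theta> (\<eta> + \<delta> *\<^sub>R v) z h) differentiable (at 0)) \<and>
     (\<forall>h. (\<integral>z. d_theta l \<theta>0 \<eta>0 z h \<partial>P) = 0) \<and>
     (\<forall>h v. (\<integral>z. d_eta_theta l \<theta>0 \<eta>0 z h v \<partial>P) = 0) \<and>
     (\<exists>c>0. \<forall>h. c * (norm h)\<^sup>2 \<le> hessian P l \<theta>0 \<eta>0 h h)"

definition envelope ::
  "'z measure \<Rightarrow> ('th::real_normed_vector \<Rightarrow> 'up::real_normed_vector \<Rightarrow> 'z \<Rightarrow> real)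
    \<Rightarrow> ('th \<Rightarrow> 'z \<Rightarrow> real) \<Rightarrow> 'th \<Rightarrow> 'up \<Rightarrow> bool" where
  "envelope P l m \<theta>0 \<eta>0 \<longleftrightarrow>
     (\<exists>eT>0. \<exists>eU>0. \<exists>C \<in> borel_measurable P.
        (\<forall>z. 0 \<le> C z) \<and> integrable P (\<lambda>z. C z ^ 4) \<and>
        (\<forall>\<theta> \<theta>' \<eta> \<eta>'. norm (\<theta> - \<theta>0) \<le> eT \<longrightarrow> norm (\<theta>' - \<theta>0) \<le> eT \<longrightarrow>
           norm (\<eta> - \<eta>0) \<le> eU \<longrightarrow> norm (\<eta>' - \<eta>0) \<le> eU \<longrightarrow>
           (\<forall>z h u v.
              \<bar>m \<theta> z\<bar> \<le> C z \<and>
              \<bar>dir_deriv (\<lambda>\<theta>. m \<theta> z) \<theta> h\<bar> \<le> C z * norm h \<and>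
              \<bar>d_theta l \<theta>0 \<eta>0 z h\<bar> \<le> C z * norm h \<and>
              \<bar>d2_theta l \<theta> \<eta> z h u\<bar> \<le> C z * norm h * norm u \<and>
              \<bar>d_eta_theta l \<theta> \<eta> z h v\<bar> \<le> C z * norm h * norm v \<and>
              \<bar>dir_deriv (\<lambda>\<theta>. m \<theta> z) \<theta> h - dir_deriv (\<lambda>\<theta>. m \<theta> z) \<theta>' h\<bar>
                \<le> C z * norm (\<theta> - \<theta>') * norm h \<and>
              \<bar>d_eta_theta l \<theta> \<eta> z h v - d_eta_theta l \<theta>' \<eta>' z h v\<bar>
                \<le> C z * (norm (\<theta> - \<theta>') + norm (\<eta> - \<eta>')) * norm h * norm v \<and>
              \<bar>d2_theta l \<theta> \<eta> z h u - d2_theta l \<theta>' \<eta>' z h u\<bar>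
                \<le> C z * (norm (\<theta> - \<theta>') + norm (\<eta> - \<eta>')) * norm h * norm u)))"

text \<open>The complete inner product space \<open>'h\<close> is, via \<open>\<iota>\<close>, the completion of \<open>'th\<close> for the norm
  \<open>H h h powr (1/2)\<close>: the inner product of \<open>'h\<close> is the continuous extension of \<open>H\<close>. The norm of \<open>'h\<close>
  is therefore the \<open>H\<close>-norm and not the extension of the norm of \<open>'th\<close>; the latter is
  \<open>cont_ext \<iota> norm\<close>.\<close>

definition is_energy_completion ::
  "('th::real_normed_vector \<Rightarrow> 'th \<Rightarrow> real) \<Rightarrow> ('th \<Rightarrow> 'h::{real_inner, complete_space}) \<Rightarrow> bool" where
  "is_energy_completion H \<iota> \<longleftrightarrow>
     linear \<iota> \<and> (\<forall>u h. inner (\<iota> u) (\<iota> h) = H u h) \<and> closure (range \<iota>) = UNIV"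

definition cont_ext :: "('th \<Rightarrow> 'h::topological_space) \<Rightarrow> ('th \<Rightarrow> real) \<Rightarrow> 'h \<Rightarrow> real" where
  "cont_ext \<iota> f = (THE g. continuous_on UNIV g \<and> (\<forall>h. g (\<iota> h) = f h))"

definition is_riesz_representer ::
  "'z measure \<Rightarrow> ('th::real_normed_vector \<Rightarrow> 'z \<Rightarrow> real) \<Rightarrow> 'th
    \<Rightarrow> ('th \<Rightarrow> 'h::real_inner) \<Rightarrow> 'h \<Rightarrow> bool" where
  "is_riesz_representer P m \<theta>0 \<iota> \<alpha> \<longleftrightarrow>
     (\<forall>\<beta>. (\<forall>h. (\<integral>z. dir_deriv (\<lambda>\<theta>. m \<theta> z) \<theta>0 h \<partial>P) = inner \<beta> (\<iota> h)) \<longleftrightarrow> \<beta> = \<alpha>)"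

definition Psi :: "'z measure \<Rightarrow> ('th \<Rightarrow> 'z \<Rightarrow> real) \<Rightarrow> 'th \<Rightarrow> real" where
  "Psi P m \<theta> = (\<integral>z. m \<theta> z \<partial>P)"

definition influence ::
  "'z measure \<Rightarrow> ('th::real_normed_vector \<Rightarrow> 'up \<Rightarrow> 'z \<Rightarrow> real) \<Rightarrow> ('th \<Rightarrow> 'z \<Rightarrow> real)
    \<Rightarrow> 'th \<Rightarrow> 'up \<Rightarrow> ('th \<Rightarrow> 'h::topological_space) \<Rightarrow> 'h \<Rightarrow> 'z \<Rightarrow> real" where
  "influence P l m \<theta>0 \<eta>0 \<iota> \<alpha> z =
     m \<theta>0 z - Psi P m \<theta>0 - cont_ext \<iota> (d_theta l \<theta>0 \<eta>0 z) \<alpha>"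

definition influence_hat ::
  "('th::real_normed_vector \<Rightarrow> 'up \<Rightarrow> 'z \<Rightarrow> real) \<Rightarrow> ('th \<Rightarrow> 'z \<Rightarrow> real)
    \<Rightarrow> 'th \<Rightarrow> 'up \<Rightarrow> 'th \<Rightarrow> real \<Rightarrow> 'z \<Rightarrow> real" where
  "influence_hat l m \<theta> \<eta> \<alpha> \<psi> z = m \<theta> z - \<psi> - d_theta l \<theta> \<eta> z \<alpha>"

text \<open>Logarithms of densities are \<open>-\<infinity>\<close> where the density vanishes; two functions that are both
  \<open>-\<infinity>\<close> at a point have distance 0 there. On real-valued functions this is the sup norm of
  the difference.\<close>

definition elog :: "ereal \<Rightarrow> ereal" where
  "elog x = (if x \<le> 0 then -\<infinity> else if x = \<infinity> then \<infinity> else ereal (ln (real_of_ereal x)))"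

definition sup_edist :: "('x \<Rightarrow> ereal) \<Rightarrow> ('x \<Rightarrow> ereal) \<Rightarrow> ereal" where
  "sup_edist f g = (SUP x. if f x = g x then 0 else \<bar>f x - g x\<bar>)"

text \<open>Centers of the covering balls need not belong to \<open>G\<close>.\<close>

definition covering_number :: "real \<Rightarrow> ('x \<Rightarrow> ereal) set \<Rightarrow> enat" where
  "covering_number \<epsilon> G =
     (INF S\<in>{S. finite S \<and> (\<forall>f\<in>G. \<exists>g\<in>S. sup_edist f g \<le> ereal \<epsilon>)}. enat (card S))"

definition log_class :: "('c \<Rightarrow> 'a \<Rightarrow> real) set \<Rightarrow> ('c \<times> 'a \<Rightarrow> ereal) set" where
  "log_class \<P> = (\<lambda>p. \<lambda>(c, a). elog (ereal (p c a))) ` \<P>"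

definition pointwise_separable :: "('c \<Rightarrow> 'a \<Rightarrow> real) set \<Rightarrow> bool" where
  "pointwise_separable \<P> \<longleftrightarrow>
     (\<exists>\<P>0\<subseteq>\<P>. countable \<P>0 \<and>
        (\<forall>p\<in>\<P>. \<exists>q. range q \<subseteq> \<P>0 \<and> (\<forall>c a. (\<lambda>n. q n c a) \<longlonglongrightarrow> p c a)))"

end

theory Submission
  imports Defs "HOL-Real_Asymp.Real_Asymp"
begin

text \<open>Weighting round \<open>t\<close> by \<open>w\<^sub>t\<close> turns conditional expectations given the past into expectations
  under the evaluation law, so \<open>\<sigma>\<^sub>t\<^sup>2 = V(\<pi>\<^sub>t)\<close> for the deterministic functional
  \<open>V(\<pi>) = \<integral> (\<pi>\<^sub>e / \<pi>) \<phi>\<^sup>2 dP\<^sub>e\<close>, and for fixed \<open>\<pi>\<close> the oracle average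
  \<open>S\<^sub>n(\<pi>) = n\<inverse> \<Sum> w\<^sub>s (\<pi>\<^sub>e / \<pi>) \<phi>\<^sub>s\<^sup>2\<close> deviates from \<open>V(\<pi>)\<close> by a martingale with second moment
  \<open>O(B\<^sup>3 / n)\<close>, where \<open>B = O(T powr (1/8))\<close> bounds the weights.
  Closeness of log-densities in sup norm is closeness of \<open>S\<^sub>n\<close> and \<open>V\<close> up to a constant factor, so an
  error that is small relative to \<open>V\<close> only needs a cover at a fixed scale, whose size is bounded
  uniformly in \<open>T\<close>; a union bound replaces chaining. The estimation error of the influence
  function is controlled in mean after predictable truncation, its sum being at most of order
  \<open>T powr (3/4)\<close>, which beats the factor \<open>B log T\<close> after division by \<open>T\<close>.\<close>

section \<open>Conditional laws and change of measure\<close>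

text \<open>In \<open>\<sigma>hat2\<close> the policy of round t is a function of the very rounds
  over which the average runs, so with the random policy inserted the summands are no longer
  martingale differences; this is why the bound must be uniform over the class. A cover at a fixed
  scale is coarse, and \<open>V\<close> at the random policy is only known to be of order
  \<open>T powr (1/8)\<close>, so the error of the cover is tolerable only as a multiple of
  \<open>V\<close>. The ratio tolerates exactly that: an error \<open>\<kappa> * V\<close> moves the
  ratio by about \<open>\<kappa>\<close> whatever the size of \<open>V\<close>, and the lower bound
  on \<open>\<sigma>hat2\<close> is spent only on an additive remainder that vanishes. One weight is
  always consumed by the change of measure. The square of an oracle summand contains four weight
  factors and keeps three, whence \<open>B ^ 3\<close>; a plug-in summand contains two and keeps
  one, whence \<open>B\<close>. All errors are bounded in mean, because means can be averaged over t
  and summed over the cover before Markov's inequality is applied once.\<close>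

lemma space_sigma_of [simp]: "space (sigma_of M X N) = space M"
  by (simp add: sigma_of_def)

lemma subalgebra_sigma_of: "X \<in> M \<rightarrow>\<^sub>M N \<Longrightarrow> subalgebra M (sigma_of M X N)"
  unfolding subalgebra_def by (auto simp: sigma_of_def dest: sets_image_in_sets[OF refl])

lemma vimage_in_sigma_of:
  "X \<in> M \<rightarrow>\<^sub>M N \<Longrightarrow> B \<in> sets N \<Longrightarrow> X -` B \<inter> space M \<in> sets (sigma_of M X N)"
  unfolding sigma_of_def by (rule in_vimage_algebra)

text \<open>Lets \<open>\<omega>\<close> itself serve as the conditioning variable that carries all
  of \<open>H\<close>, so that the past needs no explicit coding.\<close>

lemma measurable_ident_subalgebra: "subalgebra M H \<Longrightarrow> (\<lambda>\<omega>. \<omega>) \<in> M \<rightarrow>\<^sub>M H"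
  unfolding subalgebra_def measurable_def using sets.sets_into_space[of _ H] by (auto simp: Int_absorb2)

lemma measure_eqI_rectangles:
  assumes sets: "sets P = sets (N1 \<Otimes>\<^sub>M N2)" "sets Q = sets (N1 \<Otimes>\<^sub>M N2)"
    and fin: "finite_measure P"
    and eq: "\<And>E B. E \<in> sets N1 \<Longrightarrow> B \<in> sets N2 \<Longrightarrow> emeasure P (E \<times> B) = emeasure Q (E \<times> B)"
  shows "P = Q"
proof (rule measure_eqI_generator_eq[where \<Omega> = "space N1 \<times> space N2"
      and E = "{a \<times> b |a b. a \<in> sets N1 \<and> b \<in> sets N2}" and A = "\<lambda>_. space N1 \<times> space N2"])
  show "Int_stable {a \<times> b |a b. a \<in> sets N1 \<and> b \<in> sets N2}"
    by (rule Int_stable_pair_measure_generator)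
  show "{a \<times> b |a b. a \<in> sets N1 \<and> b \<in> sets N2} \<subseteq> Pow (space N1 \<times> space N2)"
    by (rule pair_measure_closed)
  show "\<And>X. X \<in> {a \<times> b |a b. a \<in> sets N1 \<and> b \<in> sets N2} \<Longrightarrow> emeasure P X = emeasure Q X"
    using eq by blast
  show "sets P = sigma_sets (space N1 \<times> space N2) {a \<times> b |a b. a \<in> sets N1 \<and> b \<in> sets N2}"
    "sets Q = sigma_sets (space N1 \<times> space N2) {a \<times> b |a b. a \<in> sets N1 \<and> b \<in> sets N2}"
    by (simp_all add: sets sets_pair_measure)
  show "range (\<lambda>_. space N1 \<times> space N2) \<subseteq> {a \<times> b |a b. a \<in> sets N1 \<and> b \<in> sets N2}"
    by blast
  show "\<And>i. emeasure P (space N1 \<times> space N2) \<noteq> \<infinity>"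
    by (simp add: finite_measure.emeasure_finite[OF fin])
qed simp

text \<open>Disintegration: the rectangle identity says that the joint law of \<open>W\<close> and
  \<open>X\<close> is the law of \<open>W\<close> composed with the kernel, and integration against
  a composition is iterated integration.\<close>

lemma nn_integral_joint_kernel:
  assumes "prob_space M" and W: "W \<in> M \<rightarrow>\<^sub>M N1" and X: "X \<in> M \<rightarrow>\<^sub>M N2"
    and \<kappa>: "\<kappa> \<in> N1 \<rightarrow>\<^sub>M prob_algebra N2"
    and rect: "\<And>E B. E \<in> sets N1 \<Longrightarrow> B \<in> sets N2 \<Longrightarrow>
      emeasure M {\<omega>\<in>space M. W \<omega> \<in> E \<and> X \<omega> \<in> B}
      = (\<integral>\<^sup>+\<omega>. indicator E (W \<omega>) * emeasure (\<kappa> (W \<omega>)) B \<partial>M)"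
    and f: "f \<in> borel_measurable (N1 \<Otimes>\<^sub>M N2)"
  shows "(\<integral>\<^sup>+\<omega>. f (W \<omega>, X \<omega>) \<partial>M) = (\<integral>\<^sup>+\<omega>. \<integral>\<^sup>+x. f (W \<omega>, x) \<partial>\<kappa> (W \<omega>) \<partial>M)"
proof -
  interpret prob_space M by fact
  note [measurable] = W X f
  have \<kappa>s [measurable]: "\<kappa> \<in> N1 \<rightarrow>\<^sub>M subprob_algebra N2"
    by (rule measurable_prob_algebraD[OF \<kappa>])
  have sets_\<kappa> [measurable_cong]: "sets (\<kappa> w) = sets N2" if "w \<in> space N1" for w
    by (rule sets_kernel[OF \<kappa>s that])
  \<comment> \<open>\<open>L w\<close> attaches the point \<open>w\<close> to a draw from
    \<open>\<kappa> w\<close>, so that binding the law of \<open>W\<close> with \<open>L\<close>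
    produces a law on pairs.\<close>
  define L where "L w = distr (\<kappa> w) (N1 \<Otimes>\<^sub>M N2) (Pair w)" for w
  have L: "L \<in> N1 \<rightarrow>\<^sub>M subprob_algebra (N1 \<Otimes>\<^sub>M N2)"
    unfolding L_def by (rule measurable_distr2[OF _ \<kappa>s]) simp
  define Q where "Q = distr M N1 W"
  have ne: "space Q \<noteq> {}"
    unfolding Q_def using measurable_space[OF W] not_empty by auto
  have LQ: "L \<in> Q \<rightarrow>\<^sub>M subprob_algebra (N1 \<Otimes>\<^sub>M N2)"
    unfolding Q_def using L by simp
  have Pair_meas: "Pair w \<in> \<kappa> w \<rightarrow>\<^sub>M N1 \<Otimes>\<^sub>M N2" if "w \<in> space N1" for w
    by (subst measurable_cong_sets[OF sets_\<kappa>[OF that] refl]) (simp add: that)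
  have eq: "distr M (N1 \<Otimes>\<^sub>M N2) (\<lambda>\<omega>. (W \<omega>, X \<omega>)) = Q \<bind> L"
  proof (rule measure_eqI_rectangles)
    show "sets (Q \<bind> L) = sets (N1 \<Otimes>\<^sub>M N2)"
      by (rule sets_bind[OF sets_kernel[OF LQ] ne])
    show "finite_measure (distr M (N1 \<Otimes>\<^sub>M N2) (\<lambda>\<omega>. (W \<omega>, X \<omega>)))"
      by (rule finite_measure_distr) simp
    fix E B assume E [measurable]: "E \<in> sets N1" and B [measurable]: "B \<in> sets N2"
    have "emeasure (Q \<bind> L) (E \<times> B) = (\<integral>\<^sup>+w. emeasure (L w) (E \<times> B) \<partial>Q)"
      by (rule emeasure_bind[OF ne LQ]) simp
    also have "\<dots> = (\<integral>\<^sup>+\<omega>. emeasure (L (W \<omega>)) (E \<times> B) \<partial>M)"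
      unfolding Q_def
      by (rule nn_integral_distr) (use measurable_emeasure_kernel[OF L, of "E \<times> B"] in simp_all)
    also have "\<dots> = (\<integral>\<^sup>+\<omega>. indicator E (W \<omega>) * emeasure (\<kappa> (W \<omega>)) B \<partial>M)"
    proof (rule nn_integral_cong)
      fix \<omega> assume "\<omega> \<in> space M"
      then have w: "W \<omega> \<in> space N1" by (rule measurable_space[OF W])
      have "emeasure (L (W \<omega>)) (E \<times> B) = emeasure (\<kappa> (W \<omega>)) (Pair (W \<omega>) -` (E \<times> B) \<inter> space (\<kappa> (W \<omega>)))"
        unfolding L_def by (rule emeasure_distr[OF Pair_meas[OF w]]) simp
      also have "Pair (W \<omega>) -` (E \<times> B) \<inter> space (\<kappa> (W \<omega>)) = (if W \<omega> \<in> E then B else {})"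
        using sets.sets_into_space[OF B] sets_eq_imp_space_eq[OF sets_\<kappa>[OF w]] by auto
      finally show "emeasure (L (W \<omega>)) (E \<times> B) = indicator E (W \<omega>) * emeasure (\<kappa> (W \<omega>)) B"
        by simp
    qed
    also have "\<dots> = emeasure M {\<omega>\<in>space M. W \<omega> \<in> E \<and> X \<omega> \<in> B}"
      using rect[OF E B] by simp
    also have "\<dots> = emeasure (distr M (N1 \<Otimes>\<^sub>M N2) (\<lambda>\<omega>. (W \<omega>, X \<omega>))) (E \<times> B)"
      by (subst emeasure_distr) (auto intro!: arg_cong[where f = "emeasure M"])
    finally show "emeasure (distr M (N1 \<Otimes>\<^sub>M N2) (\<lambda>\<omega>. (W \<omega>, X \<omega>))) (E \<times> B) = emeasure (Q \<bind> L) (E \<times> B)"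
      by simp
  qed simp
  have "(\<integral>\<^sup>+\<omega>. f (W \<omega>, X \<omega>) \<partial>M) = (\<integral>\<^sup>+y. f y \<partial>distr M (N1 \<Otimes>\<^sub>M N2) (\<lambda>\<omega>. (W \<omega>, X \<omega>)))"
    by (subst nn_integral_distr) simp_all
  also have "\<dots> = (\<integral>\<^sup>+w. \<integral>\<^sup>+y. f y \<partial>L w \<partial>Q)"
    unfolding eq by (rule nn_integral_bind[OF f LQ])
  also have "\<dots> = (\<integral>\<^sup>+\<omega>. \<integral>\<^sup>+y. f y \<partial>L (W \<omega>) \<partial>M)"
    unfolding Q_def
    by (rule nn_integral_distr[OF W]) (use nn_integral_measurable_subprob_algebra[OF f] L in \<open>simp add: measurable_compose\<close>)
  also have "\<dots> = (\<integral>\<^sup>+\<omega>. \<integral>\<^sup>+x. f (W \<omega>, x) \<partial>\<kappa> (W \<omega>) \<partial>M)"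
  proof (rule nn_integral_cong)
    fix \<omega> assume "\<omega> \<in> space M"
    then have w: "W \<omega> \<in> space N1" by (rule measurable_space[OF W])
    show "(\<integral>\<^sup>+y. f y \<partial>L (W \<omega>)) = (\<integral>\<^sup>+x. f (W \<omega>, x) \<partial>\<kappa> (W \<omega>))"
      unfolding L_def by (rule nn_integral_distr[OF Pair_meas[OF w]]) simp
  qed
  finally show ?thesis .
qed

text \<open>\<open>has_cond_law\<close> fixes the kernel only up to a null set depending on
  \<open>B\<close>; integrating over an event of the generated sigma-algebra absorbs these null sets
  and leaves an exact identity.\<close>

lemma has_cond_law_rectangle:
  assumes "prob_space M" and W: "W \<in> M \<rightarrow>\<^sub>M N1" and X: "X \<in> M \<rightarrow>\<^sub>M N2"
    and \<kappa>: "\<kappa> \<in> N1 \<rightarrow>\<^sub>M prob_algebra N2"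
    and law: "has_cond_law M (sigma_of M W N1) X N2 (\<lambda>\<omega>. \<kappa> (W \<omega>))"
    and E: "E \<in> sets N1" and B: "B \<in> sets N2"
  shows "emeasure M {\<omega>\<in>space M. W \<omega> \<in> E \<and> X \<omega> \<in> B}
      = (\<integral>\<^sup>+\<omega>. indicator E (W \<omega>) * emeasure (\<kappa> (W \<omega>)) B \<partial>M)"
proof -
  interpret prob_space M by fact
  interpret S: finite_measure_subalgebra M "sigma_of M W N1"
    by unfold_locales (rule subalgebra_sigma_of[OF W])
  note [measurable] = W X E B measurable_prob_algebraD[OF \<kappa>]
  have pk: "prob_space (\<kappa> (W \<omega>))" if "\<omega> \<in> space M" for \<omega>
    using measurable_space[OF \<kappa> measurable_space[OF W that]] by (simp add: space_prob_algebra)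
  let ?E = "W -` E \<inter> space M"
  have E': "?E \<in> sets (sigma_of M W N1)" by (rule vimage_in_sigma_of[OF W E])
  \<comment> \<open>The preimage of \<open>B\<close> is not cut down to the sample space, so
    integrability is read off from the indicator that agrees with it there.\<close>
  have int: "integrable M (indicator (X -` B) :: 'a \<Rightarrow> real)"
  proof -
    have "integrable M (indicator (X -` B \<inter> space M) :: 'a \<Rightarrow> real)"
      by (simp add: less_top[symmetric])
    then show ?thesis
      by (subst Bochner_Integration.integrable_cong[OF refl, where g = "indicator (X -` B \<inter> space M)"])
        (auto simp: indicator_def)
  qed
  have "(\<integral>\<omega>\<in>?E. indicator (X -` B) \<omega> \<partial>M) = (\<integral>\<omega>\<in>?E. real_cond_exp M (sigma_of M W N1) (indicator (X -` B)) \<omega> \<partial>M)"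
    by (rule S.real_cond_exp_intA[OF int E'])
  also have "\<dots> = (\<integral>\<omega>\<in>?E. measure (\<kappa> (W \<omega>)) B \<partial>M)"
    using law B unfolding has_cond_law_def set_lebesgue_integral_def
    by (intro integral_cong_AE) (auto simp: intro!: measurable_compose[OF W])
  finally have *: "(\<integral>\<omega>\<in>?E. indicator (X -` B) \<omega> \<partial>M) = (\<integral>\<omega>\<in>?E. measure (\<kappa> (W \<omega>)) B \<partial>M)" .
  have "emeasure M {\<omega>\<in>space M. W \<omega> \<in> E \<and> X \<omega> \<in> B} = ennreal (\<integral>\<omega>\<in>?E. indicator (X -` B) \<omega> \<partial>M)"
    unfolding set_lebesgue_integral_def
    by (subst Bochner_Integration.integral_cong[OF refl, where g = "indicator {\<omega>\<in>space M. W \<omega> \<in> E \<and> X \<omega> \<in> B}"])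
       (auto simp: emeasure_eq_measure indicator_def)
  also have "\<dots> = (\<integral>\<^sup>+\<omega>. ennreal (indicator ?E \<omega> * measure (\<kappa> (W \<omega>)) B) \<partial>M)"
  proof -
    have "integrable M (\<lambda>\<omega>. indicator ?E \<omega> * measure (\<kappa> (W \<omega>)) B)"
      by (rule integrable_const_bound[where B = 1])
        (auto intro!: prob_space.prob_le_1[OF pk] AE_I2 simp: indicator_def)
    then show ?thesis
      unfolding * by (subst nn_integral_eq_integral) (auto simp: set_lebesgue_integral_def)
  qed
  also have "\<dots> = (\<integral>\<^sup>+\<omega>. indicator E (W \<omega>) * emeasure (\<kappa> (W \<omega>)) B \<partial>M)"
    by (intro nn_integral_cong)
      (auto simp: indicator_def finite_measure.emeasure_eq_measure[OF prob_space.finite_measure[OF pk]])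
  finally show ?thesis .
qed


text \<open>The two sides below define finite measures in \<open>E\<close>, so it suffices to compare them on
  rectangles, where conditional independence applies.\<close>

lemma has_cond_law_cond_indep_rectangle:
  assumes "prob_space M" and V: "V \<in> M \<rightarrow>\<^sub>M N1" and X: "X \<in> M \<rightarrow>\<^sub>M N2"
    and sub: "subalgebra M H"
    and \<kappa>: "\<kappa> \<in> N1 \<rightarrow>\<^sub>M prob_algebra N2"
    and law: "has_cond_law M (sigma_of M V N1) X N2 (\<lambda>\<omega>. \<kappa> (V \<omega>))"
    and indep: "cond_indep_of M (sigma_of M V N1) X N2 H"
    and E: "E \<in> sets (H \<Otimes>\<^sub>M N1)" and B: "B \<in> sets N2"
  shows "emeasure M {\<omega>\<in>space M. (\<omega>, V \<omega>) \<in> E \<and> X \<omega> \<in> B}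
      = (\<integral>\<^sup>+\<omega>. indicator E (\<omega>, V \<omega>) * emeasure (\<kappa> (V \<omega>)) B \<partial>M)"
proof -
  interpret prob_space M by fact
  interpret S: finite_measure_subalgebra M "sigma_of M V N1"
    by unfold_locales (rule subalgebra_sigma_of[OF V])
  have idH [measurable]: "(\<lambda>\<omega>. \<omega>) \<in> M \<rightarrow>\<^sub>M H" by (rule measurable_ident_subalgebra[OF sub])
  note [measurable] = V X E B measurable_prob_algebraD[OF \<kappa>]
  have spH: "space H = space M" and HM: "sets H \<subseteq> sets M" using sub by (auto simp: subalgebra_def)
  have VS [measurable]: "V \<in> sigma_of M V N1 \<rightarrow>\<^sub>M N1"
    unfolding sigma_of_def by (rule measurable_vimage_algebra1) (use measurable_space[OF V] in auto)
  have pk: "prob_space (\<kappa> (V \<omega>))" if "\<omega> \<in> space M" for \<omega>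
    using measurable_space[OF \<kappa> measurable_space[OF V that]] by (simp add: space_prob_algebra)
  have pk_em: "emeasure (\<kappa> (V \<omega>)) B = ennreal (measure (\<kappa> (V \<omega>)) B)" if "\<omega> \<in> space M" for \<omega>
    by (rule finite_measure.emeasure_eq_measure[OF prob_space.finite_measure[OF pk[OF that]]])
  define P1 where "P1 = distr (density M (indicator (X -` B \<inter> space M))) (H \<Otimes>\<^sub>M N1) (\<lambda>\<omega>. (\<omega>, V \<omega>))"
  define P2 where "P2 = distr (density M (\<lambda>\<omega>. emeasure (\<kappa> (V \<omega>)) B)) (H \<Otimes>\<^sub>M N1) (\<lambda>\<omega>. (\<omega>, V \<omega>))"
  have P1: "emeasure P1 E' = emeasure M {\<omega>\<in>space M. (\<omega>, V \<omega>) \<in> E' \<and> X \<omega> \<in> B}" if [measurable]: "E' \<in> sets (H \<Otimes>\<^sub>M N1)" for E'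
  proof -
    have "emeasure P1 E' = (\<integral>\<^sup>+\<omega>. indicator (X -` B \<inter> space M) \<omega> * indicator ((\<lambda>\<omega>. (\<omega>, V \<omega>)) -` E' \<inter> space M) \<omega> \<partial>M)"
      unfolding P1_def by (subst emeasure_distr) (simp_all add: emeasure_density)
    also have "\<dots> = (\<integral>\<^sup>+\<omega>. indicator {\<omega>\<in>space M. (\<omega>, V \<omega>) \<in> E' \<and> X \<omega> \<in> B} \<omega> \<partial>M)"
      by (intro nn_integral_cong) (auto split: split_indicator)
    finally show ?thesis by simp
  qed
  have P2: "emeasure P2 E' = (\<integral>\<^sup>+\<omega>. indicator E' (\<omega>, V \<omega>) * emeasure (\<kappa> (V \<omega>)) B \<partial>M)" if [measurable]: "E' \<in> sets (H \<Otimes>\<^sub>M N1)" for E'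
    unfolding P2_def
    by (subst emeasure_distr) (auto simp: emeasure_density intro!: nn_integral_cong split: split_indicator)
  have "P1 = P2"
  proof (rule measure_eqI_rectangles)
    show "sets P1 = sets (H \<Otimes>\<^sub>M N1)" "sets P2 = sets (H \<Otimes>\<^sub>M N1)" by (simp_all add: P1_def P2_def)
    show "finite_measure P1"
      by (rule finite_measureI)
        (simp add: P1[unfolded P1_def] P1_def space_pair_measure emeasure_eq_measure P1[OF sets.top, unfolded P1_def space_pair_measure])
    fix D U assume D: "D \<in> sets H" and U [measurable]: "U \<in> sets N1"
    have [measurable]: "D \<in> sets M" using D HM by auto
    have DU [measurable]: "D \<times> U \<in> sets (H \<Otimes>\<^sub>M N1)" using D U by simp
    let ?G = "sigma_of M V N1" and ?U = "V -` U \<inter> space M"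
    have U': "?U \<in> sets ?G" by (rule vimage_in_sigma_of[OF V U])
    have int: "integrable M (indicator (X -` B \<inter> D) :: 'a \<Rightarrow> real)"
    proof -
      have "X -` B \<inter> D = (X -` B \<inter> space M) \<inter> D" using sets.sets_into_space[of D M] by auto
      moreover have "integrable M (indicator ((X -` B \<inter> space M) \<inter> D) :: 'a \<Rightarrow> real)"
        by (simp add: less_top[symmetric])
      ultimately show ?thesis by simp
    qed
    have intD: "integrable M (indicator D :: 'a \<Rightarrow> real)"
      by (simp add: less_top[symmetric])
    have k_meas: "(\<lambda>\<omega>. indicat_real ?U \<omega> * measure (\<kappa> (V \<omega>)) B) \<in> borel_measurable ?G"
      using U' by simp
    have intk: "integrable M (\<lambda>\<omega>. (indicat_real ?U \<omega> * measure (\<kappa> (V \<omega>)) B) * indicator D \<omega>)"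
      by (rule integrable_const_bound[where B = 1])
        (auto intro!: prob_space.prob_le_1[OF pk] AE_I2 simp: indicator_def)
    have "(\<integral>\<omega>\<in>?U. indicator (X -` B \<inter> D) \<omega> \<partial>M) = (\<integral>\<omega>\<in>?U. real_cond_exp M ?G (indicator (X -` B \<inter> D)) \<omega> \<partial>M)"
      by (rule S.real_cond_exp_intA[OF int U'])
    also have "\<dots> = (\<integral>\<omega>. (indicator ?U \<omega> * measure (\<kappa> (V \<omega>)) B) * real_cond_exp M ?G (indicator D) \<omega> \<partial>M)"
    proof -
      have "AE \<omega> in M. real_cond_exp M ?G (indicator (X -` B \<inter> D)) \<omega>
          = real_cond_exp M ?G (indicator (X -` B)) \<omega> * real_cond_exp M ?G (indicator D) \<omega>"
        using indep B D unfolding cond_indep_of_def by auto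
      moreover have "AE \<omega> in M. real_cond_exp M ?G (indicator (X -` B)) \<omega> = measure (\<kappa> (V \<omega>)) B"
        using law B unfolding has_cond_law_def by auto
      ultimately show ?thesis
        unfolding set_lebesgue_integral_def by (intro integral_cong_AE) auto
    qed
    \<comment> \<open>The factor in parentheses is measurable for the sigma-algebra of
      \<open>V\<close>, so the conditional expectation can be taken off the indicator of
      \<open>D\<close>.\<close>
    also have "\<dots> = (\<integral>\<omega>. (indicator ?U \<omega> * measure (\<kappa> (V \<omega>)) B) * indicator D \<omega> \<partial>M)"
      by (rule S.real_cond_exp_intg(2)[OF intk k_meas]) simp
    finally have *: "(\<integral>\<omega>\<in>?U. indicator (X -` B \<inter> D) \<omega> \<partial>M) = \<dots>" .
    have "emeasure P1 (D \<times> U) = emeasure M {\<omega>\<in>space M. (\<omega>, V \<omega>) \<in> D \<times> U \<and> X \<omega> \<in> B}"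
      by (rule P1[OF DU])
    also have "\<dots> = ennreal (\<integral>\<omega>\<in>?U. indicator (X -` B \<inter> D) \<omega> \<partial>M)"
      unfolding set_lebesgue_integral_def
      by (subst Bochner_Integration.integral_cong[OF refl, where g = "indicator {\<omega>\<in>space M. (\<omega>, V \<omega>) \<in> D \<times> U \<and> X \<omega> \<in> B}"])
         (auto simp: emeasure_eq_measure indicator_def)
    also have "\<dots> = (\<integral>\<^sup>+\<omega>. ennreal ((indicator ?U \<omega> * measure (\<kappa> (V \<omega>)) B) * indicator D \<omega>) \<partial>M)"
      unfolding * by (subst nn_integral_eq_integral[OF intk]) auto
    also have "\<dots> = (\<integral>\<^sup>+\<omega>. indicator (D \<times> U) (\<omega>, V \<omega>) * emeasure (\<kappa> (V \<omega>)) B \<partial>M)"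
      by (intro nn_integral_cong) (auto simp: indicator_def pk_em)
    also have "\<dots> = emeasure P2 (D \<times> U)" by (rule P2[OF DU, symmetric])
    finally show "emeasure P1 (D \<times> U) = emeasure P2 (D \<times> U)" .
  qed
  then show ?thesis using P1[OF E] P2[OF E] by simp
qed

text \<open>Independence is a kernel that ignores the past; this puts the draw of the context into
  the form required by \<open>nn_integral_joint_kernel\<close>.\<close>

lemma (in prob_space) indep_set_rectangle:
  assumes X: "X \<in> M \<rightarrow>\<^sub>M N" and sub: "subalgebra M H"
    and indep: "indep_set (sets H) (sets (sigma_of M X N))"
    and law: "distr M N X = K"
    and D: "D \<in> sets H" and B: "B \<in> sets N"
  shows "emeasure M {\<omega>\<in>space M. \<omega> \<in> D \<and> X \<omega> \<in> B} = (\<integral>\<^sup>+\<omega>. indicator D \<omega> * emeasure K B \<partial>M)"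
proof -
  have DM [measurable]: "D \<in> sets M" using D sub by (auto simp: subalgebra_def)
  have "{\<omega>\<in>space M. \<omega> \<in> D \<and> X \<omega> \<in> B} = D \<inter> (X -` B \<inter> space M)"
    using sets.sets_into_space[OF DM] by auto
  also have "prob \<dots> = prob D * prob (X -` B \<inter> space M)"
    by (rule indep_setD[OF indep D vimage_in_sigma_of[OF X B]])
  finally have "emeasure M {\<omega>\<in>space M. \<omega> \<in> D \<and> X \<omega> \<in> B} = emeasure M D * emeasure M (X -` B \<inter> space M)"
    by (simp add: emeasure_eq_measure ennreal_mult)
  also have "emeasure M (X -` B \<inter> space M) = emeasure K B"
    unfolding law[symmetric] by (rule emeasure_distr[OF X B, symmetric])
  finally show ?thesis by (simp add: nn_integral_multc)
qed

section \<open>The evaluation law and a single round of the experiment\<close>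

lemma nn_integral_eval_law:
  assumes PC: "prob_space PC"
    and PY: "(\<lambda>(c, a). PY c a) \<in> PC \<Otimes>\<^sub>M MA \<rightarrow>\<^sub>M prob_algebra borel"
    and pe: "policy \<mu> pe \<in> PC \<rightarrow>\<^sub>M prob_algebra MA"
    and f [measurable]: "f \<in> borel_measurable (obs_space PC MA)"
  shows "(\<integral>\<^sup>+z. f z \<partial>eval_law PC MA \<mu> PY pe)
      = (\<integral>\<^sup>+c. \<integral>\<^sup>+a. \<integral>\<^sup>+y. f (c, a, y) \<partial>PY c a \<partial>policy \<mu> pe c \<partial>PC)"
    and "prob_space (eval_law PC MA \<mu> PY pe)"
    and "sets (eval_law PC MA \<mu> PY pe) = sets (obs_space PC MA)"
proof -
  interpret prob_space PC by fact
  let ?ret = "\<lambda>c a. PY c a \<bind> (\<lambda>y. return (obs_space PC MA) (c, a, y))"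
  note [measurable] = pe
  have PY1 [measurable]: "PY c \<in> MA \<rightarrow>\<^sub>M prob_algebra borel" if "c \<in> space PC" for c
    using measurable_compose[OF measurable_Pair1'[OF that] PY] by simp
  have R [measurable]: "(\<lambda>x. return (obs_space PC MA) (fst (fst x), snd (fst x), snd x))
      \<in> (PC \<Otimes>\<^sub>M MA) \<Otimes>\<^sub>M borel \<rightarrow>\<^sub>M prob_algebra (obs_space PC MA)"
    unfolding obs_space_def by simp
  have K3: "(\<lambda>x. PY (fst x) (snd x) \<bind> (\<lambda>y. return (obs_space PC MA) (fst x, snd x, y)))
      \<in> PC \<Otimes>\<^sub>M MA \<rightarrow>\<^sub>M prob_algebra (obs_space PC MA)"
    by (rule measurable_bind_prob_space2[where N = borel
          and g = "\<lambda>x y. return (obs_space PC MA) (fst x, snd x, y)"])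
       (use PY R in \<open>simp_all add: case_prod_beta'\<close>)
  have K2: "(\<lambda>c. policy \<mu> pe c \<bind> ?ret c)
      \<in> PC \<rightarrow>\<^sub>M prob_algebra (obs_space PC MA)"
    by (rule measurable_bind_prob_space2[OF pe]) (use K3 in \<open>simp add: case_prod_beta'\<close>)
  show "prob_space (eval_law PC MA \<mu> PY pe)"
    unfolding eval_law_def
    by (rule prob_space_bind'[OF _ K2]) (simp add: space_prob_algebra PC)
  show "sets (eval_law PC MA \<mu> PY pe) = sets (obs_space PC MA)"
    unfolding eval_law_def
    by (rule sets_bind'[OF _ K2]) (simp add: space_prob_algebra PC)
  have "(\<integral>\<^sup>+z. f z \<partial>eval_law PC MA \<mu> PY pe) = (\<integral>\<^sup>+c. \<integral>\<^sup>+z. f z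
      \<partial>(policy \<mu> pe c \<bind> ?ret c) \<partial>PC)"
    unfolding eval_law_def by (rule nn_integral_bind[OF f measurable_prob_algebraD[OF K2]])
  also have "\<dots> = (\<integral>\<^sup>+c. \<integral>\<^sup>+a. \<integral>\<^sup>+y. f (c, a, y) \<partial>PY c a \<partial>policy \<mu> pe c \<partial>PC)"
  proof (rule nn_integral_cong)
    fix c assume c: "c \<in> space PC"
    have sp: "sets (policy \<mu> pe c) = sets MA"
      using measurable_space[OF pe c] by (simp add: space_prob_algebra)
    have "?ret c \<in> MA \<rightarrow>\<^sub>M prob_algebra (obs_space PC MA)"
      using measurable_compose[OF measurable_Pair1'[OF c] K3] by simp
    then have k2: "?ret c \<in> policy \<mu> pe c \<rightarrow>\<^sub>M subprob_algebra (obs_space PC MA)"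
      by (subst measurable_cong_sets[OF sp refl]) (rule measurable_prob_algebraD)
    have "(\<integral>\<^sup>+z. f z \<partial>(policy \<mu> pe c \<bind> ?ret c))
        = (\<integral>\<^sup>+a. \<integral>\<^sup>+z. f z \<partial>(?ret c a) \<partial>policy \<mu> pe c)"
      by (rule nn_integral_bind[OF f k2])
    also have "\<dots> = (\<integral>\<^sup>+a. \<integral>\<^sup>+y. f (c, a, y) \<partial>PY c a \<partial>policy \<mu> pe c)"
    proof (rule nn_integral_cong)
      fix a assume "a \<in> space (policy \<mu> pe c)"
      then have a: "a \<in> space MA" using sets_eq_imp_space_eq[OF sp] by simp
      have sy: "sets (PY c a) = sets borel"
        using measurable_space[OF PY1[OF c] a] by (simp add: space_prob_algebra)
      have k3: "(\<lambda>y. return (obs_space PC MA) (c, a, y)) \<in> PY c a \<rightarrow>\<^sub>M subprob_algebra (obs_space PC MA)"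
        by (subst measurable_cong_sets[OF sy refl])
          (rule measurable_prob_algebraD, use c a in \<open>simp add: obs_space_def\<close>)
      have "(\<integral>\<^sup>+z. f z \<partial>(?ret c a))
          = (\<integral>\<^sup>+y. \<integral>\<^sup>+z. f z \<partial>return (obs_space PC MA) (c, a, y) \<partial>PY c a)"
        by (rule nn_integral_bind[OF f k3])
      also have "\<dots> = (\<integral>\<^sup>+y. f (c, a, y) \<partial>PY c a)"
        by (intro nn_integral_cong nn_integral_return)
          (use c a f in \<open>auto simp: obs_space_def space_pair_measure\<close>)
      finally show "(\<integral>\<^sup>+z. f z \<partial>(?ret c a)) = \<dots>" .
    qed
    finally show "(\<integral>\<^sup>+z. f z \<partial>(policy \<mu> pe c \<bind> ?ret c)) = \<dots>" .
  qed
  finally show "(\<integral>\<^sup>+z. f z \<partial>eval_law PC MA \<mu> PY pe)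
      = (\<integral>\<^sup>+c. \<integral>\<^sup>+a. \<integral>\<^sup>+y. f (c, a, y) \<partial>PY c a \<partial>policy \<mu> pe c \<partial>PC)" .
qed

text \<open>The coordinates are integrated out against the order of time: outcome, action, context.
  Conditional independence lets the outcome kernel depend on the current context and action alone,
  the action kernel sees the past through the policy, and the context kernel is constant. The past
  remains present as the coordinate \<open>\<omega>\<close>.\<close>

lemma one_round_nn_integral:
  fixes M H :: "'w measure"
  assumes M: "prob_space M" and PC: "prob_space PC"
    and sub: "subalgebra M H"
    and C: "C \<in> M \<rightarrow>\<^sub>M PC" and A: "A \<in> M \<rightarrow>\<^sub>M MA" and Y: "Y \<in> borel_measurable M"
    and law_C: "distr M PC C = PC"
    and indep_C: "prob_space.indep_set M (sets H) (sets (sigma_of M C PC))"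
    and law_A: "has_cond_law M (sigma_join M H C PC) A MA (\<lambda>\<omega>. policy \<mu> (p \<omega>) (C \<omega>))"
    and law_Y: "has_cond_law M (sigma_of M (\<lambda>\<omega>. (C \<omega>, A \<omega>)) (PC \<Otimes>\<^sub>M MA)) Y borel (\<lambda>\<omega>. PY (C \<omega>) (A \<omega>))"
    and indep_Y: "cond_indep_of M (sigma_of M (\<lambda>\<omega>. (C \<omega>, A \<omega>)) (PC \<Otimes>\<^sub>M MA)) Y borel H"
    and PY: "(\<lambda>(c, a). PY c a) \<in> PC \<Otimes>\<^sub>M MA \<rightarrow>\<^sub>M prob_algebra borel"
    and pol: "(\<lambda>(\<omega>, c). policy \<mu> (p \<omega>) c) \<in> H \<Otimes>\<^sub>M PC \<rightarrow>\<^sub>M prob_algebra MA"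
    and f: "f \<in> borel_measurable (H \<Otimes>\<^sub>M obs_space PC MA)"
  shows "(\<integral>\<^sup>+\<omega>. f (\<omega>, C \<omega>, A \<omega>, Y \<omega>) \<partial>M)
    = (\<integral>\<^sup>+\<omega>. \<integral>\<^sup>+c. \<integral>\<^sup>+a. \<integral>\<^sup>+y. f (\<omega>, c, a, y) \<partial>PY c a \<partial>policy \<mu> (p \<omega>) c \<partial>PC \<partial>M)"
proof -
  interpret prob_space M by fact
  have idH [measurable]: "(\<lambda>\<omega>. \<omega>) \<in> M \<rightarrow>\<^sub>M H" by (rule measurable_ident_subalgebra[OF sub])
  note [measurable] = C A Y
  have fm [measurable]: "f \<in> borel_measurable (H \<Otimes>\<^sub>M (PC \<Otimes>\<^sub>M (MA \<Otimes>\<^sub>M borel)))"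
    using f by (simp add: obs_space_def)
  define \<kappa>Y where "\<kappa>Y = (\<lambda>w :: 'w \<times> _. PY (fst (snd w)) (snd (snd w)) :: real measure)"
  have \<kappa>Y: "\<kappa>Y \<in> H \<Otimes>\<^sub>M (PC \<Otimes>\<^sub>M MA) \<rightarrow>\<^sub>M prob_algebra borel"
    unfolding \<kappa>Y_def using measurable_compose[OF measurable_snd PY, of H] by (simp add: case_prod_beta')
  define fY where "fY = (\<lambda>(w, y). f (fst w, fst (snd w), snd (snd w), y))"
  have fY [measurable]: "fY \<in> borel_measurable ((H \<Otimes>\<^sub>M (PC \<Otimes>\<^sub>M MA)) \<Otimes>\<^sub>M borel)"
    unfolding fY_def by measurable
  define \<kappa>A where "\<kappa>A = (\<lambda>(\<omega>, c). policy \<mu> (p \<omega>) c)"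
  have \<kappa>A: "\<kappa>A \<in> H \<Otimes>\<^sub>M PC \<rightarrow>\<^sub>M prob_algebra MA"
    using pol by (simp add: \<kappa>A_def)
  define fA where "fA = (\<lambda>(w, a). \<integral>\<^sup>+y. f (fst w, snd w, a, y) \<partial>PY (snd w) a)"
  have fA [measurable]: "fA \<in> borel_measurable ((H \<Otimes>\<^sub>M PC) \<Otimes>\<^sub>M MA)"
    unfolding fA_def case_prod_beta'
  proof (rule nn_integral_measurable_subprob_algebra2[where N = borel])
    show "(\<lambda>w. PY (snd (fst w)) (snd w)) \<in> (H \<Otimes>\<^sub>M PC) \<Otimes>\<^sub>M MA \<rightarrow>\<^sub>M subprob_algebra borel"
      using measurable_compose[of "\<lambda>w. (snd (fst w), snd w)" "(H \<Otimes>\<^sub>M PC) \<Otimes>\<^sub>M MA", OF _ measurable_prob_algebraD[OF PY]]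
      by (simp add: case_prod_beta')
  qed simp
  define fC where "fC w = (\<integral>\<^sup>+a. fA (w, a) \<partial>\<kappa>A w)" for w
  have fC: "fC \<in> borel_measurable (H \<Otimes>\<^sub>M PC)"
    unfolding fC_def
    by (rule nn_integral_measurable_subprob_algebra2[OF _ measurable_prob_algebraD[OF \<kappa>A]]) simp
  have "(\<integral>\<^sup>+\<omega>. f (\<omega>, C \<omega>, A \<omega>, Y \<omega>) \<partial>M) = (\<integral>\<^sup>+\<omega>. fY ((\<omega>, C \<omega>, A \<omega>), Y \<omega>) \<partial>M)"
    by (simp add: fY_def)
  also have "\<dots> = (\<integral>\<^sup>+\<omega>. \<integral>\<^sup>+y. fY ((\<omega>, C \<omega>, A \<omega>), y) \<partial>\<kappa>Y (\<omega>, C \<omega>, A \<omega>) \<partial>M)"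
  proof (rule nn_integral_joint_kernel[OF M _ Y \<kappa>Y _ fY])
    fix E B assume E: "E \<in> sets (H \<Otimes>\<^sub>M (PC \<Otimes>\<^sub>M MA))" and B: "B \<in> sets (borel :: real measure)"
    show "emeasure M {\<omega>\<in>space M. (\<omega>, C \<omega>, A \<omega>) \<in> E \<and> Y \<omega> \<in> B}
      = (\<integral>\<^sup>+\<omega>. indicator E (\<omega>, C \<omega>, A \<omega>) * emeasure (\<kappa>Y (\<omega>, C \<omega>, A \<omega>)) B \<partial>M)"
      using has_cond_law_cond_indep_rectangle[OF M _ Y sub PY _ indep_Y E B] law_Y
      by (simp add: \<kappa>Y_def)
  qed simp
  also have "\<dots> = (\<integral>\<^sup>+\<omega>. fA ((\<omega>, C \<omega>), A \<omega>) \<partial>M)"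
    by (simp add: fY_def \<kappa>Y_def fA_def)
  also have "\<dots> = (\<integral>\<^sup>+\<omega>. \<integral>\<^sup>+a. fA ((\<omega>, C \<omega>), a) \<partial>\<kappa>A (\<omega>, C \<omega>) \<partial>M)"
  proof (rule nn_integral_joint_kernel[OF M _ A \<kappa>A _ fA])
    show "emeasure M {\<omega>\<in>space M. (\<omega>, C \<omega>) \<in> E \<and> A \<omega> \<in> B}
      = (\<integral>\<^sup>+\<omega>. indicator E (\<omega>, C \<omega>) * emeasure (\<kappa>A (\<omega>, C \<omega>)) B \<partial>M)"
      if "E \<in> sets (H \<Otimes>\<^sub>M PC)" "B \<in> sets MA" for E B
      by (rule has_cond_law_rectangle[OF M _ A \<kappa>A _ that])
        (use law_A in \<open>simp_all add: sigma_join_def \<kappa>A_def\<close>)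
  qed simp
  also have "\<dots> = (\<integral>\<^sup>+\<omega>. fC (\<omega>, C \<omega>) \<partial>M)" by (simp add: fC_def)
  also have "\<dots> = (\<integral>\<^sup>+\<omega>. \<integral>\<^sup>+c. fC (\<omega>, c) \<partial>PC \<partial>M)"
  proof (rule nn_integral_joint_kernel[OF M idH C _ _ fC])
    show "(\<lambda>\<omega>. PC) \<in> H \<rightarrow>\<^sub>M prob_algebra PC"
      using PC by (simp add: space_prob_algebra)
    show "emeasure M {\<omega>\<in>space M. \<omega> \<in> E \<and> C \<omega> \<in> B} = (\<integral>\<^sup>+\<omega>. indicator E \<omega> * emeasure PC B \<partial>M)"
      if "E \<in> sets H" "B \<in> sets PC" for E B
      by (rule indep_set_rectangle[OF C sub indep_C law_C that])
  qed
  finally show ?thesis by (simp add: fC_def fA_def \<kappa>A_def)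
qed

text \<open>Both policies have densities with respect to the same base measure
  \<open>\<mu> c\<close>, so the integrands can be compared pointwise. Where \<open>p c a\<close>
  vanishes so does \<open>q c a\<close>, which makes division by zero harmless.\<close>

lemma nn_integral_policy_change:
  assumes sets: "sets (\<mu> c) = sets MA"
    and p: "p c \<in> borel_measurable MA" and q: "q c \<in> borel_measurable MA"
    and nn: "\<And>a. 0 \<le> p c a" "\<And>a. 0 \<le> q c a"
    and pos: "\<And>a. 0 < q c a \<Longrightarrow> 0 < p c a"
    and g: "g \<in> borel_measurable MA"
  shows "(\<integral>\<^sup>+a. ennreal (q c a / p c a) * g a \<partial>policy \<mu> p c) = (\<integral>\<^sup>+a. g a \<partial>policy \<mu> q c)"
proof -
  have [measurable]: "p c \<in> borel_measurable (\<mu> c)" "q c \<in> borel_measurable (\<mu> c)" "g \<in> borel_measurable (\<mu> c)"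
    using p q g by (simp_all cong: measurable_cong_sets add: sets)
  have "ennreal (p c a) * (ennreal (q c a / p c a) * g a) = ennreal (q c a) * g a" for a
  proof (cases "q c a = 0")
    case False
    then have "0 < p c a" using pos nn(2) by (simp add: order.strict_iff_order)
    then have "ennreal (p c a) * ennreal (q c a / p c a) = ennreal (q c a)"
      using nn by (simp add: ennreal_mult[symmetric])
    then show ?thesis by (simp add: mult.assoc[symmetric])
  qed simp
  then show ?thesis unfolding policy_def by (simp add: nn_integral_density)
qed

text \<open>The cancellation of the behaviour density is carried out for almost every
  \<open>\<omega>\<close> inside the iterated integral. The integrand may depend on the past, which
  later admits random but predictable factors.\<close>

lemma one_round_change_of_measure:
  assumes M: "prob_space M" and PC: "prob_space PC" and spC: "space PC = UNIV" and spA: "space MA = UNIV"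
    and sub: "subalgebra M H"
    and C: "C \<in> M \<rightarrow>\<^sub>M PC" and A: "A \<in> M \<rightarrow>\<^sub>M MA" and Y: "Y \<in> borel_measurable M"
    and law_C: "distr M PC C = PC"
    and indep_C: "prob_space.indep_set M (sets H) (sets (sigma_of M C PC))"
    and law_A: "has_cond_law M (sigma_join M H C PC) A MA (\<lambda>\<omega>. policy \<mu> (p \<omega>) (C \<omega>))"
    and law_Y: "has_cond_law M (sigma_of M (\<lambda>\<omega>. (C \<omega>, A \<omega>)) (PC \<Otimes>\<^sub>M MA)) Y borel (\<lambda>\<omega>. PY (C \<omega>) (A \<omega>))"
    and indep_Y: "cond_indep_of M (sigma_of M (\<lambda>\<omega>. (C \<omega>, A \<omega>)) (PC \<Otimes>\<^sub>M MA)) Y borel H"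
    and PY: "(\<lambda>(c, a). PY c a) \<in> PC \<Otimes>\<^sub>M MA \<rightarrow>\<^sub>M prob_algebra borel"
    and pe: "cond_density PC MA \<mu> pe"
    and p: "random_cond_density H PC MA \<mu> p"
    and pos: "AE \<omega> in M. \<forall>c a. 0 < pe c a \<longrightarrow> 0 < p \<omega> c a"
    and f: "f \<in> borel_measurable (H \<Otimes>\<^sub>M obs_space PC MA)"
  shows "(\<integral>\<^sup>+\<omega>. ennreal (pe (C \<omega>) (A \<omega>) / p \<omega> (C \<omega>) (A \<omega>)) * f (\<omega>, C \<omega>, A \<omega>, Y \<omega>) \<partial>M)
    = (\<integral>\<^sup>+\<omega>. \<integral>\<^sup>+z. f (\<omega>, z) \<partial>eval_law PC MA \<mu> PY pe \<partial>M)"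
proof -
  have idH [measurable]: "(\<lambda>\<omega>. \<omega>) \<in> M \<rightarrow>\<^sub>M H" by (rule measurable_ident_subalgebra[OF sub])
  have spH: "space H = space M" using sub by (simp add: subalgebra_def)
  have fm [measurable]: "f \<in> borel_measurable (H \<Otimes>\<^sub>M (PC \<Otimes>\<^sub>M (MA \<Otimes>\<^sub>M borel)))"
    using f by (simp add: obs_space_def)
  have pol: "(\<lambda>(\<omega>, c). policy \<mu> (p \<omega>) c) \<in> H \<Otimes>\<^sub>M PC \<rightarrow>\<^sub>M prob_algebra MA"
    and pm: "(\<lambda>(\<omega>, c, a). p \<omega> c a) \<in> borel_measurable (H \<Otimes>\<^sub>M PC \<Otimes>\<^sub>M MA)"
    and p0: "\<And>\<omega> c a. 0 \<le> p \<omega> c a"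
    using p unfolding random_cond_density_def by auto
  have polE: "policy \<mu> pe \<in> PC \<rightarrow>\<^sub>M prob_algebra MA"
    and pem: "(\<lambda>(c, a). pe c a) \<in> borel_measurable (PC \<Otimes>\<^sub>M MA)"
    and pe0: "\<And>c a. 0 \<le> pe c a"
    using pe unfolding cond_density_def by auto
  have sets\<mu>: "sets (\<mu> c) = sets MA" for c
    using measurable_space[OF polE, of c] by (simp add: spC space_prob_algebra policy_def)
  have pem_c: "pe c \<in> borel_measurable MA" for c
    using measurable_compose[OF measurable_Pair1'[of c PC MA] pem] by (simp add: spC)
  have pm_c: "p \<omega> c \<in> borel_measurable MA" if "\<omega> \<in> space M" for \<omega> c
    using measurable_compose[of "\<lambda>a. (\<omega>, c, a)" MA, OF _ pm] that by (simp add: spC spH)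
  have R [measurable]: "(\<lambda>x. pe (fst (snd x)) (fst (snd (snd x))) / p (fst x) (fst (snd x)) (fst (snd (snd x))))
      \<in> borel_measurable (H \<Otimes>\<^sub>M (PC \<Otimes>\<^sub>M (MA \<Otimes>\<^sub>M (borel :: real measure))))"
    using measurable_compose[of "\<lambda>x. (fst (snd x), fst (snd (snd x)))" "H \<Otimes>\<^sub>M (PC \<Otimes>\<^sub>M (MA \<Otimes>\<^sub>M (borel :: real measure)))", OF _ pem]
      measurable_compose[of "\<lambda>x. (fst x, fst (snd x), fst (snd (snd x)))" "H \<Otimes>\<^sub>M (PC \<Otimes>\<^sub>M (MA \<Otimes>\<^sub>M (borel :: real measure)))", OF _ pm]
    by simp
  have g: "(\<lambda>a. \<integral>\<^sup>+y. f (\<omega>, c, a, y) \<partial>PY c a) \<in> borel_measurable MA" if "\<omega> \<in> space M" for \<omega> c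
  proof (rule nn_integral_measurable_subprob_algebra2[where N = borel])
    show "(\<lambda>a. PY c a) \<in> MA \<rightarrow>\<^sub>M subprob_algebra borel"
      using measurable_compose[OF measurable_Pair1'[of c PC MA] measurable_prob_algebraD[OF PY]] by (simp add: spC)
    show "(\<lambda>(a, y). f (\<omega>, c, a, y)) \<in> borel_measurable (MA \<Otimes>\<^sub>M borel)"
      using that by (simp add: spC spH case_prod_beta')
  qed
  have yc: "(\<integral>\<^sup>+y. ennreal k * f (\<omega>, c, a, y) \<partial>PY c a) = ennreal k * (\<integral>\<^sup>+y. f (\<omega>, c, a, y) \<partial>PY c a)"
    if "\<omega> \<in> space M" for k \<omega> c a
  proof (rule nn_integral_cmult)
    have "sets (PY c a) = sets borel"
      using measurable_space[OF PY, of "(c, a)"] by (simp add: spC spA space_pair_measure space_prob_algebra)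
    then show "(\<lambda>y. f (\<omega>, c, a, y)) \<in> borel_measurable (PY c a)"
      using that by (subst measurable_cong_sets[OF _ refl, of _ borel]) (simp_all add: spC spA spH)
  qed
  define g where "g x = ennreal (pe (fst (snd x)) (fst (snd (snd x))) / p (fst x) (fst (snd x)) (fst (snd (snd x)))) * f x" for x
  have g_meas: "g \<in> borel_measurable (H \<Otimes>\<^sub>M obs_space PC MA)"
    unfolding g_def by (simp add: obs_space_def)
  have "(\<integral>\<^sup>+\<omega>. ennreal (pe (C \<omega>) (A \<omega>) / p \<omega> (C \<omega>) (A \<omega>)) * f (\<omega>, C \<omega>, A \<omega>, Y \<omega>) \<partial>M)
    = (\<integral>\<^sup>+\<omega>. g (\<omega>, C \<omega>, A \<omega>, Y \<omega>) \<partial>M)"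
    by (simp add: g_def)
  also have "\<dots> = (\<integral>\<^sup>+\<omega>. \<integral>\<^sup>+c. \<integral>\<^sup>+a. \<integral>\<^sup>+y. g (\<omega>, c, a, y) \<partial>PY c a \<partial>policy \<mu> (p \<omega>) c \<partial>PC \<partial>M)"
    by (rule one_round_nn_integral[OF M PC sub C A Y law_C indep_C law_A law_Y indep_Y PY pol g_meas])
  also have "\<dots> = (\<integral>\<^sup>+\<omega>. \<integral>\<^sup>+z. f (\<omega>, z) \<partial>eval_law PC MA \<mu> PY pe \<partial>M)"
  proof (rule nn_integral_cong_AE, rule AE_mp[OF pos], rule AE_I2, rule impI)
    fix \<omega> assume w: "\<omega> \<in> space M" and pos: "\<forall>c a. 0 < pe c a \<longrightarrow> 0 < p \<omega> c a"
    have fz: "(\<lambda>z. f (\<omega>, z)) \<in> borel_measurable (obs_space PC MA)"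
      using f w spH by (auto intro!: measurable_compose[OF measurable_Pair1'])
    have "(\<integral>\<^sup>+a. \<integral>\<^sup>+y. g (\<omega>, c, a, y) \<partial>PY c a \<partial>policy \<mu> (p \<omega>) c)
        = (\<integral>\<^sup>+a. \<integral>\<^sup>+y. f (\<omega>, c, a, y) \<partial>PY c a \<partial>policy \<mu> pe c)" for c
      unfolding g_def fst_conv snd_conv yc[OF w]
      by (rule nn_integral_policy_change[of \<mu> c MA "p \<omega>" pe])
        (use pos p0 pe0 g[OF w] pm_c[OF w] pem_c sets\<mu> in auto)
    then show "(\<integral>\<^sup>+c. \<integral>\<^sup>+a. \<integral>\<^sup>+y. g (\<omega>, c, a, y) \<partial>PY c a \<partial>policy \<mu> (p \<omega>) c \<partial>PC)
        = (\<integral>\<^sup>+z. f (\<omega>, z) \<partial>eval_law PC MA \<mu> PY pe)"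
      unfolding nn_integral_eval_law(1)[OF PC PY polE fz] by simp
  qed
  finally show ?thesis .
qed

section \<open>Linearization of the influence function\<close>

lemma deriv_lineI:
  fixes f :: "'v::real_normed_vector \<Rightarrow> real"
  assumes "(f has_derivative blinfun_apply D) (at x)"
  shows "((\<lambda>\<epsilon>::real. f (x + \<epsilon> *\<^sub>R h)) has_real_derivative blinfun_apply D h) (at 0)"
proof -
  have "((\<lambda>\<epsilon>::real. x + \<epsilon> *\<^sub>R h) has_derivative (\<lambda>\<epsilon>. \<epsilon> *\<^sub>R h)) (at 0)"
    by (auto intro!: derivative_eq_intros)
  moreover have "(f has_derivative blinfun_apply D) (at (x + 0 *\<^sub>R h))" using assms by simp
  ultimately have "((\<lambda>\<epsilon>::real. f (x + \<epsilon> *\<^sub>R h)) has_derivative (\<lambda>\<epsilon>. blinfun_apply D (\<epsilon> *\<^sub>R h))) (at 0)"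
    by (rule has_derivative_compose)
  then show ?thesis
    by (simp add: has_field_derivative_def blinfun.scaleR_right mult_commute_abs)
qed

lemma dir_deriv_blinfun:
  assumes "(f has_derivative blinfun_apply D) (at x)"
  shows "dir_deriv f x h = blinfun_apply D h"
  unfolding dir_deriv_def by (rule DERIV_imp_deriv[OF deriv_lineI[OF assms]])

text \<open>Shifting the base point turns differentiability at \<open>0\<close> of each line into differentiability along
  the segment.\<close>

lemma dir_deriv_mvt:
  fixes f :: "'v::real_normed_vector \<Rightarrow> real"
  assumes diff: "\<And>t. 0 \<le> t \<Longrightarrow> t \<le> 1 \<Longrightarrow> (\<lambda>\<epsilon>::real. f (x + t *\<^sub>R h + \<epsilon> *\<^sub>R h)) differentiable (at 0)"
    and bd: "\<And>t. 0 \<le> t \<Longrightarrow> t \<le> 1 \<Longrightarrow> \<bar>dir_deriv f (x + t *\<^sub>R h) h\<bar> \<le> B"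
  shows "\<bar>f (x + h) - f x\<bar> \<le> B"
proof -
  define g where "g t = f (x + t *\<^sub>R h)" for t
  have g: "(g has_real_derivative dir_deriv f (x + t *\<^sub>R h) h) (at t)" if "0 \<le> t" "t \<le> 1" for t
  proof -
    have "((\<lambda>\<epsilon>. f (x + t *\<^sub>R h + \<epsilon> *\<^sub>R h)) has_real_derivative dir_deriv f (x + t *\<^sub>R h) h) (at 0)"
      unfolding dir_deriv_def using diff[OF that]
      by (simp add: DERIV_deriv_iff_real_differentiable)
    then have "((\<lambda>\<epsilon>. g (\<epsilon> + t)) has_real_derivative dir_deriv f (x + t *\<^sub>R h) h) (at 0)"
      by (simp add: g_def scaleR_add_left algebra_simps)
    then show ?thesis using DERIV_shift[of g _ 0 t] by simp
  qed
  obtain z where z: "0 < z" "z < 1" and "g 1 - g 0 = (1 - 0) * dir_deriv f (x + z *\<^sub>R h) h"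
    using MVT2[of 0 1 g "\<lambda>t. dir_deriv f (x + t *\<^sub>R h) h"] g by auto
  then show ?thesis using bd[of z] by (simp add: g_def)
qed

text \<open>\<open>cont_ext\<close> is a definite description, so existence and uniqueness are both
  due. Coercivity bounds the original norm by the energy norm: \<open>\<iota>\<close> becomes
  injective, and a map that is Lipschitz for the original norm becomes Lipschitz on the dense range
  of \<open>\<iota>\<close>, from which it extends in exactly one way.\<close>

lemma is_energy_completion_ext:
  fixes \<iota> :: "'th::real_normed_vector \<Rightarrow> 'h::{real_inner, complete_space}" and f :: "'th \<Rightarrow> real"
  assumes comp: "is_energy_completion H \<iota>" and c: "0 < c" "\<And>h. c * (norm h)\<^sup>2 \<le> H h h"
    and lip: "\<And>h k. \<bar>f h - f k\<bar> \<le> L * norm (h - k)"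
  shows "continuous_on UNIV (cont_ext \<iota> f)" and "cont_ext \<iota> f (\<iota> h) = f h"
proof -
  have lin: "linear \<iota>" and inn: "\<And>u h. inner (\<iota> u) (\<iota> h) = H u h" and dense: "closure (range \<iota>) = UNIV"
    using comp by (auto simp: is_energy_completion_def)
  have low: "norm h \<le> norm (\<iota> h) / sqrt c" for h
  proof -
    have "c * (norm h)\<^sup>2 \<le> (norm (\<iota> h))\<^sup>2" using c(2)[of h] inn[of h h] by (simp add: power2_norm_eq_inner)
    then have "(sqrt c * norm h)\<^sup>2 \<le> (norm (\<iota> h))\<^sup>2" using c(1) by (simp add: power_mult_distrib)
    then have "sqrt c * norm h \<le> norm (\<iota> h)" by (rule power2_le_imp_le) simp
    then show ?thesis using c(1) by (simp add: field_simps)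
  qed
  have L: "\<bar>f h - f k\<bar> \<le> \<bar>L\<bar> / sqrt c * dist (\<iota> h) (\<iota> k)" for h k
  proof -
    have "\<bar>f h - f k\<bar> \<le> \<bar>L\<bar> * norm (h - k)"
      using lip[of h k] by (meson abs_ge_self mult_right_mono norm_ge_zero order_trans)
    also have "\<dots> \<le> \<bar>L\<bar> * (norm (\<iota> (h - k)) / sqrt c)" by (intro mult_left_mono low) auto
    finally show ?thesis by (simp add: dist_norm linear_diff[OF lin])
  qed
  have inj: "inj \<iota>"
  proof (rule injI)
    fix h k assume "\<iota> h = \<iota> k"
    then have "norm (h - k) \<le> 0" using low[of "h - k"] by (simp add: linear_diff[OF lin])
    then show "h = k" by simp
  qed
  have "\<exists>g. continuous_on UNIV g \<and> (\<forall>h. g (\<iota> h) = f h)"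
  proof -
    have "(\<bar>L\<bar> / sqrt c)-lipschitz_on (range \<iota>) (\<lambda>x. f (inv \<iota> x))"
      using L c(1) by (auto simp: lipschitz_on_def inj dist_real_def)
    then have "uniformly_continuous_on (range \<iota>) (\<lambda>x. f (inv \<iota> x))"
      by (rule lipschitz_on_uniformly_continuous)
    then obtain g where g: "uniformly_continuous_on (closure (range \<iota>)) g"
      "\<And>x. x \<in> range \<iota> \<Longrightarrow> f (inv \<iota> x) = g x"
      by (rule uniformly_continuous_on_extension_on_closure) (rule that)
    have "continuous_on UNIV g"
      using uniformly_continuous_imp_continuous[OF g(1)] by (simp add: dense)
    moreover have "g (\<iota> h) = f h" for h
      using g(2)[of "\<iota> h"] inj by simp
    ultimately have "continuous_on UNIV g \<and> (\<forall>h. g (\<iota> h) = f h)" by simp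
    then show ?thesis by blast
  qed
  moreover have "g = g'" if "continuous_on UNIV g \<and> (\<forall>h. g (\<iota> h) = f h)"
    "continuous_on UNIV g' \<and> (\<forall>h. g' (\<iota> h) = f h)" for g g' :: "'h \<Rightarrow> real"
  proof -
    have "closed {x. g x = g' x}" using that by (intro closed_Collect_eq) auto
    moreover have "range \<iota> \<subseteq> {x. g x = g' x}" using that by auto
    ultimately have "closure (range \<iota>) \<subseteq> {x. g x = g' x}" by (rule closure_minimal[rotated])
    then show ?thesis unfolding dense by (intro ext) blast
  qed
  ultimately have "\<exists>!g. continuous_on UNIV g \<and> (\<forall>h. g (\<iota> h) = f h)"
    by (rule ex_ex1I)
  then have "continuous_on UNIV (cont_ext \<iota> f) \<and> (\<forall>h. cont_ext \<iota> f (\<iota> h) = f h)"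
    unfolding cont_ext_def by (rule theI')
  then show "continuous_on UNIV (cont_ext \<iota> f)" "cont_ext \<iota> f (\<iota> h) = f h" by auto
qed


lemma power4_affine_le:
  fixes a b x :: real
  assumes "0 \<le> a" "0 \<le> b" "0 \<le> x"
  shows "(a * x + b) ^ 4 \<le> (a + b) ^ 4 * (x ^ 4 + 1)"
proof -
  have "a * x + b \<le> (a + b) * max x 1"
    unfolding distrib_right using assms mult_left_mono[of x "max x 1" a] mult_left_mono[of 1 "max x 1" b] by simp
  then have "(a * x + b) ^ 4 \<le> ((a + b) * max x 1) ^ 4"
    using assms by (intro power_mono) auto
  also have "\<dots> = (a + b) ^ 4 * (max x 1) ^ 4" by (rule power_mult_distrib)
  also have "\<dots> \<le> (a + b) ^ 4 * (x ^ 4 + 1)"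
    using assms by (intro mult_left_mono) (auto simp: max_def)
  finally show ?thesis .
qed

lemma le_one_plus_power4: "x \<le> 1 + x ^ 4" for x :: real
proof -
  have "0 \<le> (x\<^sup>2 - 1/2)\<^sup>2 + (x - 1/2)\<^sup>2" by simp
  also have "\<dots> = x ^ 4 - x + 1/2" by (simp add: power2_eq_square power4_eq_xxxx algebra_simps)
  finally show ?thesis by simp
qed

text \<open>Condenses the assumptions on the loss into one envelope \<open>Q\<close> with a fourth
  moment, which bounds both the influence function and its rate of change near the truth. Estimates
  that involve the representer are first obtained for directions in the original space and then pass
  to the completion along approximating sequences.\<close>

lemma influence_properties:
  fixes l :: "'th::real_normed_vector \<Rightarrow> 'up::real_normed_vector \<Rightarrow> 'z \<Rightarrow> real"
    and \<iota> :: "'th \<Rightarrow> 'h::{real_inner, complete_space}"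
  assumes P: "prob_space P"
    and m_meas: "m \<theta>0 \<in> borel_measurable P" and l_meas: "\<And>\<theta> \<eta>. l \<theta> \<eta> \<in> borel_measurable P"
    and regular: "regularity P l m \<theta>0 \<eta>0" and env: "envelope P l m \<theta>0 \<eta>0"
    and comp: "is_energy_completion (hessian P l \<theta>0 \<eta>0) \<iota>"
  obtains Q \<delta> where "0 < \<delta>" "\<delta> \<le> 1" "Q \<in> borel_measurable P" "integrable P (\<lambda>z. Q z ^ 4)" "\<And>z. 1 \<le> Q z"
    "\<And>z. \<bar>influence P l m \<theta>0 \<eta>0 \<iota> \<alpha>0 z\<bar> \<le> Q z"
    "\<And>\<theta> \<eta> \<alpha> \<psi> z. norm (\<theta> - \<theta>0) \<le> \<delta> \<Longrightarrow> norm (\<eta> - \<eta>0) \<le> \<delta> \<Longrightarrow> cont_ext \<iota> norm (\<iota> \<alpha> - \<alpha>0) \<le> \<delta> \<Longrightarrow>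
       \<bar>influence_hat l m \<theta> \<eta> \<alpha> \<psi> z - influence P l m \<theta>0 \<eta>0 \<iota> \<alpha>0 z\<bar>
       \<le> Q z * (norm (\<theta> - \<theta>0) + norm (\<eta> - \<eta>0) + cont_ext \<iota> norm (\<iota> \<alpha> - \<alpha>0) + \<bar>\<psi> - Psi P m \<theta>0\<bar>)"
    "influence P l m \<theta>0 \<eta>0 \<iota> \<alpha>0 \<in> borel_measurable P"
    "(\<integral>z. influence P l m \<theta>0 \<eta>0 \<iota> \<alpha>0 z \<partial>P) = 0"
    "continuous_on UNIV (\<lambda>\<alpha>. cont_ext \<iota> norm (\<iota> \<alpha> - \<alpha>0))"
    "\<And>x. 0 \<le> cont_ext \<iota> norm x"
proof -
  interpret prob_space P by fact
  obtain r1 r2 c where r1: "0 < r1" and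
    l2: "\<And>\<eta> z. twice_frechet_differentiable_on (\<lambda>\<theta>. l \<theta> \<eta> z) (ball \<theta>0 r1)" and
    m1: "\<And>\<theta> z. \<theta> \<in> ball \<theta>0 r1 \<Longrightarrow> (\<lambda>\<theta>. m \<theta> z) differentiable (at \<theta>)" and
    r2: "0 < r2" and
    le: "\<And>\<theta> \<eta> z h v. \<theta> \<in> ball \<theta>0 r2 \<Longrightarrow> \<eta> \<in> ball \<eta>0 r2 \<Longrightarrow>
      (\<lambda>\<delta>::real. d_theta l \<theta> (\<eta> + \<delta> *\<^sub>R v) z h) differentiable (at 0)" and
    foc: "\<And>h. (\<integral>z. d_theta l \<theta>0 \<eta>0 z h \<partial>P) = 0" and
    c: "0 < c" "\<And>h. c * (norm h)\<^sup>2 \<le> hessian P l \<theta>0 \<eta>0 h h"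
    using regular unfolding regularity_def by metis
  obtain eT eU C where eT: "0 < eT" and eU: "0 < eU" and C_meas [measurable]: "C \<in> borel_measurable P"
    and C0': "\<forall>z. 0 \<le> C z" and C4: "integrable P (\<lambda>z. C z ^ 4)"
    and E0: "(\<forall>\<theta> \<theta>' \<eta> \<eta>'. norm (\<theta> - \<theta>0) \<le> eT \<longrightarrow> norm (\<theta>' - \<theta>0) \<le> eT \<longrightarrow>
           norm (\<eta> - \<eta>0) \<le> eU \<longrightarrow> norm (\<eta>' - \<eta>0) \<le> eU \<longrightarrow>
           (\<forall>z h u v.
              \<bar>m \<theta> z\<bar> \<le> C z \<and>
              \<bar>dir_deriv (\<lambda>\<theta>. m \<theta> z) \<theta> h\<bar> \<le> C z * norm h \<and>
              \<bar>d_theta l \<theta>0 \<eta>0 z h\<bar> \<le> C z * norm h \<and>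
              \<bar>d2_theta l \<theta> \<eta> z h u\<bar> \<le> C z * norm h * norm u \<and>
              \<bar>d_eta_theta l \<theta> \<eta> z h v\<bar> \<le> C z * norm h * norm v \<and>
              \<bar>dir_deriv (\<lambda>\<theta>. m \<theta> z) \<theta> h - dir_deriv (\<lambda>\<theta>. m \<theta> z) \<theta>' h\<bar>
                \<le> C z * norm (\<theta> - \<theta>') * norm h \<and>
              \<bar>d_eta_theta l \<theta> \<eta> z h v - d_eta_theta l \<theta>' \<eta>' z h v\<bar>
                \<le> C z * (norm (\<theta> - \<theta>') + norm (\<eta> - \<eta>')) * norm h * norm v \<and>
              \<bar>d2_theta l \<theta> \<eta> z h u - d2_theta l \<theta>' \<eta>' z h u\<bar>
                \<le> C z * (norm (\<theta> - \<theta>') + norm (\<eta> - \<eta>')) * norm h * norm u))"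
    using env unfolding envelope_def by (elim exE conjE bexE) (rule that; assumption)
  have C0: "\<And>z. 0 \<le> C z" using C0' by simp
  have E: "\<forall>z h u v.
              \<bar>m \<theta> z\<bar> \<le> C z \<and>
              \<bar>dir_deriv (\<lambda>\<theta>. m \<theta> z) \<theta> h\<bar> \<le> C z * norm h \<and>
              \<bar>d_theta l \<theta>0 \<eta>0 z h\<bar> \<le> C z * norm h \<and>
              \<bar>d2_theta l \<theta> \<eta> z h u\<bar> \<le> C z * norm h * norm u \<and>
              \<bar>d_eta_theta l \<theta> \<eta> z h v\<bar> \<le> C z * norm h * norm v"
    if "norm (\<theta> - \<theta>0) \<le> eT" "norm (\<eta> - \<eta>0) \<le> eU" for \<theta> \<eta>
    using E0[THEN spec, THEN spec, THEN spec, THEN spec, THEN mp, OF that(1), THEN mp, OF that(1),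
      THEN mp, OF that(2), THEN mp, OF that(2)] by blast
  have E_m: "\<bar>m \<theta> z\<bar> \<le> C z" "\<bar>dir_deriv (\<lambda>\<theta>. m \<theta> z) \<theta> h\<bar> \<le> C z * norm h" if "norm (\<theta> - \<theta>0) \<le> eT" for \<theta> z h
    using E[OF that, of \<eta>0] eU by auto
  have E_l: "\<bar>d_theta l \<theta>0 \<eta>0 z h\<bar> \<le> C z * norm h" for z h
    using E[of \<theta>0 \<eta>0] eU eT by auto
  have E_2: "\<bar>d2_theta l \<theta> \<eta> z h u\<bar> \<le> C z * norm h * norm u" "\<bar>d_eta_theta l \<theta> \<eta> z h v\<bar> \<le> C z * norm h * norm v"
    if "norm (\<theta> - \<theta>0) \<le> eT" "norm (\<eta> - \<eta>0) \<le> eU" for \<theta> \<eta> z h u v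
    using E[OF that] by auto
  have C_int: "integrable P C"
    by (rule Bochner_Integration.integrable_bound[of _ "\<lambda>z. 1 + C z ^ 4"])
      (use C4 le_one_plus_power4 C0 in auto)
  obtain D where D: "\<And>\<eta> z x. x \<in> ball \<theta>0 r1 \<Longrightarrow> ((\<lambda>\<theta>. l \<theta> \<eta> z) has_derivative blinfun_apply (D \<eta> z x)) (at x)"
    "\<And>\<eta> z x. x \<in> ball \<theta>0 r1 \<Longrightarrow> D \<eta> z differentiable (at x)"
    using l2 unfolding twice_frechet_differentiable_on_def by metis
  have dl: "d_theta l x \<eta> z h = blinfun_apply (D \<eta> z x) h" if "x \<in> ball \<theta>0 r1" for x \<eta> z h
    unfolding d_theta_def by (rule dir_deriv_blinfun[OF D(1)[OF that]])
  have t0: "\<theta>0 \<in> ball \<theta>0 r1" using r1 by simp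
  \<comment> \<open>\<open>L z\<close> and \<open>N\<close> are the score at the truth and the
    original norm, both carried to the completion; \<open>L z\<close> inherits the Lipschitz
    constant \<open>C z\<close>.\<close>
  define L where "L z = cont_ext \<iota> (d_theta l \<theta>0 \<eta>0 z)" for z
  define N where "N = cont_ext \<iota> norm"
  have lipL: "\<bar>d_theta l \<theta>0 \<eta>0 z h - d_theta l \<theta>0 \<eta>0 z k\<bar> \<le> C z * norm (h - k)" for z h k
    using E_l[of z "h - k"] by (simp add: dl[OF t0] blinfun.diff_right)
  have lipN: "\<bar>norm h - norm k\<bar> \<le> 1 * norm (h - k)" for h k :: 'th
    by (simp add: norm_triangle_ineq3)
  have cL: "continuous_on UNIV (L z)" and L\<iota>: "L z (\<iota> h) = d_theta l \<theta>0 \<eta>0 z h" for z h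
    unfolding L_def using is_energy_completion_ext[OF comp c lipL] by auto
  have cN: "continuous_on UNIV N" and N\<iota>: "N (\<iota> h) = norm h" for h
    unfolding N_def using is_energy_completion_ext[OF comp c lipN] by auto
  have lin: "linear \<iota>" and inn: "\<And>u h. inner (\<iota> u) (\<iota> h) = hessian P l \<theta>0 \<eta>0 u h" and dense: "closure (range \<iota>) = UNIV"
    using comp by (auto simp: is_energy_completion_def)
  \<comment> \<open>Every point of the completion is a limit of embedded directions; one such
    sequence \<open>s x\<close> is fixed for each \<open>x\<close> and carries all the limit
    arguments below.\<close>
  have "\<exists>s. (\<lambda>n. \<iota> (s n)) \<longlonglongrightarrow> x" for x
  proof -
    have "x \<in> closure (range \<iota>)" using dense by simp
    then obtain y where y: "\<forall>n. y n \<in> range \<iota>" "y \<longlonglongrightarrow> x" unfolding closure_sequential by auto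
    then have "\<forall>n. \<exists>a. y n = \<iota> a" by blast
    then have "\<exists>s. \<forall>n. y n = \<iota> (s n)" by (rule choice)
    then obtain s where "\<forall>n. y n = \<iota> (s n)" ..
    then have "y = (\<lambda>n. \<iota> (s n))" by (intro ext) simp
    with y(2) show ?thesis by (intro exI[of _ s]) simp
  qed
  then have "\<forall>x. \<exists>s. (\<lambda>n. \<iota> (s n)) \<longlonglongrightarrow> x" ..
  then have "\<exists>s. \<forall>x. (\<lambda>n. \<iota> (s x n)) \<longlonglongrightarrow> x" by (rule choice)
  then obtain s where s: "\<And>x. (\<lambda>n. \<iota> (s x n)) \<longlonglongrightarrow> x" by (elim exE) (rule that, erule spec)
  have limN: "(\<lambda>n. N (y n)) \<longlonglongrightarrow> N x" if "y \<longlonglongrightarrow> x" for y x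
    by (rule continuous_on_tendsto_compose[OF cN that]) simp_all
  have limL: "(\<lambda>n. L z (y n)) \<longlonglongrightarrow> L z x" if "y \<longlonglongrightarrow> x" for y x z
    by (rule continuous_on_tendsto_compose[OF cL that]) simp_all
  have N0: "0 \<le> N x" for x
    by (rule LIMSEQ_le_const[OF limN[OF s]]) (simp add: N\<iota>)
  have N_zero: "N 0 = 0" using N\<iota>[of 0] by (simp add: linear_0[OF lin])
  have N_tri: "norm a \<le> N (\<iota> a - x) + N x" for a x
  proof (rule LIMSEQ_le_const)
    show "(\<lambda>n. N (\<iota> a - \<iota> (s x n)) + N (\<iota> (s x n))) \<longlonglongrightarrow> N (\<iota> a - x) + N x"
      by (intro tendsto_intros limN s)
    show "\<exists>n0. \<forall>n\<ge>n0. norm a \<le> N (\<iota> a - \<iota> (s x n)) + N (\<iota> (s x n))"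
      using norm_triangle_sub[of a] by (auto simp: linear_diff[OF lin, symmetric] N\<iota> add.commute)
  qed
  have L_diff: "\<bar>L z (\<iota> a) - L z x\<bar> \<le> C z * N (\<iota> a - x)" for z a x
  proof (rule LIMSEQ_le)
    show "(\<lambda>n. \<bar>L z (\<iota> a) - L z (\<iota> (s x n))\<bar>) \<longlonglongrightarrow> \<bar>L z (\<iota> a) - L z x\<bar>"
      by (intro tendsto_intros limL s)
    show "(\<lambda>n. C z * N (\<iota> a - \<iota> (s x n))) \<longlonglongrightarrow> C z * N (\<iota> a - x)"
      by (intro tendsto_intros limN s)
    show "\<exists>n0. \<forall>n\<ge>n0. \<bar>L z (\<iota> a) - L z (\<iota> (s x n))\<bar> \<le> C z * N (\<iota> a - \<iota> (s x n))"
      using lipL by (auto simp: linear_diff[OF lin, symmetric] N\<iota> L\<iota>)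
  qed
  have L_bd: "\<bar>L z x\<bar> \<le> C z * N x" for z x
  proof (rule LIMSEQ_le)
    show "(\<lambda>n. \<bar>L z (\<iota> (s x n))\<bar>) \<longlonglongrightarrow> \<bar>L z x\<bar>" by (intro tendsto_intros limL s)
    show "(\<lambda>n. C z * N (\<iota> (s x n))) \<longlonglongrightarrow> C z * N x" by (intro tendsto_intros limN s)
    show "\<exists>n0. \<forall>n\<ge>n0. \<bar>L z (\<iota> (s x n))\<bar> \<le> C z * N (\<iota> (s x n))"
      using E_l by (auto simp: N\<iota> L\<iota>)
  qed
  \<comment> \<open>The loss is measurable in \<open>z\<close> for each fixed parameter, so its
    derivative is measurable as a limit of difference quotients with steps
    \<open>1 / Suc n\<close>.\<close>
  have d_meas [measurable]: "(\<lambda>z. d_theta l \<theta>0 \<eta>0 z h) \<in> borel_measurable P" for h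
  proof (rule borel_measurable_LIMSEQ_real)
    show "(\<lambda>n. (l (\<theta>0 + (1 / real (Suc n)) *\<^sub>R h) \<eta>0 z - l \<theta>0 \<eta>0 z) / (1 / real (Suc n))) \<longlonglongrightarrow> d_theta l \<theta>0 \<eta>0 z h" for z
    proof -
      have "((\<lambda>\<epsilon>::real. l (\<theta>0 + \<epsilon> *\<^sub>R h) \<eta>0 z) has_real_derivative d_theta l \<theta>0 \<eta>0 z h) (at 0)"
        using deriv_lineI[OF D(1)[OF t0]] by (simp add: dl[OF t0])
      then have "((\<lambda>e. (l (\<theta>0 + e *\<^sub>R h) \<eta>0 z - l \<theta>0 \<eta>0 z) / e) \<longlongrightarrow> d_theta l \<theta>0 \<eta>0 z h) (at 0)"
        by (simp add: DERIV_def)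
      moreover have "filterlim (\<lambda>n. 1 / real (Suc n)) (at 0) sequentially"
        unfolding filterlim_at using LIMSEQ_inverse_real_of_nat by (auto simp: inverse_eq_divide)
      ultimately show ?thesis by (rule filterlim_compose)
    qed
  qed (use l_meas in simp)
  have L_meas [measurable]: "(\<lambda>z. L z x) \<in> borel_measurable P" for x
    by (rule borel_measurable_LIMSEQ_real[OF limL[OF s]]) (simp add: L\<iota>)
  have L_int: "integrable P (\<lambda>z. L z x)" for x
    by (rule Bochner_Integration.integrable_bound[of _ "\<lambda>z. C z * N x"])
      (use C_int L_bd[of _ x] C0 N0[of x] in \<open>simp_all add: abs_mult\<close>)
  \<comment> \<open>The first-order condition speaks about the original directions. The mean of the
    score at \<open>x\<close> differs from its mean at such a direction by at most the mean of
    \<open>C\<close> times their distance, which can be made arbitrarily small.\<close>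
  have L_zero: "(\<integral>z. L z x \<partial>P) = 0" for x
  proof -
    have "\<bar>\<integral>z. L z x \<partial>P\<bar> \<le> (\<integral>z. C z \<partial>P) * N (\<iota> (s x n) - x)" for n
    proof -
      have "\<bar>\<integral>z. L z x \<partial>P\<bar> = \<bar>\<integral>z. L z (\<iota> (s x n)) - L z x \<partial>P\<bar>"
        by (subst Bochner_Integration.integral_diff[OF L_int L_int]) (simp add: L\<iota> foc)
      also have "\<dots> \<le> (\<integral>z. \<bar>L z (\<iota> (s x n)) - L z x\<bar> \<partial>P)" by (rule integral_abs_bound)
      also have "\<dots> \<le> (\<integral>z. C z * N (\<iota> (s x n) - x) \<partial>P)"
      proof (rule integral_mono)
        show "integrable P (\<lambda>z. \<bar>L z (\<iota> (s x n)) - L z x\<bar>)"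
          by (intro integrable_abs Bochner_Integration.integrable_diff L_int)
        show "integrable P (\<lambda>z. C z * N (\<iota> (s x n) - x))" using C_int by simp
      qed (rule L_diff)
      finally show ?thesis by simp
    qed
    moreover have "(\<lambda>n. (\<integral>z. C z \<partial>P) * N (\<iota> (s x n) - x)) \<longlonglongrightarrow> (\<integral>z. C z \<partial>P) * N (x - x)"
      by (intro tendsto_intros limN s)
    ultimately have "\<bar>\<integral>z. L z x \<partial>P\<bar> \<le> (\<integral>z. C z \<partial>P) * N (x - x)"
      by (intro LIMSEQ_le_const) auto
    then show ?thesis by (simp add: N_zero)
  qed
  have K0: "0 \<le> (\<integral>z. C z \<partial>P)" by (rule Bochner_Integration.integral_nonneg) (rule C0)
  \<comment> \<open>The envelope bounds the Hessian by the mean of \<open>C\<close> times the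
    squared norm, so the embedding is bounded for the original norm. This yields continuity, and
    hence measurability, of the representer error as a function of the estimate.\<close>
  have \<iota>_cont: "continuous_on UNIV \<iota>"
  proof -
    have "norm (\<iota> h) \<le> norm h * sqrt (\<integral>z. C z \<partial>P)" for h
    proof -
      have "hessian P l \<theta>0 \<eta>0 h h \<le> (\<integral>z. \<bar>d2_theta l \<theta>0 \<eta>0 z h h\<bar> \<partial>P)"
        unfolding hessian_def by (rule order_trans[OF abs_ge_self integral_abs_bound])
      also have "\<dots> \<le> (\<integral>z. C z * norm h * norm h \<partial>P)"
      proof (rule integral_mono')
        show "integrable P (\<lambda>z. C z * norm h * norm h)" using C_int by simp
        show "\<bar>d2_theta l \<theta>0 \<eta>0 z h h\<bar> \<le> C z * norm h * norm h" for z
          by (rule E_2) (use eT eU in simp_all)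
        show "0 \<le> C z * norm h * norm h" for z by (simp add: C0)
      qed
      also have "\<dots> = (norm h * sqrt (\<integral>z. C z \<partial>P))\<^sup>2"
        using K0 by (simp add: power_mult_distrib power2_eq_square)
      finally have "(norm (\<iota> h))\<^sup>2 \<le> (norm h * sqrt (\<integral>z. C z \<partial>P))\<^sup>2"
        using inn[of h h] by (simp add: power2_norm_eq_inner)
      then show ?thesis by (rule power2_le_imp_le) (simp add: K0)
    qed
    then have "bounded_linear \<iota>"
      by (intro bounded_linear_intro[where K = "sqrt (\<integral>z. C z \<partial>P)"] linear_add[OF lin] linear_scale[OF lin]) simp
    then show ?thesis by (rule linear_continuous_on)
  qed
  \<comment> \<open>Halving \<open>r1\<close> and \<open>r2\<close> keeps closed balls of radius
    \<open>\<delta>\<close> inside the open balls of differentiability; the envelope bounds already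
    hold on closed balls.\<close>
  define \<delta> where "\<delta> = min 1 (min (r1/2) (min (r2/2) (min eT eU)))"
  have \<delta>: "0 < \<delta>" "\<delta> \<le> 1" "\<delta> < r1" "\<delta> < r2" "\<delta> \<le> eT" "\<delta> \<le> eU"
    using r1 r2 eT eU by (auto simp: \<delta>_def)
  have seg: "norm (t *\<^sub>R h) \<le> d" if "norm h \<le> d" "0 \<le> t" "t \<le> 1" for t d and h :: "'v::real_normed_vector"
    using that mult_mono[of t 1 "norm h" d] by simp
  have m_diff: "\<bar>m \<theta> z - m \<theta>0 z\<bar> \<le> C z * norm (\<theta> - \<theta>0)" if "norm (\<theta> - \<theta>0) \<le> \<delta>" for \<theta> z
  proof -
    have "\<bar>m (\<theta>0 + (\<theta> - \<theta>0)) z - m \<theta>0 z\<bar> \<le> C z * norm (\<theta> - \<theta>0)"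
    proof (rule dir_deriv_mvt[of "\<lambda>\<theta>. m \<theta> z"])
      fix t :: real assume t: "0 \<le> t" "t \<le> 1"
      have n: "norm (t *\<^sub>R (\<theta> - \<theta>0)) \<le> \<delta>" by (rule seg[OF that t])
      have "(\<lambda>\<theta>. m \<theta> z) differentiable at (\<theta>0 + t *\<^sub>R (\<theta> - \<theta>0) + 0 *\<^sub>R (\<theta> - \<theta>0))"
        using n \<delta> by (intro m1) (simp add: dist_norm)
      then show "(\<lambda>\<epsilon>::real. m (\<theta>0 + t *\<^sub>R (\<theta> - \<theta>0) + \<epsilon> *\<^sub>R (\<theta> - \<theta>0)) z) differentiable at 0"
        by (rule differentiable_compose) (auto intro!: derivative_intros)
      show "\<bar>dir_deriv (\<lambda>\<theta>. m \<theta> z) (\<theta>0 + t *\<^sub>R (\<theta> - \<theta>0)) (\<theta> - \<theta>0)\<bar> \<le> C z * norm (\<theta> - \<theta>0)"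
        using n \<delta> by (intro E_m) simp
    qed
    then show ?thesis by simp
  qed
  have l_diff1: "\<bar>d_theta l \<theta> \<eta> z a - d_theta l \<theta>0 \<eta> z a\<bar> \<le> C z * norm (\<theta> - \<theta>0) * norm a"
    if "norm (\<theta> - \<theta>0) \<le> \<delta>" "norm (\<eta> - \<eta>0) \<le> \<delta>" for \<theta> \<eta> z a
  proof -
    have "\<bar>d_theta l (\<theta>0 + (\<theta> - \<theta>0)) \<eta> z a - d_theta l \<theta>0 \<eta> z a\<bar> \<le> C z * norm (\<theta> - \<theta>0) * norm a"
    proof (rule dir_deriv_mvt[of "\<lambda>\<theta>. d_theta l \<theta> \<eta> z a"])
      fix t :: real assume t: "0 \<le> t" "t \<le> 1"
      have n: "norm (t *\<^sub>R (\<theta> - \<theta>0)) \<le> \<delta>" by (rule seg[OF that(1) t])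
      have y: "\<theta>0 + t *\<^sub>R (\<theta> - \<theta>0) \<in> ball \<theta>0 r1" using n \<delta> by (simp add: dist_norm)
      obtain D' where D': "(D \<eta> z has_derivative D') (at (\<theta>0 + t *\<^sub>R (\<theta> - \<theta>0)))"
        using D(2)[OF y] unfolding differentiable_def by blast
      have "((\<lambda>x. blinfun_apply (D \<eta> z x) a) has_derivative (\<lambda>u. blinfun_apply (D' u) a)) (at (\<theta>0 + t *\<^sub>R (\<theta> - \<theta>0)))"
        by (rule bounded_linear.has_derivative[OF blinfun.bounded_linear_left D'])
      then have "((\<lambda>x. d_theta l x \<eta> z a) has_derivative (\<lambda>u. blinfun_apply (D' u) a)) (at (\<theta>0 + t *\<^sub>R (\<theta> - \<theta>0)))"
        by (rule has_derivative_transform_within_open[OF _ open_ball y]) (simp add: dl)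
      then have "(\<lambda>\<theta>. d_theta l \<theta> \<eta> z a) differentiable at (\<theta>0 + t *\<^sub>R (\<theta> - \<theta>0) + 0 *\<^sub>R (\<theta> - \<theta>0))"
        by (auto simp: differentiable_def)
      then show "(\<lambda>\<epsilon>::real. d_theta l (\<theta>0 + t *\<^sub>R (\<theta> - \<theta>0) + \<epsilon> *\<^sub>R (\<theta> - \<theta>0)) \<eta> z a) differentiable at 0"
        by (rule differentiable_compose) (auto intro!: derivative_intros)
      show "\<bar>dir_deriv (\<lambda>\<theta>. d_theta l \<theta> \<eta> z a) (\<theta>0 + t *\<^sub>R (\<theta> - \<theta>0)) (\<theta> - \<theta>0)\<bar> \<le> C z * norm (\<theta> - \<theta>0) * norm a"
        unfolding d2_theta_def[symmetric] using n that \<delta> by (intro E_2(1)) auto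
    qed
    then show ?thesis by simp
  qed
  have l_diff2: "\<bar>d_theta l \<theta>0 \<eta> z a - d_theta l \<theta>0 \<eta>0 z a\<bar> \<le> C z * norm a * norm (\<eta> - \<eta>0)"
    if "norm (\<eta> - \<eta>0) \<le> \<delta>" for \<eta> z a
  proof -
    have "\<bar>d_theta l \<theta>0 (\<eta>0 + (\<eta> - \<eta>0)) z a - d_theta l \<theta>0 \<eta>0 z a\<bar> \<le> C z * norm a * norm (\<eta> - \<eta>0)"
    proof (rule dir_deriv_mvt[of "\<lambda>\<eta>. d_theta l \<theta>0 \<eta> z a"])
      fix t :: real assume t: "0 \<le> t" "t \<le> 1"
      have n: "norm (t *\<^sub>R (\<eta> - \<eta>0)) \<le> \<delta>" by (rule seg[OF that t])
      show "(\<lambda>\<epsilon>::real. d_theta l \<theta>0 (\<eta>0 + t *\<^sub>R (\<eta> - \<eta>0) + \<epsilon> *\<^sub>R (\<eta> - \<eta>0)) z a) differentiable at 0"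
        using n \<delta> by (intro le) (auto simp: dist_norm)
      show "\<bar>dir_deriv (\<lambda>\<eta>. d_theta l \<theta>0 \<eta> z a) (\<eta>0 + t *\<^sub>R (\<eta> - \<eta>0)) (\<eta> - \<eta>0)\<bar> \<le> C z * norm a * norm (\<eta> - \<eta>0)"
        unfolding d_eta_theta_def[symmetric] using n \<delta> by (intro E_2(2)) auto
    qed
    then show ?thesis by simp
  qed
  \<comment> \<open>\<open>N \<alpha>0 + 2\<close> is 1, from the derivative of \<open>m\<close>,
    plus \<open>N \<alpha>0 + 1\<close>, which bounds the norm of an estimated representer within
    distance \<open>\<delta> \<le> 1\<close>. The constant summand absorbs the centering and forces
    \<open>Q\<close> to be at least 1.\<close>
  define Q where "Q z = (N \<alpha>0 + 2) * C z + (1 + \<bar>Psi P m \<theta>0\<bar>)" for z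
  have phi: "influence P l m \<theta>0 \<eta>0 \<iota> \<alpha>0 z = m \<theta>0 z - Psi P m \<theta>0 - L z \<alpha>0" for z
    by (simp add: influence_def L_def)
  note [measurable] = m_meas
  have m_bd: "\<bar>m \<theta>0 z\<bar> \<le> C z" for z using E_m(1)[of \<theta>0] eT by simp
  have m_int: "integrable P (m \<theta>0)"
    by (rule Bochner_Integration.integrable_bound[OF C_int]) (use m_bd C0 in auto)
  have Q_meas: "Q \<in> borel_measurable P" unfolding Q_def by measurable
  have NC: "0 \<le> N \<alpha>0 * C z" for z using N0 C0 by simp
  have Q1: "1 \<le> Q z" for z using NC[of z] C0[of z] by (simp add: Q_def algebra_simps)
  show ?thesis
  proof (rule that[of \<delta> Q])
    show "integrable P (\<lambda>z. Q z ^ 4)"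
    proof (rule Bochner_Integration.integrable_bound)
      show "integrable P (\<lambda>z. (N \<alpha>0 + 2 + (1 + \<bar>Psi P m \<theta>0\<bar>)) ^ 4 * (C z ^ 4 + 1))" using C4 by simp
      show "AE z in P. norm (Q z ^ 4) \<le> norm ((N \<alpha>0 + 2 + (1 + \<bar>Psi P m \<theta>0\<bar>)) ^ 4 * (C z ^ 4 + 1))"
      proof (rule AE_I2)
        fix z
        have "Q z ^ 4 \<le> (N \<alpha>0 + 2 + (1 + \<bar>Psi P m \<theta>0\<bar>)) ^ 4 * (C z ^ 4 + 1)"
          unfolding Q_def using N0[of \<alpha>0] by (intro power4_affine_le C0) simp_all
        then show "norm (Q z ^ 4) \<le> norm ((N \<alpha>0 + 2 + (1 + \<bar>Psi P m \<theta>0\<bar>)) ^ 4 * (C z ^ 4 + 1))"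
          using Q1[of z] by simp
      qed
    qed (use Q_meas in measurable)
    show "\<bar>influence P l m \<theta>0 \<eta>0 \<iota> \<alpha>0 z\<bar> \<le> Q z" for z
      using m_bd[of z] L_bd[of z \<alpha>0] C0[of z] by (simp add: phi Q_def algebra_simps)
    show "influence P l m \<theta>0 \<eta>0 \<iota> \<alpha>0 \<in> borel_measurable P"
      using m_meas by (simp add: phi[abs_def])
    show "(\<integral>z. influence P l m \<theta>0 \<eta>0 \<iota> \<alpha>0 z \<partial>P) = 0"
      by (simp add: phi m_int L_int L_zero prob_space Psi_def)
    show "continuous_on UNIV (\<lambda>\<alpha>. cont_ext \<iota> norm (\<iota> \<alpha> - \<alpha>0))"
      unfolding N_def[symmetric]
      by (rule continuous_on_compose2[OF cN]) (auto intro!: continuous_intros \<iota>_cont)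
    show "0 \<le> cont_ext \<iota> norm x" for x using N0 by (simp add: N_def)
    fix \<theta> \<eta> \<alpha> \<psi> z
    assume th: "norm (\<theta> - \<theta>0) \<le> \<delta>" and et: "norm (\<eta> - \<eta>0) \<le> \<delta>" and al: "cont_ext \<iota> norm (\<iota> \<alpha> - \<alpha>0) \<le> \<delta>"
    let ?a = "norm (\<theta> - \<theta>0)" and ?b = "norm (\<eta> - \<eta>0)" and ?n = "N (\<iota> \<alpha> - \<alpha>0)" and ?p = "\<bar>\<psi> - Psi P m \<theta>0\<bar>"
    have na: "norm \<alpha> \<le> N \<alpha>0 + 1" using N_tri[of \<alpha> \<alpha>0] al \<delta> by (simp add: N_def)
    \<comment> \<open>The parameters are moved to the truth one at a time, \<open>\<theta>\<close>
      before \<open>\<eta>\<close> before \<open>\<alpha>\<close>, so that the mean value argument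
      runs along segments on which a single argument varies.\<close>
    have "\<bar>influence_hat l m \<theta> \<eta> \<alpha> \<psi> z - influence P l m \<theta>0 \<eta>0 \<iota> \<alpha>0 z\<bar>
      \<le> \<bar>m \<theta> z - m \<theta>0 z\<bar> + ?p + \<bar>d_theta l \<theta> \<eta> z \<alpha> - d_theta l \<theta>0 \<eta> z \<alpha>\<bar>
        + \<bar>d_theta l \<theta>0 \<eta> z \<alpha> - d_theta l \<theta>0 \<eta>0 z \<alpha>\<bar> + \<bar>L z (\<iota> \<alpha>) - L z \<alpha>0\<bar>"
      by (simp add: influence_hat_def phi L\<iota>)
    also have "\<dots> \<le> C z * ?a + ?p + C z * ?a * norm \<alpha> + C z * norm \<alpha> * ?b + C z * ?n"
      using m_diff[OF th] l_diff1[OF th et] l_diff2[OF et] L_diff by (intro add_mono) auto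
    also have "\<dots> \<le> C z * ?a + ?p + C z * ?a * (N \<alpha>0 + 1) + C z * (N \<alpha>0 + 1) * ?b + C z * ?n"
      using na C0 by (intro add_mono mult_left_mono mult_right_mono) auto
    also have "\<dots> \<le> Q z * (?a + ?b + ?n + ?p)"
    proof -
      have "Q z * (?a + ?b + ?n + ?p) - (C z * ?a + ?p + C z * ?a * (N \<alpha>0 + 1) + C z * (N \<alpha>0 + 1) * ?b + C z * ?n)
        = C z * ?b + C z * (N \<alpha>0 + 1) * ?n + (N \<alpha>0 + 2) * C z * ?p
          + (1 + \<bar>Psi P m \<theta>0\<bar>) * (?a + ?b + ?n) + \<bar>Psi P m \<theta>0\<bar> * ?p"
        by (simp add: Q_def algebra_simps)
      moreover have "0 \<le> \<dots>"
        by (intro add_nonneg_nonneg mult_nonneg_nonneg C0 N0 norm_ge_zero abs_ge_zero zero_le_one zero_le_numeral)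
      ultimately show ?thesis by linarith
    qed
    finally show "\<bar>influence_hat l m \<theta> \<eta> \<alpha> \<psi> z - influence P l m \<theta>0 \<eta>0 \<iota> \<alpha>0 z\<bar>
      \<le> Q z * (norm (\<theta> - \<theta>0) + norm (\<eta> - \<eta>0) + cont_ext \<iota> norm (\<iota> \<alpha> - \<alpha>0) + \<bar>\<psi> - Psi P m \<theta>0\<bar>)"
      unfolding N_def .
  qed (rule \<delta> Q_meas Q1)+
qed

section \<open>Multiplicative covers\<close>

text \<open>The infimum of a nonempty set of extended naturals is its least element, and a finite
  value excludes the empty set, whose infimum is infinite.\<close>

lemma covering_number_attained:
  assumes "covering_number \<epsilon> G = enat n"
  obtains S where "finite S" "card S = n" "\<And>f. f \<in> G \<Longrightarrow> \<exists>g\<in>S. sup_edist f g \<le> ereal \<epsilon>"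
proof -
  let ?S = "{S. finite S \<and> (\<forall>f\<in>G. \<exists>g\<in>S. sup_edist f g \<le> ereal \<epsilon>)}"
  let ?A = "(\<lambda>S. enat (card S)) ` ?S"
  have eq: "Inf ?A = enat n" using assms by (simp add: covering_number_def)
  have ne: "?A \<noteq> {}"
  proof
    assume "?A = {}"
    then have "Inf ?A = \<infinity>" unfolding Inf_enat_def by (rule if_P)
    then show False using eq by simp
  qed
  then have "\<exists>x. x \<in> ?A" by blast
  then have "(LEAST x. x \<in> ?A) \<in> ?A" by (rule LeastI_ex)
  then have "Inf ?A \<in> ?A" unfolding Inf_enat_def if_not_P[OF ne] .
  then show ?thesis using that eq by auto
qed

lemma sup_edist_leD:
  assumes "sup_edist f g \<le> ereal \<epsilon>"
  shows "f x = g x \<or> \<bar>f x - g x\<bar> \<le> ereal \<epsilon>"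
proof -
  have "(if f x = g x then 0 else \<bar>f x - g x\<bar>) \<le> sup_edist f g"
    unfolding sup_edist_def by (rule SUP_upper) simp
  then show ?thesis using assms order_trans by (auto split: if_splits)
qed

text \<open>Two densities near a common center differ by at most \<open>2 * \<epsilon>\<close> in
  logarithm. A vanishing density has logarithm -\<infinity>, at infinite distance from every real
  center, so zeros can be matched with zeros only.\<close>

lemma log_close_imp_ratio:
  assumes p: "0 \<le> p" and r: "0 \<le> r"
    and "elog (ereal p) = g \<or> \<bar>elog (ereal p) - g\<bar> \<le> ereal \<epsilon>"
    and "elog (ereal r) = g \<or> \<bar>elog (ereal r) - g\<bar> \<le> ereal \<epsilon>"
    and \<epsilon>: "0 \<le> \<epsilon>"
  shows "p \<le> exp (2 * \<epsilon>) * r"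
proof (cases "p = 0")
  case False
  then have p0: "0 < p" using p by simp
  then have lp: "elog (ereal p) = ereal (ln p)" by (simp add: elog_def)
  obtain y where y: "g = ereal y" "\<bar>ln p - y\<bar> \<le> \<epsilon>"
    using assms(3) lp \<epsilon> by (cases g) auto
  have r0: "0 < r"
  proof (rule ccontr)
    assume "\<not> 0 < r"
    then have "elog (ereal r) = -\<infinity>" by (simp add: elog_def)
    then show False using assms(4) y by simp
  qed
  then have "elog (ereal r) = ereal (ln r)" by (simp add: elog_def)
  then have "\<bar>ln r - y\<bar> \<le> \<epsilon>" using assms(4) y(1) \<epsilon> by auto
  then have "ln p \<le> 2 * \<epsilon> + ln r" using y(2) by linarith
  then have "exp (ln p) \<le> exp (2 * \<epsilon> + ln r)" by simp
  then show ?thesis using p0 r0 by (simp add: exp_add)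
qed (use r in simp)

text \<open>Covering centers may lie outside the class and need not be logarithms of densities. Each
  center with a member of the class nearby is replaced by such a member, which doubles the radius
  and explains \<open>2 * \<epsilon>\<close>; the new centers then have every property shared by the
  class, in particular the weight bound.\<close>

lemma finite_multiplicative_cover:
  assumes entropy: "elog (ereal_of_enat (covering_number \<epsilon> (log_class \<P>))) \<le> ereal b"
    and \<epsilon>: "0 \<le> \<epsilon>" and nn: "\<And>p c a. p \<in> \<P> \<Longrightarrow> 0 \<le> p c a"
  obtains R where "R \<subseteq> \<P>" "finite R" "real (card R) \<le> exp b"
    "\<And>p. p \<in> \<P> \<Longrightarrow> \<exists>r\<in>R. \<forall>c a. p c a \<le> exp (2 * \<epsilon>) * r c a \<and> r c a \<le> exp (2 * \<epsilon>) * p c a"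
proof -
  obtain n where n: "covering_number \<epsilon> (log_class \<P>) = enat n"
    using entropy by (cases "covering_number \<epsilon> (log_class \<P>)") (auto simp: elog_def)
  have n_le: "real n \<le> exp b"
  proof (cases "n = 0")
    case False
    then have "ln (real n) \<le> b" using entropy by (simp add: n elog_def)
    then have "exp (ln (real n)) \<le> exp b" by simp
    then show ?thesis using False by simp
  qed simp
  obtain S where S: "finite S" "card S = n" "\<And>f. f \<in> log_class \<P> \<Longrightarrow> \<exists>g\<in>S. sup_edist f g \<le> ereal \<epsilon>"
    using covering_number_attained[OF n] by metis
  define L where "L p = (\<lambda>(c, a). elog (ereal (p c a)))" for p :: "'a \<Rightarrow> 'b \<Rightarrow> real"
  define near where "near g p \<longleftrightarrow> p \<in> \<P> \<and> sup_edist (L p) g \<le> ereal \<epsilon>" for g p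
  define R where "R = (\<lambda>g. SOME p. near g p) ` {g\<in>S. \<exists>p. near g p}"
  have some: "near g (SOME p. near g p)" if "\<exists>p. near g p" for g
    using that by (rule someI_ex)
  show ?thesis
  proof (rule that[of R])
    have "(SOME p. near g p) \<in> \<P>" if "\<exists>p. near g p" for g using some[OF that] by (simp only: near_def)
    then show "R \<subseteq> \<P>" unfolding R_def by blast
    show "finite R" unfolding R_def using S(1) by simp
    have "card R \<le> card S"
      unfolding R_def using S(1) by (intro order_trans[OF card_image_le card_mono]) auto
    then show "real (card R) \<le> exp b" using n_le S(2) by linarith
    fix p assume p: "p \<in> \<P>"
    then have "L p \<in> log_class \<P>" by (auto simp: log_class_def L_def)
    then obtain g where g: "g \<in> S" "sup_edist (L p) g \<le> ereal \<epsilon>" using S(3) by blast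
    then have ex: "\<exists>p. near g p" using p near_def by auto
    define r where "r = (SOME p. near g p)"
    have r: "near g r" unfolding r_def by (rule some[OF ex])
    have rR: "r \<in> R" unfolding R_def r_def using g(1) ex by auto
    have "p c a \<le> exp (2 * \<epsilon>) * r c a \<and> r c a \<le> exp (2 * \<epsilon>) * p c a" for c a
    proof -
      have 1: "L p (c, a) = g (c, a) \<or> \<bar>L p (c, a) - g (c, a)\<bar> \<le> ereal \<epsilon>" by (rule sup_edist_leD[OF g(2)])
      have 2: "L r (c, a) = g (c, a) \<or> \<bar>L r (c, a) - g (c, a)\<bar> \<le> ereal \<epsilon>"
        by (rule sup_edist_leD) (use r near_def in simp)
      have rP: "r \<in> \<P>" using r near_def by simp
      show ?thesis
        using log_close_imp_ratio[OF nn[OF p] nn[OF rP] 1[unfolded L_def prod.case] 2[unfolded L_def prod.case] \<epsilon>]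
          log_close_imp_ratio[OF nn[OF rP] nn[OF p] 2[unfolded L_def prod.case] 1[unfolded L_def prod.case] \<epsilon>] by simp
    qed
    then show "\<exists>r\<in>R. \<forall>c a. p c a \<le> exp (2 * \<epsilon>) * r c a \<and> r c a \<le> exp (2 * \<epsilon>) * p c a" using rR by blast
  qed
qed

section \<open>Averages of importance-weighted rounds\<close>

text \<open>Partial sums of nonnegative terms increase, so the terms that are kept form an initial
  block whose sum is still below the threshold.\<close>

lemma sum_stopped_le:
  fixes x :: "nat \<Rightarrow> real"
  assumes "\<And>s. 0 \<le> x s" "0 \<le> d"
  shows "(\<Sum>s=1..n. if (\<Sum>r=1..s. x r) \<le> d then x s else 0) \<le> d"
proof (induction n)
  case (Suc n)
  show ?case
  proof (cases "(\<Sum>r=1..Suc n. x r) \<le> d")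
    case True
    have "(\<Sum>s=1..Suc n. if (\<Sum>r=1..s. x r) \<le> d then x s else 0) \<le> (\<Sum>s=1..Suc n. x s)"
      by (rule sum_mono) (simp add: assms)
    then show ?thesis using True by linarith
  qed (use Suc in simp)
qed (use assms in simp)

text \<open>A Young-type splitting with free scale: it trades a first power for a fourth power,
  whose sum is what the rates control, at the price of a constant in each round.\<close>

lemma fourth_power_split:
  fixes a \<tau> :: real
  assumes "0 \<le> a" "0 < \<tau>"
  shows "a \<le> 1 / \<tau> + \<tau> ^ 3 * a ^ 4"
proof -
  have "\<tau> * a \<le> 1 + (\<tau> * a) ^ 4" by (rule le_one_plus_power4)
  then have "\<tau> * a \<le> \<tau> * (1 / \<tau> + \<tau> ^ 3 * a ^ 4)"
    using assms by (simp add: algebra_simps power_mult_distrib power4_eq_xxxx power3_eq_cube)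
  then show ?thesis using assms by simp
qed

text \<open>The analogue for the centering error, where the controlled sum is that of squares
  divided by the root of the horizon; that root is \<open>\<tau>\<^sup>2\<close> in the
  application.\<close>

lemma square_split:
  fixes y \<tau> :: real
  assumes "1 \<le> \<tau>"
  shows "\<bar>y\<bar> + y\<^sup>2 \<le> 1 / \<tau> + 2 * \<tau> ^ 3 * (y\<^sup>2 / \<tau>\<^sup>2)"
proof -
  have "\<tau> * \<bar>y\<bar> \<le> 1 + (\<tau> * \<bar>y\<bar>)\<^sup>2"
    using sum_squares_bound[of 1 "\<tau> * \<bar>y\<bar>"] assms by (simp add: power2_eq_square) (smt (verit) mult_nonneg_nonneg abs_ge_zero)
  then have "\<tau> * \<bar>y\<bar> \<le> \<tau> * (1 / \<tau> + \<tau> * y\<^sup>2)"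
    using assms by (simp add: algebra_simps power2_eq_square)
  then have "\<bar>y\<bar> \<le> 1 / \<tau> + \<tau> * y\<^sup>2" using assms by simp
  moreover have "y\<^sup>2 \<le> \<tau> * y\<^sup>2" using assms mult_right_mono[of 1 \<tau> "y\<^sup>2"] by simp
  moreover have "2 * \<tau> ^ 3 * (y\<^sup>2 / \<tau>\<^sup>2) = 2 * (\<tau> * y\<^sup>2)"
    using assms by (simp add: power3_eq_cube power2_eq_square)
  ultimately show ?thesis by linarith
qed

text \<open>The scale \<open>\<tau> = T powr (1/4)\<close> balances the two contributions: T
  constants \<open>4 / \<tau>\<close>, one inverse scale per error, and
  \<open>2 * \<tau> ^ 3\<close> times a stopped sum of at most 1 are both multiples of
  \<open>\<tau> ^ 3\<close>. The summands of \<open>x\<close> are normalized so that the assumed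
  rates make their sum small in probability.\<close>

lemma stopped_error_sum_le:
  fixes a b k y :: "nat \<Rightarrow> real"
  assumes nn: "\<And>s. 0 \<le> a s" "\<And>s. 0 \<le> b s" "\<And>s. 0 \<le> k s"
    and T: "1 \<le> T" and d: "0 \<le> d" "d \<le> 1"
  defines "x \<equiv> \<lambda>s. a s ^ 4 + b s ^ 4 + k s ^ 4 + (y s)\<^sup>2 / sqrt (real T)"
  shows "(\<Sum>s=1..T. if (\<Sum>r=1..s. x r) \<le> d then a s + b s + k s + \<bar>y s\<bar> + (y s)\<^sup>2 else 0) \<le> 6 * real T powr (3/4)"
proof -
  define \<tau> where "\<tau> = real T powr (1/4)"
  have \<tau>1: "1 \<le> \<tau>" unfolding \<tau>_def using T by (simp add: ge_one_powr_ge_zero)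
  have \<tau>2: "sqrt (real T) = \<tau>\<^sup>2"
    unfolding \<tau>_def using T by (simp add: powr_half_sqrt[symmetric] power2_eq_square powr_add[symmetric])
  have \<tau>3: "real T powr (3/4) = \<tau> ^ 3"
    unfolding \<tau>_def using T by (simp add: power3_eq_cube powr_add[symmetric])
  have \<tau>4: "real T = \<tau> ^ 4"
    unfolding \<tau>_def using T by (simp add: power4_eq_xxxx powr_add[symmetric])
  have x0: "0 \<le> x s" for s unfolding x_def using nn by simp
  let ?c = "\<lambda>s. (\<Sum>r=1..s. x r) \<le> d"
  have "(\<Sum>s=1..T. if ?c s then a s + b s + k s + \<bar>y s\<bar> + (y s)\<^sup>2 else 0)
      \<le> (\<Sum>s=1..T. 4 / \<tau> + 2 * \<tau> ^ 3 * (if ?c s then x s else 0))"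
  proof (rule sum_mono)
    fix s
    have "a s + b s + k s + \<bar>y s\<bar> + (y s)\<^sup>2 \<le> 4 / \<tau> + (\<tau> ^ 3 * (a s ^ 4 + b s ^ 4 + k s ^ 4) + 2 * \<tau> ^ 3 * ((y s)\<^sup>2 / \<tau>\<^sup>2))"
      using fourth_power_split[OF nn(1)[of s], of \<tau>] fourth_power_split[OF nn(2)[of s], of \<tau>]
        fourth_power_split[OF nn(3)[of s], of \<tau>] square_split[OF \<tau>1, of "y s"] \<tau>1
      by (simp add: distrib_left)
    also have "\<dots> \<le> 4 / \<tau> + 2 * \<tau> ^ 3 * x s"
    proof -
      have "0 \<le> \<tau> ^ 3 * (a s ^ 4 + b s ^ 4 + k s ^ 4)" using nn \<tau>1 by simp
      then show ?thesis by (simp add: x_def \<tau>2 algebra_simps)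
    qed
    finally show "(if ?c s then a s + b s + k s + \<bar>y s\<bar> + (y s)\<^sup>2 else 0) \<le> 4 / \<tau> + 2 * \<tau> ^ 3 * (if ?c s then x s else 0)"
      using \<tau>1 by simp
  qed
  also have "\<dots> = 4 * \<tau> ^ 3 + 2 * \<tau> ^ 3 * (\<Sum>s=1..T. if ?c s then x s else 0)"
    using \<tau>1 by (simp add: sum.distrib sum_distrib_left[symmetric] \<tau>4 power4_eq_xxxx power3_eq_cube)
  also have "\<dots> \<le> 4 * \<tau> ^ 3 + 2 * \<tau> ^ 3 * 1"
    using sum_stopped_le[of x d T] x0 d \<tau>1 by (intro add_left_mono mult_left_mono) auto
  finally show ?thesis by (simp add: \<tau>3)
qed

text \<open>\<open>S\<close> stands for three errors of size at most 1, whereas \<open>y\<close> is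
  unbounded. Hence \<open>y\<^sup>2\<close> has to survive while \<open>S\<^sup>2\<close> is
  absorbed into \<open>3 * S\<close>; the constant 8 is \<open>2 * 3 + 2\<close>.\<close>

lemma squares_diff_le:
  fixes u v Q S y :: real
  assumes "\<bar>v\<bar> \<le> Q" "\<bar>u - v\<bar> \<le> Q * (S + \<bar>y\<bar>)" "0 \<le> S" "S \<le> 3" "0 \<le> Q"
  shows "\<bar>u\<^sup>2 - v\<^sup>2\<bar> \<le> 8 * (S + \<bar>y\<bar> + y\<^sup>2) * Q\<^sup>2"
proof -
  let ?x = "S + \<bar>y\<bar>"
  have x0: "0 \<le> ?x" using assms by simp
  have "u\<^sup>2 - v\<^sup>2 = (u - v) * (u - v + 2 * v)" by (simp add: power2_eq_square algebra_simps)
  then have "\<bar>u\<^sup>2 - v\<^sup>2\<bar> = \<bar>u - v\<bar> * \<bar>u - v + 2 * v\<bar>" by (simp add: abs_mult)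
  also have "\<dots> \<le> (Q * ?x) * (Q * ?x + 2 * Q)"
    using assms x0 by (intro mult_mono) auto
  also have "\<dots> = Q\<^sup>2 * (?x\<^sup>2 + 2 * ?x)" by (simp add: power2_eq_square algebra_simps)
  also have "\<dots> \<le> Q\<^sup>2 * (8 * (S + \<bar>y\<bar> + y\<^sup>2))"
  proof (rule mult_left_mono)
    have "?x\<^sup>2 \<le> 2 * S\<^sup>2 + 2 * y\<^sup>2"
      using sum_squares_bound[of S "\<bar>y\<bar>"] by (simp add: power2_sum)
    moreover have "S\<^sup>2 \<le> 3 * S" using assms by (simp add: power2_eq_square mult_right_mono)
    ultimately show "?x\<^sup>2 + 2 * ?x \<le> 8 * (S + \<bar>y\<bar> + y\<^sup>2)"
      using assms(3) zero_le_power2[of y] abs_ge_zero[of y] by argo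
  qed simp
  finally show ?thesis by (simp add: mult_ac)
qed

text \<open>The hypothesis bounds \<open>v\<close> by \<open>(h + \<rho>) / (1 - \<kappa>)\<close>,
  which turns an error relative to \<open>v\<close> into one relative to the denominator
  \<open>h\<close>. No upper bound on \<open>v\<close> enters, and \<open>c\<close> is paid only for
  \<open>\<rho>\<close>.\<close>

lemma ratio_deviation_le:
  fixes v h \<kappa> \<rho> c :: real
  assumes c: "0 < c" "c \<le> h" and v: "\<bar>h - v\<bar> \<le> \<kappa> * v + \<rho>" and \<kappa>: "0 \<le> \<kappa>" "\<kappa> < 1" and \<rho>: "0 \<le> \<rho>"
  shows "\<bar>v / h - 1\<bar> \<le> (\<kappa> + \<rho> / c) / (1 - \<kappa>)"
proof -
  have h: "0 < h" using c by simp
  have vv: "v * (1 - \<kappa>) \<le> h + \<rho>" using v by (simp add: algebra_simps)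
  have "\<bar>h - v\<bar> * (1 - \<kappa>) \<le> (\<kappa> * v + \<rho>) * (1 - \<kappa>)" using v \<kappa> by (intro mult_right_mono) auto
  also have "\<dots> = \<kappa> * (v * (1 - \<kappa>)) + \<rho> * (1 - \<kappa>)" by (simp add: algebra_simps)
  also have "\<dots> \<le> \<kappa> * (h + \<rho>) + \<rho> * (1 - \<kappa>)" using vv \<kappa> by (intro add_right_mono mult_left_mono) auto
  also have "\<dots> = \<kappa> * h + \<rho>" by (simp add: algebra_simps)
  finally have "\<bar>h - v\<bar> \<le> (\<kappa> * h + \<rho>) / (1 - \<kappa>)" using \<kappa> by (simp add: pos_le_divide_eq)
  then have "\<bar>h - v\<bar> / h \<le> (\<kappa> * h + \<rho>) / (1 - \<kappa>) / h" using h by (intro divide_right_mono) auto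
  also have "\<dots> = (\<kappa> + \<rho> / h) / (1 - \<kappa>)" using h by (simp add: field_simps)
  also have "\<dots> \<le> (\<kappa> + \<rho> / c) / (1 - \<kappa>)"
    using \<kappa> \<rho> c h by (intro divide_right_mono add_left_mono divide_left_mono) auto
  also have "\<bar>h - v\<bar> / h = \<bar>v / h - 1\<bar>" using h by (simp add: diff_divide_distrib[symmetric] field_simps abs_divide[symmetric] abs_minus_commute) 
  finally show ?thesis .
qed

text \<open>Transfers concentration from a cover element \<open>r\<close> to a density \<open>g\<close> within a factor \<open>e\<close> of it,
  with an error that is relative to the mean.\<close>

lemma multiplicative_transfer:
  fixes Sg Sr Vg Vr e :: real
  assumes e: "1 \<le> e" and S: "Sg \<le> e * Sr" "Sr \<le> e * Sg" and V: "Vg \<le> e * Vr" "Vr \<le> e * Vg"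
    and V0: "0 \<le> Vg"
  shows "\<bar>Sg - Vg\<bar> \<le> (e\<^sup>2 - 1) * Vg + e * \<bar>Sr - Vr\<bar>"
proof (rule abs_leI)
  have "Sg \<le> e * (Vr + \<bar>Sr - Vr\<bar>)"
    using S(1) e by (intro order_trans[OF S(1) mult_left_mono]) auto
  also have "\<dots> \<le> e * (e * Vg + \<bar>Sr - Vr\<bar>)" using V(2) e by (intro mult_left_mono) auto
  finally show "Sg - Vg \<le> (e\<^sup>2 - 1) * Vg + e * \<bar>Sr - Vr\<bar>"
    by (simp add: power2_eq_square algebra_simps)
  have e2: "1 \<le> e\<^sup>2" using e by simp
  have "Vg \<le> e * Vr" by fact
  also have "\<dots> \<le> e * (Sr + \<bar>Sr - Vr\<bar>)" using e by (intro mult_left_mono) auto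
  also have "\<dots> \<le> e * (e * Sg + \<bar>Sr - Vr\<bar>)" using S(2) e by (intro mult_left_mono) auto
  finally have *: "Vg \<le> e\<^sup>2 * Sg + e * \<bar>Sr - Vr\<bar>" by (simp add: power2_eq_square algebra_simps)
  let ?d = "\<bar>Sr - Vr\<bar>"
  show "- (Sg - Vg) \<le> (e\<^sup>2 - 1) * Vg + e * ?d"
  proof (cases "Vg \<le> Sg")
    case True
    then show ?thesis using e e2 V0 by (smt (verit) mult_nonneg_nonneg abs_ge_zero)
  next
    case False
    \<comment> \<open>The inequality just derived has an error relative to the sample quantity
      \<open>Sg\<close>, which is the smaller of the two in this case.\<close>
    have "(e\<^sup>2 - 1) * Sg \<le> (e\<^sup>2 - 1) * Vg" using False e2 by (intro mult_left_mono) auto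
    then show ?thesis using * by (simp add: algebra_simps)
  qed
qed

text \<open>One horizon reduced to what the probabilistic estimates use: a filtration, observations,
  weights bounded by \<open>B\<close>, and the identity that weighting a round turns it into a fresh
  draw from \<open>P\<close>. Since the integrand in \<open>change_of_measure\<close> may depend on
  the past, the identity encodes conditional expectations.\<close>

locale weighted_rounds = prob_space M for M :: "'w measure" +
  fixes F :: "nat \<Rightarrow> 'w measure" and Z :: "nat \<Rightarrow> 'w \<Rightarrow> 'z" and w :: "nat \<Rightarrow> 'w \<Rightarrow> real"
    and P :: "'z measure" and T :: nat and B :: real
  assumes prob_P: "prob_space P"
    and F_sub: "\<And>t. t \<le> T \<Longrightarrow> subalgebra M (F t)"
    and F_mono: "\<And>s t. s \<le> t \<Longrightarrow> t \<le> T \<Longrightarrow> sets (F s) \<subseteq> sets (F t)"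
    and Z_F: "\<And>t. t \<in> {1..T} \<Longrightarrow> Z t \<in> F t \<rightarrow>\<^sub>M P"
    and w_F: "\<And>t. t \<in> {1..T} \<Longrightarrow> w t \<in> borel_measurable (F t)"
    and w_nonneg: "\<And>t \<omega>. 0 \<le> w t \<omega>"
    and w_le: "\<And>t. t \<in> {1..T} \<Longrightarrow> AE \<omega> in M. w t \<omega> \<le> B"
    and change_of_measure: "\<And>t f. t \<in> {1..T} \<Longrightarrow> f \<in> borel_measurable (F (t - 1) \<Otimes>\<^sub>M P) \<Longrightarrow>
      (\<integral>\<^sup>+\<omega>. ennreal (w t \<omega>) * f (\<omega>, Z t \<omega>) \<partial>M) = (\<integral>\<^sup>+\<omega>. \<integral>\<^sup>+z. f (\<omega>, z) \<partial>P \<partial>M)"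
begin

sublocale P: prob_space P by (rule prob_P)

lemma space_F: "t \<le> T \<Longrightarrow> space (F t) = space M"
  using F_sub by (auto simp: subalgebra_def)

lemma measurable_F_mono:
  "s \<le> t \<Longrightarrow> t \<le> T \<Longrightarrow> f \<in> F s \<rightarrow>\<^sub>M K \<Longrightarrow> f \<in> F t \<rightarrow>\<^sub>M K"
  using F_mono[of s t] by (auto simp: measurable_def space_F)

lemma measurable_F_M: "t \<le> T \<Longrightarrow> f \<in> F t \<rightarrow>\<^sub>M K \<Longrightarrow> f \<in> M \<rightarrow>\<^sub>M K"
  by (rule measurable_from_subalg[OF F_sub])

lemma Z_M [measurable]: "t \<in> {1..T} \<Longrightarrow> Z t \<in> M \<rightarrow>\<^sub>M P"
  using measurable_F_M[OF _ Z_F] by simp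

lemma w_M [measurable]: "t \<in> {1..T} \<Longrightarrow> w t \<in> borel_measurable M"
  using measurable_F_M[OF _ w_F] by simp

lemma pair_F_M:
  assumes t: "t \<in> {1..T}" and f: "f \<in> F (t - 1) \<Otimes>\<^sub>M P \<rightarrow>\<^sub>M K"
  shows "(\<lambda>\<omega>. f (\<omega>, Z t \<omega>)) \<in> M \<rightarrow>\<^sub>M K"
proof -
  have "(\<lambda>\<omega>. (\<omega>, Z t \<omega>)) \<in> M \<rightarrow>\<^sub>M F (t - 1) \<Otimes>\<^sub>M P"
    using t by (intro measurable_Pair measurable_ident_subalgebra F_sub Z_M) auto
  then show ?thesis using f by (rule measurable_compose)
qed

text \<open>Testing the change of measure against past events identifies the conditional
  expectation: it averages over a fresh \<open>z\<close> with \<open>\<omega>\<close> frozen. The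
  deterministic dominating function \<open>h\<close> keeps this average finite, and bounded, for
  every \<open>\<omega>\<close> of the sample space.\<close>

lemma cond_exp_nonneg:
  fixes f :: "'w \<times> 'z \<Rightarrow> real"
  assumes t: "t \<in> {1..T}" and f: "f \<in> borel_measurable (F (t - 1) \<Otimes>\<^sub>M P)" and h: "integrable P h"
    and nn: "\<And>x. 0 \<le> f x" and le: "\<And>\<omega> z. f (\<omega>, z) \<le> h z"
  shows "integrable M (\<lambda>\<omega>. w t \<omega> * f (\<omega>, Z t \<omega>))"
    and "AE \<omega> in M. real_cond_exp M (F (t - 1)) (\<lambda>\<omega>. w t \<omega> * f (\<omega>, Z t \<omega>)) \<omega> = (\<integral>z. f (\<omega>, z) \<partial>P)"
proof -
  have tT: "t - 1 \<le> T" using t by auto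
  interpret S: finite_measure_subalgebra M "F (t - 1)"
    by unfold_locales (rule F_sub[OF tT])
  have h0: "0 \<le> h z" for z using nn le order_trans by blast
  have fZ [measurable]: "(\<lambda>\<omega>. f (\<omega>, Z t \<omega>)) \<in> borel_measurable M" by (rule pair_F_M[OF t f])
  note [measurable] = w_M[OF t] f
  have fw: "(\<lambda>z. f (\<omega>, z)) \<in> borel_measurable P" if "\<omega> \<in> space M" for \<omega>
    by (rule measurable_compose[OF measurable_Pair1' f]) (use that space_F[OF tT] in simp)
  have int_f: "integrable P (\<lambda>z. f (\<omega>, z))" if "\<omega> \<in> space M" for \<omega>
    by (rule Bochner_Integration.integrable_bound[OF h fw[OF that]])
      (use nn le h0 in simp)
  define I where "I \<omega> = (\<integral>z. f (\<omega>, z) \<partial>P)" for \<omega>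
  have I0: "0 \<le> I \<omega>" for \<omega> unfolding I_def by (rule Bochner_Integration.integral_nonneg) (rule nn)
  have I_nn: "(\<integral>\<^sup>+z. ennreal (f (\<omega>, z)) \<partial>P) = ennreal (I \<omega>)" if "\<omega> \<in> space M" for \<omega>
    unfolding I_def by (rule nn_integral_eq_integral[OF int_f[OF that]]) (simp add: nn)
  have I_meas: "I \<in> borel_measurable (F (t - 1))"
    unfolding I_def by (rule P.borel_measurable_lebesgue_integral) (use f in simp)
  then have I_M [measurable]: "I \<in> borel_measurable M" by (rule measurable_F_M[OF tT])
  have I_le: "I \<omega> \<le> (\<integral>z. h z \<partial>P)" if "\<omega> \<in> space M" for \<omega>
    unfolding I_def by (rule integral_mono[OF int_f[OF that] h]) (rule le)
  have I_int: "integrable M I"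
    by (rule integrable_const_bound[where B = "\<integral>z. h z \<partial>P"]) (use I_le I0 in \<open>auto intro!: AE_I2\<close>)
  have eq: "(\<integral>\<^sup>+\<omega>. ennreal (indicator D \<omega> * (w t \<omega> * f (\<omega>, Z t \<omega>))) \<partial>M) = (\<integral>\<^sup>+\<omega>. ennreal (indicator D \<omega> * I \<omega>) \<partial>M)"
    if D: "D \<in> sets (F (t - 1))" for D
  proof -
    have "(\<lambda>x. ennreal (indicator D (fst x) * f x)) \<in> borel_measurable (F (t - 1) \<Otimes>\<^sub>M P)"
      using D by measurable
    from change_of_measure[OF t this]
    have "(\<integral>\<^sup>+\<omega>. ennreal (w t \<omega>) * ennreal (indicator D \<omega> * f (\<omega>, Z t \<omega>)) \<partial>M)
        = (\<integral>\<^sup>+\<omega>. \<integral>\<^sup>+z. ennreal (indicator D \<omega> * f (\<omega>, z)) \<partial>P \<partial>M)" by simp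
    moreover have "ennreal (w t \<omega>) * ennreal (indicator D \<omega> * f (\<omega>, Z t \<omega>))
        = ennreal (indicator D \<omega> * (w t \<omega> * f (\<omega>, Z t \<omega>)))" for \<omega>
      by (simp add: ennreal_mult[symmetric] nn w_nonneg mult_ac)
    moreover have "(\<integral>\<^sup>+\<omega>. \<integral>\<^sup>+z. ennreal (indicator D \<omega> * f (\<omega>, z)) \<partial>P \<partial>M) = (\<integral>\<^sup>+\<omega>. ennreal (indicator D \<omega> * I \<omega>) \<partial>M)"
      by (intro nn_integral_cong) (auto simp: indicator_def I_nn)
    ultimately show ?thesis by simp
  qed
  have "(\<integral>\<^sup>+\<omega>. ennreal (w t \<omega> * f (\<omega>, Z t \<omega>)) \<partial>M) = (\<integral>\<^sup>+\<omega>. ennreal (I \<omega>) \<partial>M)"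
    using eq[OF sets.top] unfolding space_F[OF tT] by (simp cong: nn_integral_cong_simp)
  also have "\<dots> = ennreal (\<integral>\<omega>. I \<omega> \<partial>M)"
    by (rule nn_integral_eq_integral[OF I_int]) (simp add: I0)
  finally show int: "integrable M (\<lambda>\<omega>. w t \<omega> * f (\<omega>, Z t \<omega>))"
    by (intro integrableI_nonneg) (auto simp: nn w_nonneg)
  show "AE \<omega> in M. real_cond_exp M (F (t - 1)) (\<lambda>\<omega>. w t \<omega> * f (\<omega>, Z t \<omega>)) \<omega> = (\<integral>z. f (\<omega>, z) \<partial>P)"
    unfolding I_def[symmetric]
  proof (rule S.real_cond_exp_charact[OF _ int I_int I_meas])
    fix D assume D: "D \<in> sets (F (t - 1))"
    then have [measurable]: "D \<in> sets M" using F_sub[OF tT] by (auto simp: subalgebra_def)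
    show "(\<integral>\<omega>\<in>D. (w t \<omega> * f (\<omega>, Z t \<omega>)) \<partial>M) = (\<integral>\<omega>\<in>D. I \<omega> \<partial>M)"
      unfolding set_lebesgue_integral_def real_scaleR_def
      by (subst (1 2) integral_eq_nn_integral) (auto simp: nn w_nonneg I0 eq[OF D])
  qed
qed

text \<open>Positive and negative parts are dominated by the same \<open>h\<close>, so the
  nonnegative case applies to each.\<close>

lemma cond_exp_weighted:
  fixes f :: "'w \<times> 'z \<Rightarrow> real"
  assumes t: "t \<in> {1..T}" and f: "f \<in> borel_measurable (F (t - 1) \<Otimes>\<^sub>M P)" and h: "integrable P h"
    and le: "\<And>\<omega> z. \<bar>f (\<omega>, z)\<bar> \<le> h z"
  shows "integrable M (\<lambda>\<omega>. w t \<omega> * f (\<omega>, Z t \<omega>))"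
    and "AE \<omega> in M. real_cond_exp M (F (t - 1)) (\<lambda>\<omega>. w t \<omega> * f (\<omega>, Z t \<omega>)) \<omega> = (\<integral>z. f (\<omega>, z) \<partial>P)"
proof -
  have tT: "t - 1 \<le> T" using t by auto
  interpret S: finite_measure_subalgebra M "F (t - 1)"
    by unfold_locales (rule F_sub[OF tT])
  note [measurable] = f
  define f1 f2 where "f1 x = max 0 (f x)" and "f2 x = max 0 (- f x)" for x
  have m: "f1 \<in> borel_measurable (F (t - 1) \<Otimes>\<^sub>M P)" "f2 \<in> borel_measurable (F (t - 1) \<Otimes>\<^sub>M P)"
    unfolding f1_def f2_def by measurable
  have nn: "0 \<le> f1 x" "0 \<le> f2 x" for x by (auto simp: f1_def f2_def)
  have le12: "f1 (\<omega>, z) \<le> h z" "f2 (\<omega>, z) \<le> h z" for \<omega> z using le[of \<omega> z] by (auto simp: f1_def f2_def)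
  have f12: "f x = f1 x - f2 x" for x by (auto simp: f1_def f2_def)
  note c1 = cond_exp_nonneg[OF t m(1) h nn(1) le12(1)] and c2 = cond_exp_nonneg[OF t m(2) h nn(2) le12(2)]
  show "integrable M (\<lambda>\<omega>. w t \<omega> * f (\<omega>, Z t \<omega>))"
    using Bochner_Integration.integrable_diff[OF c1(1) c2(1)] by (simp add: f12 algebra_simps)
  have int_f: "integrable P (\<lambda>z. g (\<omega>, z))" if "\<omega> \<in> space M" "g \<in> borel_measurable (F (t - 1) \<Otimes>\<^sub>M P)"
    "\<And>\<omega> z. \<bar>g (\<omega>, z)\<bar> \<le> h z" for \<omega> and g :: "'w \<times> 'z \<Rightarrow> real"
  proof (rule Bochner_Integration.integrable_bound[OF h])
    show "(\<lambda>z. g (\<omega>, z)) \<in> borel_measurable P"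
      by (rule measurable_compose[OF measurable_Pair1' that(2)]) (use that(1) space_F[OF tT] in simp)
    show "AE z in P. norm (g (\<omega>, z)) \<le> norm (h z)"
    proof (rule AE_I2)
      fix z show "norm (g (\<omega>, z)) \<le> norm (h z)" using that(3)[of \<omega> z] by simp
    qed
  qed
  have "AE \<omega> in M. real_cond_exp M (F (t - 1)) (\<lambda>\<omega>. w t \<omega> * f1 (\<omega>, Z t \<omega>) - w t \<omega> * f2 (\<omega>, Z t \<omega>)) \<omega>
      = real_cond_exp M (F (t - 1)) (\<lambda>\<omega>. w t \<omega> * f1 (\<omega>, Z t \<omega>)) \<omega> - real_cond_exp M (F (t - 1)) (\<lambda>\<omega>. w t \<omega> * f2 (\<omega>, Z t \<omega>)) \<omega>"
    by (rule S.real_cond_exp_diff[OF c1(1) c2(1)])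
  with c1(2) c2(2) AE_space
  show "AE \<omega> in M. real_cond_exp M (F (t - 1)) (\<lambda>\<omega>. w t \<omega> * f (\<omega>, Z t \<omega>)) \<omega> = (\<integral>z. f (\<omega>, z) \<partial>P)"
  proof eventually_elim
    case (elim \<omega>)
    have "(\<integral>z. f (\<omega>, z) \<partial>P) = (\<integral>z. f1 (\<omega>, z) \<partial>P) - (\<integral>z. f2 (\<omega>, z) \<partial>P)"
      unfolding f12
      by (rule Bochner_Integration.integral_diff; rule int_f[OF elim(3)]) (use m nn le12 in simp_all)
    then show ?case using elim by (simp add: f12 right_diff_distrib)
  qed
qed

text \<open>Of the two weights in the square one is bounded by \<open>B\<close>, and the other is
  consumed by the change of measure.\<close>

lemma second_moment_weighted:
  fixes f :: "'z \<Rightarrow> real"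
  assumes t: "t \<in> {1..T}" and f [measurable]: "f \<in> borel_measurable P" and f2: "integrable P (\<lambda>z. (f z)\<^sup>2)"
  shows "integrable M (\<lambda>\<omega>. (w t \<omega> * f (Z t \<omega>))\<^sup>2)"
    and "(\<integral>\<omega>. (w t \<omega> * f (Z t \<omega>))\<^sup>2 \<partial>M) \<le> B * (\<integral>z. (f z)\<^sup>2 \<partial>P)"
proof -
  have tT: "t - 1 \<le> T" using t by auto
  note [measurable] = w_M[OF t] Z_M[OF t]
  interpret S: finite_measure_subalgebra M "F (t - 1)"
    by unfold_locales (rule F_sub[OF tT])
  have m: "(\<lambda>x. (f (snd x))\<^sup>2) \<in> borel_measurable (F (t - 1) \<Otimes>\<^sub>M P)" by measurable
  have i: "integrable M (\<lambda>\<omega>. w t \<omega> * (f (Z t \<omega>))\<^sup>2)"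
    and c: "AE \<omega> in M. real_cond_exp M (F (t - 1)) (\<lambda>\<omega>. w t \<omega> * (f (Z t \<omega>))\<^sup>2) \<omega> = (\<integral>z. (f z)\<^sup>2 \<partial>P)"
    using cond_exp_weighted[OF t m f2] by simp_all
  have "(\<integral>\<omega>. w t \<omega> * (f (Z t \<omega>))\<^sup>2 \<partial>M) = (\<integral>\<omega>. real_cond_exp M (F (t - 1)) (\<lambda>\<omega>. w t \<omega> * (f (Z t \<omega>))\<^sup>2) \<omega> \<partial>M)"
    using S.real_cond_exp_int(2)[OF i] by simp
  also have "\<dots> = (\<integral>\<omega>. (\<integral>z. (f z)\<^sup>2 \<partial>P) \<partial>M)"
    by (rule integral_cong_AE) (use c in simp_all)
  finally have e: "(\<integral>\<omega>. w t \<omega> * (f (Z t \<omega>))\<^sup>2 \<partial>M) = (\<integral>z. (f z)\<^sup>2 \<partial>P)" by (simp add: prob_space)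
  have le: "AE \<omega> in M. (w t \<omega> * f (Z t \<omega>))\<^sup>2 \<le> B * (w t \<omega> * (f (Z t \<omega>))\<^sup>2)"
    using w_le[OF t]
  proof eventually_elim
    case (elim \<omega>)
    have "w t \<omega> * (w t \<omega> * (f (Z t \<omega>))\<^sup>2) \<le> B * (w t \<omega> * (f (Z t \<omega>))\<^sup>2)"
      using elim w_nonneg by (intro mult_right_mono) auto
    then show ?case by (simp add: power2_eq_square mult_ac)
  qed
  show i2: "integrable M (\<lambda>\<omega>. (w t \<omega> * f (Z t \<omega>))\<^sup>2)"
  proof (rule Bochner_Integration.integrable_bound)
    show "integrable M (\<lambda>\<omega>. B * (w t \<omega> * (f (Z t \<omega>))\<^sup>2))" using i by simp
    show "AE \<omega> in M. norm ((w t \<omega> * f (Z t \<omega>))\<^sup>2) \<le> norm (B * (w t \<omega> * (f (Z t \<omega>))\<^sup>2))"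
      using le by eventually_elim simp
  qed measurable
  have "(\<integral>\<omega>. (w t \<omega> * f (Z t \<omega>))\<^sup>2 \<partial>M) \<le> (\<integral>\<omega>. B * (w t \<omega> * (f (Z t \<omega>))\<^sup>2) \<partial>M)"
    by (rule integral_mono_AE[OF i2 _ le]) (use i in simp)
  then show "(\<integral>\<omega>. (w t \<omega> * f (Z t \<omega>))\<^sup>2 \<partial>M) \<le> B * (\<integral>z. (f z)\<^sup>2 \<partial>P)" using e by simp
qed

text \<open>The centred terms are martingale differences, so the cross terms vanish.\<close>

lemma martingale_second_moment:
  fixes f :: "'z \<Rightarrow> real"
  assumes f [measurable]: "f \<in> borel_measurable P" and f2: "integrable P (\<lambda>z. (f z)\<^sup>2)" and n: "n \<le> T"
  defines "\<xi> \<equiv> \<lambda>s \<omega>. w s \<omega> * f (Z s \<omega>) - (\<integral>z. f z \<partial>P)"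
  shows "(\<lambda>\<omega>. \<Sum>s=1..n. \<xi> s \<omega>) \<in> borel_measurable (F n)"
    and "integrable M (\<lambda>\<omega>. (\<Sum>s=1..n. \<xi> s \<omega>)\<^sup>2)"
    and "(\<integral>\<omega>. (\<Sum>s=1..n. \<xi> s \<omega>)\<^sup>2 \<partial>M) \<le> real n * (B * (\<integral>z. (f z)\<^sup>2 \<partial>P))"
proof -
  let ?v = "\<integral>z. f z \<partial>P"
  have f1: "integrable P f"
    by (rule P.square_integrable_imp_integrable[OF f f2])
  have mF: "\<xi> s \<in> borel_measurable (F s)" if "s \<in> {1..T}" for s
    unfolding \<xi>_def using Z_F[OF that] w_F[OF that] by measurable
  have \<xi>_M: "\<xi> s \<in> borel_measurable M" if "s \<in> {1..T}" for s
    using measurable_F_M[OF _ mF[OF that]] that by simp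
  have sumF: "(\<lambda>\<omega>. \<Sum>s=1..n. \<xi> s \<omega>) \<in> borel_measurable (F n)" if "n \<le> T" for n
    by (intro borel_measurable_sum measurable_F_mono[OF _ that mF]) (use that in auto)
  have X1: "integrable M (\<lambda>\<omega>. w s \<omega> * f (Z s \<omega>))"
    and X1c: "AE \<omega> in M. real_cond_exp M (F (s - 1)) (\<lambda>\<omega>. w s \<omega> * f (Z s \<omega>)) \<omega> = ?v" if "s \<in> {1..T}" for s
    using cond_exp_weighted[OF that _ integrable_abs[OF f1], of "\<lambda>x. f (snd x)"] by simp_all
  have \<xi>1: "integrable M (\<xi> s)" if "s \<in> {1..T}" for s
    unfolding \<xi>_def using X1[OF that] by simp
  have \<xi>c: "AE \<omega> in M. real_cond_exp M (F (s - 1)) (\<xi> s) \<omega> = 0" if s: "s \<in> {1..T}" for s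
  proof -
    interpret S: finite_measure_subalgebra M "F (s - 1)"
      by unfold_locales (rule F_sub, use s in auto)
    have "AE \<omega> in M. real_cond_exp M (F (s - 1)) (\<xi> s) \<omega>
        = real_cond_exp M (F (s - 1)) (\<lambda>\<omega>. w s \<omega> * f (Z s \<omega>)) \<omega> - real_cond_exp M (F (s - 1)) (\<lambda>_. ?v) \<omega>"
      unfolding \<xi>_def by (rule S.real_cond_exp_diff[OF X1[OF s]]) simp
    moreover have "AE \<omega> in M. real_cond_exp M (F (s - 1)) (\<lambda>_. ?v) \<omega> = ?v"
      by (rule S.real_cond_exp_F_meas) simp_all
    ultimately show ?thesis using X1c[OF s] by eventually_elim simp
  qed
  have \<xi>2: "integrable M (\<lambda>\<omega>. (\<xi> s \<omega>)\<^sup>2)" "(\<integral>\<omega>. (\<xi> s \<omega>)\<^sup>2 \<partial>M) \<le> B * (\<integral>z. (f z)\<^sup>2 \<partial>P)" if s: "s \<in> {1..T}" for s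
  proof -
    interpret S: finite_measure_subalgebra M "F (s - 1)"
      by unfold_locales (rule F_sub, use s in auto)
    note X2 = second_moment_weighted[OF s f f2]
    have e: "(\<xi> s \<omega>)\<^sup>2 = (w s \<omega> * f (Z s \<omega>))\<^sup>2 - (2 * ?v * (w s \<omega> * f (Z s \<omega>)) - ?v\<^sup>2)" for \<omega>
      by (simp add: \<xi>_def power2_eq_square algebra_simps)
    show "integrable M (\<lambda>\<omega>. (\<xi> s \<omega>)\<^sup>2)" unfolding e using X1[OF s] X2(1) by simp
    have "(\<integral>\<omega>. w s \<omega> * f (Z s \<omega>) \<partial>M) = (\<integral>\<omega>. real_cond_exp M (F (s - 1)) (\<lambda>\<omega>. w s \<omega> * f (Z s \<omega>)) \<omega> \<partial>M)"
      using S.real_cond_exp_int(2)[OF X1[OF s]] by simp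
    also have "\<dots> = (\<integral>\<omega>. ?v \<partial>M)"
      by (rule integral_cong_AE) (use X1c[OF s] in simp_all)
    finally have "(\<integral>\<omega>. w s \<omega> * f (Z s \<omega>) \<partial>M) = ?v" by (simp add: prob_space)
    then have "(\<integral>\<omega>. (\<xi> s \<omega>)\<^sup>2 \<partial>M) = (\<integral>\<omega>. (w s \<omega> * f (Z s \<omega>))\<^sup>2 \<partial>M) - ?v\<^sup>2"
      unfolding e using X1[OF s] X2(1) by (simp add: prob_space power2_eq_square)
    then show "(\<integral>\<omega>. (\<xi> s \<omega>)\<^sup>2 \<partial>M) \<le> B * (\<integral>z. (f z)\<^sup>2 \<partial>P)"
      using X2(2) zero_le_power2[of ?v] by linarith
  qed
  have main: "n \<le> T \<Longrightarrow> integrable M (\<lambda>\<omega>. (\<Sum>s=1..n. \<xi> s \<omega>)\<^sup>2) \<and>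
      (\<integral>\<omega>. (\<Sum>s=1..n. \<xi> s \<omega>)\<^sup>2 \<partial>M) \<le> real n * (B * (\<integral>z. (f z)\<^sup>2 \<partial>P))" for n
  proof (induction n)
    case (Suc n)
    define S where "S \<omega> = (\<Sum>s=1..n. \<xi> s \<omega>)" for \<omega>
    have s: "Suc n \<in> {1..T}" using Suc.prems by simp
    interpret C: finite_measure_subalgebra M "F n"
      by unfold_locales (rule F_sub, use Suc.prems in simp)
    have IH: "integrable M (\<lambda>\<omega>. (S \<omega>)\<^sup>2)" "(\<integral>\<omega>. (S \<omega>)\<^sup>2 \<partial>M) \<le> real n * (B * (\<integral>z. (f z)\<^sup>2 \<partial>P))"
      using Suc by (auto simp: S_def)
    have SF: "S \<in> borel_measurable (F n)" unfolding S_def using sumF[of n] Suc.prems by simp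
    have SM [measurable]: "S \<in> borel_measurable M" using measurable_F_M[OF _ SF] Suc.prems by simp
    note [measurable] = \<xi>_M[OF s]
    have prod: "integrable M (\<lambda>\<omega>. S \<omega> * \<xi> (Suc n) \<omega>)"
    proof (rule Bochner_Integration.integrable_bound)
      show "integrable M (\<lambda>\<omega>. (S \<omega>)\<^sup>2 + (\<xi> (Suc n) \<omega>)\<^sup>2)" using IH(1) \<xi>2(1)[OF s] by simp
      show "AE \<omega> in M. norm (S \<omega> * \<xi> (Suc n) \<omega>) \<le> norm ((S \<omega>)\<^sup>2 + (\<xi> (Suc n) \<omega>)\<^sup>2)"
      proof (rule AE_I2)
        fix \<omega>
        have "2 * \<bar>S \<omega>\<bar> * \<bar>\<xi> (Suc n) \<omega>\<bar> \<le> (S \<omega>)\<^sup>2 + (\<xi> (Suc n) \<omega>)\<^sup>2"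
          using sum_squares_bound[of "\<bar>S \<omega>\<bar>" "\<bar>\<xi> (Suc n) \<omega>\<bar>"] by simp
        moreover have "0 \<le> \<bar>S \<omega>\<bar> * \<bar>\<xi> (Suc n) \<omega>\<bar>" by simp
        ultimately have "\<bar>S \<omega>\<bar> * \<bar>\<xi> (Suc n) \<omega>\<bar> \<le> (S \<omega>)\<^sup>2 + (\<xi> (Suc n) \<omega>)\<^sup>2" by linarith
        then show "norm (S \<omega> * \<xi> (Suc n) \<omega>) \<le> norm ((S \<omega>)\<^sup>2 + (\<xi> (Suc n) \<omega>)\<^sup>2)"
          by (simp add: abs_mult)
      qed
    qed measurable
    have "(\<integral>\<omega>. S \<omega> * \<xi> (Suc n) \<omega> \<partial>M) = (\<integral>\<omega>. S \<omega> * real_cond_exp M (F n) (\<xi> (Suc n)) \<omega> \<partial>M)"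
      using C.real_cond_exp_intg(2)[OF prod SF] by simp
    also have "\<dots> = (\<integral>\<omega>. 0 \<partial>M)"
      by (rule integral_cong_AE) (use \<xi>c[OF s] in auto)
    finally have cross: "(\<integral>\<omega>. S \<omega> * \<xi> (Suc n) \<omega> \<partial>M) = 0" by simp
    have e: "(\<Sum>s=1..Suc n. \<xi> s \<omega>)\<^sup>2 = (S \<omega>)\<^sup>2 + (2 * (S \<omega> * \<xi> (Suc n) \<omega>) + (\<xi> (Suc n) \<omega>)\<^sup>2)" for \<omega>
      by (simp add: S_def power2_eq_square algebra_simps)
    have "(\<integral>\<omega>. (\<Sum>s=1..Suc n. \<xi> s \<omega>)\<^sup>2 \<partial>M) = (\<integral>\<omega>. (S \<omega>)\<^sup>2 \<partial>M) + (\<integral>\<omega>. (\<xi> (Suc n) \<omega>)\<^sup>2 \<partial>M)"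
      unfolding e using prod IH(1) \<xi>2(1)[OF s] cross by simp
    moreover have "integrable M (\<lambda>\<omega>. (\<Sum>s=1..Suc n. \<xi> s \<omega>)\<^sup>2)"
      unfolding e using prod IH(1) \<xi>2(1)[OF s] by simp
    ultimately show ?case using IH(2) \<xi>2(2)[OF s] by (simp add: algebra_simps)
  qed simp
  show "(\<lambda>\<omega>. \<Sum>s=1..n. \<xi> s \<omega>) \<in> borel_measurable (F n)" by (rule sumF[OF n])
  show "integrable M (\<lambda>\<omega>. (\<Sum>s=1..n. \<xi> s \<omega>)\<^sup>2)"
    "(\<integral>\<omega>. (\<Sum>s=1..n. \<xi> s \<omega>)\<^sup>2 \<partial>M) \<le> real n * (B * (\<integral>z. (f z)\<^sup>2 \<partial>P))"
    using main[OF n] by auto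
qed

text \<open>The conditional mean is zero, and in the conditional second moment one weight is
  consumed while the other survives as the function \<open>g\<close> of a fresh observation, with
  the current policy frozen in \<open>\<omega>\<close>.\<close>

lemma cond_variance_weighted:
  fixes \<phi> :: "'z \<Rightarrow> real" and g :: "'w \<times> 'z \<Rightarrow> real"
  assumes t: "t \<in> {1..T}" and \<phi> [measurable]: "\<phi> \<in> borel_measurable P"
    and \<phi>2: "integrable P (\<lambda>z. (\<phi> z)\<^sup>2)" and mean: "(\<integral>z. \<phi> z \<partial>P) = 0"
    and g: "g \<in> borel_measurable (F (t - 1) \<Otimes>\<^sub>M P)"
    and w_eq: "\<And>\<omega>. w t \<omega> = g (\<omega>, Z t \<omega>)"
    and g_bd: "AE \<omega> in M. \<forall>z. 0 \<le> g (\<omega>, z) \<and> g (\<omega>, z) \<le> B"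
  shows "AE \<omega> in M. cond_variance M (F (t - 1)) (\<lambda>\<omega>. w t \<omega> * \<phi> (Z t \<omega>)) \<omega> = (\<integral>z. g (\<omega>, z) * (\<phi> z)\<^sup>2 \<partial>P)"
proof -
  have tT: "t - 1 \<le> T" using t by auto
  interpret S: finite_measure_subalgebra M "F (t - 1)"
    by unfold_locales (rule F_sub[OF tT])
  note [measurable] = w_M[OF t] Z_M[OF t] g
  have \<phi>1: "integrable P \<phi>" by (rule P.square_integrable_imp_integrable[OF \<phi> \<phi>2])
  have X1: "AE \<omega> in M. real_cond_exp M (F (t - 1)) (\<lambda>\<omega>. w t \<omega> * \<phi> (Z t \<omega>)) \<omega> = 0"
    using cond_exp_weighted(2)[OF t _ integrable_abs[OF \<phi>1], of "\<lambda>x. \<phi> (snd x)"] mean by simp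
  \<comment> \<open>Clipping to the interval from 0 to \<open>B\<close> provides the pointwise
    domination that \<open>cond_exp_weighted\<close> asks for; it alters \<open>g\<close> only for a
    null set of \<open>\<omega>\<close>.\<close>
  define c where "c x = max 0 (min (g x) B)" for x
  have c_meas [measurable]: "c \<in> borel_measurable (F (t - 1) \<Otimes>\<^sub>M P)" unfolding c_def by measurable
  have cg: "c (\<omega>, z) = g (\<omega>, z)" if "\<forall>z. 0 \<le> g (\<omega>, z) \<and> g (\<omega>, z) \<le> B" for \<omega> z
    using that by (simp add: c_def)
  have f_meas: "(\<lambda>x. c x * (\<phi> (snd x))\<^sup>2) \<in> borel_measurable (F (t - 1) \<Otimes>\<^sub>M P)" by measurable
  have bd: "\<bar>c (\<omega>, z) * (\<phi> z)\<^sup>2\<bar> \<le> \<bar>B\<bar> * (\<phi> z)\<^sup>2" for \<omega> z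
    unfolding abs_mult by (intro mult_mono) (auto simp: c_def)
  have hint: "integrable P (\<lambda>z. \<bar>B\<bar> * (\<phi> z)\<^sup>2)" using \<phi>2 by simp
  have ce: "AE \<omega> in M. real_cond_exp M (F (t - 1)) (\<lambda>\<omega>. w t \<omega> * (c (\<omega>, Z t \<omega>) * (\<phi> (Z t \<omega>))\<^sup>2)) \<omega>
      = (\<integral>z. c (\<omega>, z) * (\<phi> z)\<^sup>2 \<partial>P)"
    using cond_exp_weighted(2)[OF t f_meas hint] bd by simp
  have fZ: "(\<lambda>\<omega>. c (\<omega>, Z t \<omega>) * (\<phi> (Z t \<omega>))\<^sup>2) \<in> borel_measurable M"
    using pair_F_M[OF t f_meas] by simp
  have "AE \<omega> in M. real_cond_exp M (F (t - 1)) (\<lambda>\<omega>. (w t \<omega> * \<phi> (Z t \<omega>) - real_cond_exp M (F (t - 1)) (\<lambda>\<omega>. w t \<omega> * \<phi> (Z t \<omega>)) \<omega>)\<^sup>2) \<omega>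
      = real_cond_exp M (F (t - 1)) (\<lambda>\<omega>. w t \<omega> * (c (\<omega>, Z t \<omega>) * (\<phi> (Z t \<omega>))\<^sup>2)) \<omega>"
  proof (rule S.real_cond_exp_cong)
    show "AE \<omega> in M. (w t \<omega> * \<phi> (Z t \<omega>) - real_cond_exp M (F (t - 1)) (\<lambda>\<omega>. w t \<omega> * \<phi> (Z t \<omega>)) \<omega>)\<^sup>2
      = w t \<omega> * (c (\<omega>, Z t \<omega>) * (\<phi> (Z t \<omega>))\<^sup>2)"
      using X1 g_bd
    proof eventually_elim
      case (elim \<omega>)
      then have "c (\<omega>, Z t \<omega>) = w t \<omega>" by (simp add: cg w_eq)
      then show ?case using elim(1) by (simp add: power_mult_distrib power2_eq_square)
    qed
    show "(\<lambda>\<omega>. w t \<omega> * (c (\<omega>, Z t \<omega>) * (\<phi> (Z t \<omega>))\<^sup>2)) \<in> borel_measurable M"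
      using fZ by (rule borel_measurable_times[OF w_M[OF t]])
  qed measurable
  with ce g_bd show ?thesis
    unfolding cond_variance_def by eventually_elim (simp add: cg)
qed

text \<open>Rests on \<open>2 * \<tau> * d \<le> \<tau>\<^sup>2 + d\<^sup>2\<close>. The resulting
  bound is linear in the variance with \<open>\<tau>\<close> still free, so it can be added up over
  sample sizes and cover elements.\<close>

lemma expected_abs_deviation:
  fixes f :: "'z \<Rightarrow> real"
  assumes f: "f \<in> borel_measurable P" and f2: "integrable P (\<lambda>z. (f z)\<^sup>2)"
    and n: "1 \<le> n" "n \<le> T" and \<tau>: "0 < \<tau>"
  defines "D \<equiv> \<lambda>\<omega>. \<bar>1 / real n * (\<Sum>s=1..n. w s \<omega> * f (Z s \<omega>)) - (\<integral>z. f z \<partial>P)\<bar>"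
  shows "integrable M D" and "(\<integral>\<omega>. D \<omega> \<partial>M) \<le> \<tau> + B * (\<integral>z. (f z)\<^sup>2 \<partial>P) / (real n * \<tau>)"
proof -
  let ?S = "\<lambda>\<omega>. \<Sum>s=1..n. w s \<omega> * f (Z s \<omega>) - (\<integral>z. f z \<partial>P)"
  note S = martingale_second_moment[OF f f2 n(2)]
  have S_M [measurable]: "?S \<in> borel_measurable M" by (rule measurable_F_M[OF n(2) S(1)])
  have D: "D \<omega> = \<bar>?S \<omega> / real n\<bar>" for \<omega>
    using n(1) by (simp add: D_def sum_subtractf field_simps)
  have le: "D \<omega> \<le> \<tau> + (?S \<omega>)\<^sup>2 / ((real n)\<^sup>2 * \<tau>)" for \<omega>
  proof -
    let ?d = "\<bar>?S \<omega> / real n\<bar>"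
    have "2 * \<tau> * ?d \<le> \<tau>\<^sup>2 + ?d\<^sup>2" by (rule sum_squares_bound)
    moreover have "0 \<le> \<tau> * ?d" using \<tau> by simp
    ultimately have "\<tau> * ?d \<le> \<tau>\<^sup>2 + ?d\<^sup>2" by linarith
    also have "\<dots> = \<tau> * (\<tau> + ?d\<^sup>2 / \<tau>)" using \<tau> by (simp add: field_simps power2_eq_square)
    finally have "?d \<le> \<tau> + ?d\<^sup>2 / \<tau>" by (rule mult_left_le_imp_le[OF _ \<tau>])
    then show ?thesis unfolding D by (simp add: power_divide)
  qed
  have int: "integrable M (\<lambda>\<omega>. \<tau> + (?S \<omega>)\<^sup>2 / ((real n)\<^sup>2 * \<tau>))" using S(2) by simp
  show iD: "integrable M D"
  proof (rule Bochner_Integration.integrable_bound[OF int])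
    show "D \<in> borel_measurable M" unfolding D[abs_def] by measurable
    show "AE \<omega> in M. norm (D \<omega>) \<le> norm (\<tau> + (?S \<omega>)\<^sup>2 / ((real n)\<^sup>2 * \<tau>))"
    proof (rule AE_I2)
      fix \<omega> have "0 \<le> D \<omega>" by (simp add: D)
      then show "norm (D \<omega>) \<le> norm (\<tau> + (?S \<omega>)\<^sup>2 / ((real n)\<^sup>2 * \<tau>))" using le[of \<omega>] by simp
    qed
  qed
  have "(\<integral>\<omega>. D \<omega> \<partial>M) \<le> (\<integral>\<omega>. \<tau> + (?S \<omega>)\<^sup>2 / ((real n)\<^sup>2 * \<tau>) \<partial>M)"
    by (rule integral_mono[OF iD int]) (rule le)
  also have "\<dots> = \<tau> + (\<integral>\<omega>. (?S \<omega>)\<^sup>2 \<partial>M) / ((real n)\<^sup>2 * \<tau>)" using S(2) by (simp add: prob_space)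
  also have "\<dots> \<le> \<tau> + real n * (B * (\<integral>z. (f z)\<^sup>2 \<partial>P)) / ((real n)\<^sup>2 * \<tau>)"
    using \<tau> by (intro add_left_mono divide_right_mono S(3)) simp
  also have "\<dots> = \<tau> + B * (\<integral>z. (f z)\<^sup>2 \<partial>P) / (real n * \<tau>)"
    using n(1) \<tau> by (simp add: power2_eq_square)
  finally show "(\<integral>\<omega>. D \<omega> \<partial>M) \<le> \<tau> + B * (\<integral>z. (f z)\<^sup>2 \<partial>P) / (real n * \<tau>)" .
qed

end

text \<open>\<open>a\<close>, \<open>b\<close> and \<open>k\<close> stand for the errors of
  \<open>\<theta>\<close>, \<open>\<eta>\<close> and \<open>\<alpha>\<close>, and \<open>y\<close>
  for that of the centering. Only the first three are confined to \<open>\<delta>\<close>, since the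
  centering enters the influence function additively.\<close>

locale estimated_rounds = weighted_rounds M F Z w P T B
  for M :: "'w measure" and F and Z :: "nat \<Rightarrow> 'w \<Rightarrow> 'z" and w P T B +
  fixes \<phi> Q :: "'z \<Rightarrow> real" and \<psi> :: "nat \<Rightarrow> 'w \<Rightarrow> 'z \<Rightarrow> real" and a b k y :: "nat \<Rightarrow> 'w \<Rightarrow> real" and \<delta> :: real
  assumes \<phi> [measurable]: "\<phi> \<in> borel_measurable P" and Q [measurable]: "Q \<in> borel_measurable P"
    and Q1: "\<And>z. 1 \<le> Q z" and Q4: "integrable P (\<lambda>z. Q z ^ 4)" and \<phi>Q: "\<And>z. \<bar>\<phi> z\<bar> \<le> Q z"
    and \<psi>: "\<And>s. s \<in> {1..T} \<Longrightarrow> (\<lambda>(\<omega>, z). \<psi> s \<omega> z) \<in> borel_measurable (F (s - 1) \<Otimes>\<^sub>M P)"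
    and am: "\<And>s. s \<in> {1..T} \<Longrightarrow> a s \<in> borel_measurable (F (s - 1))"
    and bm: "\<And>s. s \<in> {1..T} \<Longrightarrow> b s \<in> borel_measurable (F (s - 1))"
    and km: "\<And>s. s \<in> {1..T} \<Longrightarrow> k s \<in> borel_measurable (F (s - 1))"
    and ym: "\<And>s. s \<in> {1..T} \<Longrightarrow> y s \<in> borel_measurable (F (s - 1))"
    and nn: "\<And>s \<omega>. 0 \<le> a s \<omega>" "\<And>s \<omega>. 0 \<le> b s \<omega>" "\<And>s \<omega>. 0 \<le> k s \<omega>"
    and \<delta>: "0 < \<delta>" "\<delta> \<le> 1" and T: "1 \<le> T" and B: "0 \<le> B"
    and bd: "\<And>s \<omega> z. s \<in> {1..T} \<Longrightarrow> a s \<omega> \<le> \<delta> \<Longrightarrow> b s \<omega> \<le> \<delta> \<Longrightarrow> k s \<omega> \<le> \<delta> \<Longrightarrow>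
      \<bar>\<psi> s \<omega> z - \<phi> z\<bar> \<le> Q z * (a s \<omega> + b s \<omega> + k s \<omega> + \<bar>y s \<omega>\<bar>)"
begin

text \<open>The indicator of a partial sum staying below \<open>\<delta> ^ 4\<close> is predictable, so the change of measure
  applies to the stopped errors, although the errors themselves need not be integrable.\<close>

lemma stopped_error_expectation:
  defines "x \<equiv> \<lambda>s \<omega>. a s \<omega> ^ 4 + b s \<omega> ^ 4 + k s \<omega> ^ 4 + (y s \<omega>)\<^sup>2 / sqrt (real T)"
  defines "W \<equiv> \<lambda>\<omega>. \<Sum>s=1..T. if (\<Sum>r=1..s. x r \<omega>) \<le> \<delta> ^ 4
      then w s \<omega> * \<bar>(\<psi> s \<omega> (Z s \<omega>))\<^sup>2 - (\<phi> (Z s \<omega>))\<^sup>2\<bar> else 0"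
  shows "integrable M W" and "(\<integral>\<omega>. W \<omega> \<partial>M) \<le> 48 * (\<integral>z. Q z ^ 4 \<partial>P) * real T powr (3/4)"
proof -
  let ?q = "\<integral>z. Q z ^ 4 \<partial>P"
  define J where "J s = {\<omega>\<in>space M. (\<Sum>r=1..s. x r \<omega>) \<le> \<delta> ^ 4}" for s
  define f where "f s u = indicator (J s) (fst u) * \<bar>(\<psi> s (fst u) (snd u))\<^sup>2 - (\<phi> (snd u))\<^sup>2\<bar>" for s u
  define D where "D s \<omega> = a s \<omega> + b s \<omega> + k s \<omega> + \<bar>y s \<omega>\<bar> + (y s \<omega>)\<^sup>2" for s \<omega>
  have x0: "0 \<le> x s \<omega>" for s \<omega> unfolding x_def using nn by simp
  have D0: "0 \<le> D s \<omega>" for s \<omega> unfolding D_def using nn by simp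
  \<comment> \<open>The estimates of round \<open>s\<close> are known before that round is observed,
    so the stopping rule may include the current error and still be measurable for
    \<open>F (s - 1)\<close>.\<close>
  have xm: "x r \<in> borel_measurable (F (s - 1))" if "r \<in> {1..s}" "s \<in> {1..T}" for r s
  proof -
    have r: "r \<in> {1..T}" and le: "r - 1 \<le> s - 1" "s - 1 \<le> T" using that by auto
    note [measurable] = measurable_F_mono[OF le am[OF r]] measurable_F_mono[OF le bm[OF r]]
      measurable_F_mono[OF le km[OF r]] measurable_F_mono[OF le ym[OF r]]
    show ?thesis unfolding x_def by measurable
  qed
  have J: "J s \<in> sets (F (s - 1))" if s: "s \<in> {1..T}" for s
  proof -
    have sp: "space (F (s - 1)) = space M" by (rule space_F) (use s in auto)
    have [measurable]: "(\<lambda>\<omega>. \<Sum>r=1..s. x r \<omega>) \<in> borel_measurable (F (s - 1))"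
      by (rule borel_measurable_sum) (rule xm[OF _ s])
    have "{\<omega>\<in>space (F (s - 1)). (\<Sum>r=1..s. x r \<omega>) \<le> \<delta> ^ 4} \<in> sets (F (s - 1))" by measurable
    then show ?thesis unfolding J_def sp .
  qed
  have fm: "f s \<in> borel_measurable (F (s - 1) \<Otimes>\<^sub>M P)" if s: "s \<in> {1..T}" for s
  proof -
    note [measurable] = J[OF s] \<psi>[OF s, unfolded case_prod_beta']
    show ?thesis unfolding f_def by measurable
  qed
  have f0: "0 \<le> f s u" for s u unfolding f_def by simp
  have f_le: "f s (\<omega>, z) \<le> indicator (J s) \<omega> * (8 * D s \<omega>) * Q z ^ 4" if s: "s \<in> {1..T}" for s \<omega> z
  proof (cases "\<omega> \<in> J s")
    case True
    \<comment> \<open>A single summand lies below the partial sum, hence below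
      \<open>\<delta> ^ 4\<close>: on the stopped event the three localized errors are at most
      \<open>\<delta>\<close> and the bound \<open>bd\<close> applies.\<close>
    have "x s \<omega> \<le> (\<Sum>r=1..s. x r \<omega>)" using s x0 by (intro member_le_sum) auto
    then have "x s \<omega> \<le> \<delta> ^ 4" using True by (simp add: J_def)
    moreover have "a s \<omega> ^ 4 \<le> x s \<omega>" "b s \<omega> ^ 4 \<le> x s \<omega>" "k s \<omega> ^ 4 \<le> x s \<omega>" unfolding x_def using nn by simp_all
    ultimately have pw: "a s \<omega> ^ 4 \<le> \<delta> ^ 4" "b s \<omega> ^ 4 \<le> \<delta> ^ 4" "k s \<omega> ^ 4 \<le> \<delta> ^ 4" by linarith+
    have le: "a s \<omega> \<le> \<delta>" "b s \<omega> \<le> \<delta>" "k s \<omega> \<le> \<delta>"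
      using pw \<delta>(1) by (auto intro: power_le_imp_le_base[of _ 3] simp: eval_nat_numeral)
    have "\<bar>(\<psi> s \<omega> z)\<^sup>2 - (\<phi> z)\<^sup>2\<bar> \<le> 8 * (a s \<omega> + b s \<omega> + k s \<omega> + \<bar>y s \<omega>\<bar> + (y s \<omega>)\<^sup>2) * (Q z)\<^sup>2"
      by (rule squares_diff_le[OF \<phi>Q bd[OF s le]]) (use le \<delta> nn Q1[of z] in simp_all)
    also have "\<dots> \<le> 8 * D s \<omega> * Q z ^ 4"
      unfolding D_def[symmetric] using D0 Q1 by (intro mult_left_mono power_increasing) auto
    finally show ?thesis using True by (simp add: f_def)
  qed (simp add: f_def)
  have W_eq: "W \<omega> = (\<Sum>s=1..T. w s \<omega> * f s (\<omega>, Z s \<omega>))" if "\<omega> \<in> space M" for \<omega>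
    unfolding W_def using that by (intro sum.cong) (auto simp: f_def J_def)
  have W_M: "W \<in> borel_measurable M"
  proof -
    have "(\<lambda>\<omega>. \<Sum>s=1..T. w s \<omega> * f s (\<omega>, Z s \<omega>)) \<in> borel_measurable M"
      by (intro borel_measurable_sum borel_measurable_times w_M pair_F_M fm)
    then show ?thesis by (subst measurable_cong[OF W_eq])
  qed
  have W0: "0 \<le> W \<omega>" for \<omega> unfolding W_def by (intro sum_nonneg) (auto simp: w_nonneg)
  have Q4': "(\<integral>\<^sup>+z. ennreal (Q z ^ 4) \<partial>P) = ennreal ?q"
    by (rule nn_integral_eq_integral[OF Q4]) simp
  have q0: "0 \<le> ?q" by (rule Bochner_Integration.integral_nonneg) simp
  have round: "(\<integral>\<^sup>+\<omega>. ennreal (w s \<omega> * f s (\<omega>, Z s \<omega>)) \<partial>M) \<le> (\<integral>\<^sup>+\<omega>. ennreal (indicator (J s) \<omega> * (8 * D s \<omega>) * ?q) \<partial>M)"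
    if s: "s \<in> {1..T}" for s
  proof -
    have "(\<integral>\<^sup>+\<omega>. ennreal (w s \<omega> * f s (\<omega>, Z s \<omega>)) \<partial>M) = (\<integral>\<^sup>+\<omega>. ennreal (w s \<omega>) * ennreal (f s (\<omega>, Z s \<omega>)) \<partial>M)"
      by (simp add: ennreal_mult f0 w_nonneg)
    also have "\<dots> = (\<integral>\<^sup>+\<omega>. \<integral>\<^sup>+z. ennreal (f s (\<omega>, z)) \<partial>P \<partial>M)"
      by (rule change_of_measure[OF s, of "\<lambda>u. ennreal (f s u)"]) (use fm[OF s] in measurable)
    also have "\<dots> \<le> (\<integral>\<^sup>+\<omega>. \<integral>\<^sup>+z. ennreal (indicator (J s) \<omega> * (8 * D s \<omega>)) * ennreal (Q z ^ 4) \<partial>P \<partial>M)"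
      by (intro nn_integral_mono) (use f_le[OF s] D0 in \<open>simp add: ennreal_mult[symmetric] ennreal_leI\<close>)
    also have "\<dots> = (\<integral>\<^sup>+\<omega>. ennreal (indicator (J s) \<omega> * (8 * D s \<omega>) * ?q) \<partial>M)"
    proof (rule nn_integral_cong)
      fix \<omega>
      have "(\<integral>\<^sup>+z. ennreal (indicator (J s) \<omega> * (8 * D s \<omega>)) * ennreal (Q z ^ 4) \<partial>P)
          = ennreal (indicator (J s) \<omega> * (8 * D s \<omega>)) * ennreal ?q"
        unfolding Q4'[symmetric] by (rule nn_integral_cmult) simp
      then show "(\<integral>\<^sup>+z. ennreal (indicator (J s) \<omega> * (8 * D s \<omega>)) * ennreal (Q z ^ 4) \<partial>P)
          = ennreal (indicator (J s) \<omega> * (8 * D s \<omega>) * ?q)"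
        using D0[of s \<omega>] q0 by (simp only: ennreal_mult mult_nonneg_nonneg indicator_pos_le zero_le_numeral)
    qed
    finally show ?thesis .
  qed
  have Dm: "(\<lambda>\<omega>. ennreal (indicator (J s) \<omega> * (8 * D s \<omega>) * ?q)) \<in> borel_measurable M" if s: "s \<in> {1..T}" for s
  proof -
    have sT: "s - 1 \<le> T" using s by auto
    have [measurable]: "J s \<in> sets M" using J[OF s] F_sub[OF sT] by (auto simp: subalgebra_def)
    note [measurable] = measurable_F_M[OF sT am[OF s]] measurable_F_M[OF sT bm[OF s]]
      measurable_F_M[OF sT km[OF s]] measurable_F_M[OF sT ym[OF s]]
    show ?thesis unfolding D_def by measurable
  qed
  have "(\<integral>\<^sup>+\<omega>. ennreal (W \<omega>) \<partial>M) = (\<integral>\<^sup>+\<omega>. (\<Sum>s=1..T. ennreal (w s \<omega> * f s (\<omega>, Z s \<omega>))) \<partial>M)"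
    by (intro nn_integral_cong) (use f0 w_nonneg in \<open>simp add: W_eq sum_ennreal\<close>)
  also have "\<dots> = (\<Sum>s=1..T. \<integral>\<^sup>+\<omega>. ennreal (w s \<omega> * f s (\<omega>, Z s \<omega>)) \<partial>M)"
    by (rule nn_integral_sum) (intro measurable_compose[OF _ measurable_ennreal] borel_measurable_times w_M pair_F_M fm)
  also have "\<dots> \<le> (\<Sum>s=1..T. \<integral>\<^sup>+\<omega>. ennreal (indicator (J s) \<omega> * (8 * D s \<omega>) * ?q) \<partial>M)"
    by (rule sum_mono) (rule round)
  also have "\<dots> = (\<integral>\<^sup>+\<omega>. (\<Sum>s=1..T. ennreal (indicator (J s) \<omega> * (8 * D s \<omega>) * ?q)) \<partial>M)"
    by (rule nn_integral_sum[symmetric]) (rule Dm)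
  \<comment> \<open>The sum is bounded path by path before integrating; 48 is the 8 from the
    difference of squares times the 6 from the stopped sum.\<close>
  also have "\<dots> \<le> (\<integral>\<^sup>+\<omega>. ennreal (48 * ?q * real T powr (3/4)) \<partial>M)"
  proof (rule nn_integral_mono)
    fix \<omega> assume w: "\<omega> \<in> space M"
    have "(\<Sum>s=1..T. if (\<Sum>r=1..s. x r \<omega>) \<le> \<delta> ^ 4 then D s \<omega> else 0) \<le> 6 * real T powr (3/4)"
      unfolding x_def D_def
      by (rule stopped_error_sum_le[OF nn T]) (use \<delta> in \<open>auto intro: power_le_one\<close>)
    moreover have "(\<Sum>s=1..T. indicator (J s) \<omega> * (8 * D s \<omega>) * ?q)
        = 8 * ?q * (\<Sum>s=1..T. if (\<Sum>r=1..s. x r \<omega>) \<le> \<delta> ^ 4 then D s \<omega> else 0)"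
      unfolding sum_distrib_left using w by (intro sum.cong) (auto simp: J_def)
    ultimately have "(\<Sum>s=1..T. indicator (J s) \<omega> * (8 * D s \<omega>) * ?q) \<le> 8 * ?q * (6 * real T powr (3/4))"
      using q0 by (simp only: mult_left_mono)
    then show "(\<Sum>s=1..T. ennreal (indicator (J s) \<omega> * (8 * D s \<omega>) * ?q)) \<le> ennreal (48 * ?q * real T powr (3/4))"
      using D0 q0 by (subst sum_ennreal) (simp_all add: ennreal_leI mult_ac)
  qed
  also have "\<dots> = ennreal (48 * ?q * real T powr (3/4))" by (simp add: emeasure_space_1)
  finally have W: "(\<integral>\<^sup>+\<omega>. ennreal (W \<omega>) \<partial>M) \<le> ennreal (48 * ?q * real T powr (3/4))" .
  show int: "integrable M W"
    using W W0 by (intro integrableI_nonneg W_M) (auto simp: le_less_trans[OF _ ennreal_less_top])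
  have "ennreal (\<integral>\<omega>. W \<omega> \<partial>M) \<le> ennreal (48 * ?q * real T powr (3/4))"
    using W nn_integral_eq_integral[OF int] W0 by simp
  then show "(\<integral>\<omega>. W \<omega> \<partial>M) \<le> 48 * ?q * real T powr (3/4)"
    using q0 by (simp add: ennreal_le_iff)
qed

text \<open>Gathers the random errors of a horizon in one variable \<open>U\<close>: deviations over
  the cover and the plug-in error. Averaging the inverse sample sizes over the rounds produces
  \<open>H\<close>, which costs only a logarithm. Left over are the relative error
  \<open>\<kappa>\<close> of the cover and the first round, where the estimate is the constant
  \<open>s1\<close>.\<close>

lemma ratio_average_deviation:
  fixes G :: "nat \<Rightarrow> 'w \<Rightarrow> 'z \<Rightarrow> real" and \<rho> :: "'r \<Rightarrow> 'z \<Rightarrow> real" and \<sigma>2 \<sigma>h :: "nat \<Rightarrow> 'w \<Rightarrow> real"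
  assumes \<rho>_meas: "\<And>r. r \<in> R \<Longrightarrow> \<rho> r \<in> borel_measurable P"
    and \<rho>_bd: "\<And>r z. r \<in> R \<Longrightarrow> 0 \<le> \<rho> r z \<and> \<rho> r z \<le> B" and R: "finite R"
    and G: "AE \<omega> in M. \<forall>t\<in>{1..T}. G t \<omega> \<in> borel_measurable P \<and> (\<forall>z. 0 \<le> G t \<omega> z \<and> G t \<omega> z \<le> B) \<and>
      (\<exists>r\<in>R. \<forall>z. G t \<omega> z \<le> e * \<rho> r z \<and> \<rho> r z \<le> e * G t \<omega> z)"
    and e: "1 \<le> e" "e\<^sup>2 < 2"
    and \<sigma>2: "AE \<omega> in M. \<forall>t\<in>{1..T}. \<sigma>2 t \<omega> = (\<integral>z. G t \<omega> z * (\<phi> z)\<^sup>2 \<partial>P)"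
    and \<sigma>h: "\<And>t \<omega>. t \<in> {1..T} \<Longrightarrow> \<sigma>h t \<omega> = (if t = 1 then s1 else
      1 / real (t - 1) * (\<Sum>s=1..t-1. w s \<omega> * (G t \<omega> (Z s \<omega>) * (\<psi> s \<omega> (Z s \<omega>))\<^sup>2)))"
    and c: "0 < c" "AE \<omega> in M. \<forall>t\<in>{1..T}. c \<le> \<sigma>h t \<omega>" and s1: "0 < s1"
    and \<tau>: "0 < \<tau>"
  defines "q \<equiv> \<integral>z. Q z ^ 4 \<partial>P" and "H \<equiv> \<Sum>n<T. 1 / real n" and "\<kappa> \<equiv> e\<^sup>2 - 1"
  obtains U where "integrable M U" "\<And>\<omega>. 0 \<le> U \<omega>"
    "(\<integral>\<omega>. U \<omega> \<partial>M) \<le> e * real (card R) * (\<tau> + B ^ 3 * q * H / (real T * \<tau>)) + B * H / real T * (48 * q * real T powr (3/4))"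
    "AE \<omega> in M. (\<Sum>s=1..T. a s \<omega> ^ 4 + b s \<omega> ^ 4 + k s \<omega> ^ 4 + (y s \<omega>)\<^sup>2 / sqrt (real T)) \<le> \<delta> ^ 4 \<longrightarrow>
      \<bar>1 / real T * (\<Sum>t=1..T. \<sigma>2 t \<omega> / \<sigma>h t \<omega>) - 1\<bar>
        \<le> (B * q / s1 + 1) / real T + \<kappa> / (1 - \<kappa>) + U \<omega> / ((1 - \<kappa>) * c)"
proof -
  define x where "x s \<omega> = a s \<omega> ^ 4 + b s \<omega> ^ 4 + k s \<omega> ^ 4 + (y s \<omega>)\<^sup>2 / sqrt (real T)" for s \<omega>
  \<comment> \<open>The stopped plug-in error of the whole horizon. It serves every \<open>t\<close>
    at once, since extending a sum of nonnegative terms beyond \<open>t - 1\<close> only enlarges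
    it.\<close>
  define W where "W \<omega> = (\<Sum>s=1..T. if (\<Sum>r=1..s. x r \<omega>) \<le> \<delta> ^ 4
      then w s \<omega> * \<bar>(\<psi> s \<omega> (Z s \<omega>))\<^sup>2 - (\<phi> (Z s \<omega>))\<^sup>2\<bar> else 0)" for \<omega>
  have W: "integrable M W" "(\<integral>\<omega>. W \<omega> \<partial>M) \<le> 48 * q * real T powr (3/4)"
    unfolding W_def x_def q_def
    by (rule stopped_error_expectation)+
  have W0: "0 \<le> W \<omega>" for \<omega> unfolding W_def by (intro sum_nonneg) (auto simp: w_nonneg)
  define f where "f r z = \<rho> r z * (\<phi> z)\<^sup>2" for r z
  have f_meas: "f r \<in> borel_measurable P" if "r \<in> R" for r
    unfolding f_def using \<rho>_meas[OF that] by measurable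
  have \<phi>2_le: "(\<phi> z)\<^sup>2 \<le> (Q z)\<^sup>2" for z
    using power_mono[OF \<phi>Q[of z], of 2] by simp
  have Q2_le: "(Q z)\<^sup>2 \<le> Q z ^ 4" for z using Q1[of z] by (intro power_increasing) auto
  have \<phi>4_le: "((\<phi> z)\<^sup>2)\<^sup>2 \<le> Q z ^ 4" for z
    using power_mono[OF \<phi>2_le[of z], of 2] by (simp add: power_mult[symmetric])
  have f2_le: "(f r z)\<^sup>2 \<le> B\<^sup>2 * Q z ^ 4" if "r \<in> R" for r z
    unfolding f_def power_mult_distrib using \<rho>_bd[OF that, of z] \<phi>4_le[of z] by (intro mult_mono power_mono) auto
  have f2_int: "integrable P (\<lambda>z. (f r z)\<^sup>2)" if "r \<in> R" for r
  proof (rule Bochner_Integration.integrable_bound)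
    show "integrable P (\<lambda>z. B\<^sup>2 * Q z ^ 4)" using Q4 by simp
    show "(\<lambda>z. (f r z)\<^sup>2) \<in> borel_measurable P" using f_meas[OF that] by measurable
    show "AE z in P. norm ((f r z)\<^sup>2) \<le> norm (B\<^sup>2 * Q z ^ 4)"
      using f2_le[OF that] by (intro AE_I2) simp
  qed
  have f2_q: "(\<integral>z. (f r z)\<^sup>2 \<partial>P) \<le> B\<^sup>2 * q" if "r \<in> R" for r
  proof -
    have "(\<integral>z. (f r z)\<^sup>2 \<partial>P) \<le> (\<integral>z. B\<^sup>2 * Q z ^ 4 \<partial>P)"
      by (rule integral_mono[OF f2_int[OF that]]) (use Q4 f2_le[OF that] in simp_all)
    then show ?thesis by (simp add: q_def)
  qed
  have q0: "0 \<le> q" unfolding q_def by (rule Bochner_Integration.integral_nonneg) simp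
  have \<phi>2_int: "integrable P (\<lambda>z. (\<phi> z)\<^sup>2)"
    by (rule Bochner_Integration.integrable_bound[OF Q4]) (use order_trans[OF \<phi>2_le Q2_le] in simp_all)
  have \<phi>2_q: "(\<integral>z. (\<phi> z)\<^sup>2 \<partial>P) \<le> q"
    unfolding q_def by (rule integral_mono[OF \<phi>2_int Q4]) (rule order_trans[OF \<phi>2_le Q2_le])
  define D where "D n r \<omega> = \<bar>1 / real n * (\<Sum>s=1..n. w s \<omega> * f r (Z s \<omega>)) - (\<integral>z. f r z \<partial>P)\<bar>" for n r \<omega>
  have D_int: "integrable M (D n r)"
    and D_le: "(\<integral>\<omega>. D n r \<omega> \<partial>M) \<le> \<tau> + B ^ 3 * q / (real n * \<tau>)" if "1 \<le> n" "n \<le> T" "r \<in> R" for n r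
  proof -
    note D = expected_abs_deviation[OF f_meas[OF that(3)] f2_int[OF that(3)] that(1,2) \<tau>]
    show "integrable M (D n r)" unfolding D_def by (rule D(1))
    have "B * (\<integral>z. (f r z)\<^sup>2 \<partial>P) \<le> B * (B\<^sup>2 * q)" by (rule mult_left_mono[OF f2_q[OF that(3)] B])
    then have "B * (\<integral>z. (f r z)\<^sup>2 \<partial>P) / (real n * \<tau>) \<le> B ^ 3 * q / (real n * \<tau>)"
      using \<tau> by (intro divide_right_mono) (simp_all add: power2_eq_square power3_eq_cube mult.assoc)
    then show "(\<integral>\<omega>. D n r \<omega> \<partial>M) \<le> \<tau> + B ^ 3 * q / (real n * \<tau>)"
      using D(2) unfolding D_def by linarith
  qed
  \<comment> \<open>Indexed by the number \<open>n = t - 1\<close> of past rounds;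
    \<open>n = 0\<close> belongs to the first round, which is treated apart. Summing over
    \<open>R\<close> is the union bound in mean.\<close>
  define E where "E n \<omega> = (if n = 0 then 0 else e * (\<Sum>r\<in>R. D n r \<omega>) + B / real n * W \<omega>)" for n \<omega>
  have D0: "0 \<le> D n r \<omega>" for n r \<omega> by (simp add: D_def)
  have E0: "0 \<le> E n \<omega>" for n \<omega>
    unfolding E_def using e B W0 D0 by (auto intro!: add_nonneg_nonneg mult_nonneg_nonneg sum_nonneg divide_nonneg_nonneg)
  have E_int: "integrable M (E n)" if "n \<le> T" for n
  proof (cases "n = 0")
    case False
    have "integrable M (\<lambda>\<omega>. e * (\<Sum>r\<in>R. D n r \<omega>) + B / real n * W \<omega>)"
      using False that W(1) D_int by (intro Bochner_Integration.integrable_add integrable_mult_right Bochner_Integration.integrable_sum) auto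
    then show ?thesis using False by (simp add: E_def[abs_def])
  qed (simp add: E_def[abs_def])
  \<comment> \<open>Division by zero yields 0, so the bound written with \<open>1 / real n\<close>
    also covers \<open>n = 0\<close>.\<close>
  have E_le: "(\<integral>\<omega>. E n \<omega> \<partial>M) \<le> e * real (card R) * (\<tau> + B ^ 3 * q / \<tau> * (1 / real n)) + B * (48 * q * real T powr (3/4)) * (1 / real n)"
    if "n \<le> T" for n
  proof (cases "n = 0")
    case True
    then show ?thesis using e \<tau> by (simp add: E_def[abs_def])
  next
    case False
    have n: "1 \<le> n" using False by simp
    have "(\<integral>\<omega>. E n \<omega> \<partial>M) = e * (\<Sum>r\<in>R. \<integral>\<omega>. D n r \<omega> \<partial>M) + B / real n * (\<integral>\<omega>. W \<omega> \<partial>M)"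
      using False W(1) D_int[OF n that] by (simp add: E_def[abs_def])
    also have "\<dots> \<le> e * (\<Sum>r\<in>R. \<tau> + B ^ 3 * q / (real n * \<tau>)) + B / real n * (48 * q * real T powr (3/4))"
      using e B by (intro add_mono mult_left_mono sum_mono D_le[OF n that] W(2)) auto
    finally show ?thesis by (simp add: mult_ac)
  qed
  define U where "U \<omega> = 1 / real T * (\<Sum>n<T. E n \<omega>)" for \<omega>
  have U_int: "integrable M U"
    unfolding U_def by (intro integrable_mult_right Bochner_Integration.integrable_sum E_int) auto
  have U0: "0 \<le> U \<omega>" for \<omega> unfolding U_def using E0 by (simp add: sum_nonneg)
  have U_le: "(\<integral>\<omega>. U \<omega> \<partial>M) \<le> e * real (card R) * (\<tau> + B ^ 3 * q * H / (real T * \<tau>)) + B * H / real T * (48 * q * real T powr (3/4))"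
  proof -
    have "(\<integral>\<omega>. U \<omega> \<partial>M) = 1 / real T * (\<Sum>n<T. \<integral>\<omega>. E n \<omega> \<partial>M)"
      unfolding U_def using E_int by (subst integral_mult_right_zero, subst Bochner_Integration.integral_sum) auto
    also have "\<dots> \<le> 1 / real T * (\<Sum>n<T. e * real (card R) * (\<tau> + B ^ 3 * q / \<tau> * (1 / real n)) + B * (48 * q * real T powr (3/4)) * (1 / real n))"
      by (intro mult_left_mono sum_mono E_le) auto
    also have "(\<Sum>n<T. e * real (card R) * (\<tau> + B ^ 3 * q / \<tau> * (1 / real n)) + B * (48 * q * real T powr (3/4)) * (1 / real n))
        = e * real (card R) * (real T * \<tau> + B ^ 3 * q / \<tau> * H) + B * (48 * q * real T powr (3/4)) * H"
      by (simp only: sum.distrib sum_distrib_left[symmetric] H_def sum_constant card_lessThan)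
    also have "1 / real T * \<dots> = e * real (card R) * (\<tau> + B ^ 3 * q * H / (real T * \<tau>)) + B * H / real T * (48 * q * real T powr (3/4))"
      using T \<tau> by (simp add: field_simps)
    finally show ?thesis .
  qed
  have \<kappa>: "0 \<le> \<kappa>" "\<kappa> < 1" using e one_le_power[OF e(1), of 2] by (auto simp: \<kappa>_def)
  have dev: "\<bar>1 / real T * (\<Sum>t=1..T. \<sigma>2 t \<omega> / \<sigma>h t \<omega>) - 1\<bar>
        \<le> (B * q / s1 + 1) / real T + \<kappa> / (1 - \<kappa>) + U \<omega> / ((1 - \<kappa>) * c)"
    if J: "(\<Sum>s=1..T. x s \<omega>) \<le> \<delta> ^ 4"
      and G: "\<forall>t\<in>{1..T}. G t \<omega> \<in> borel_measurable P \<and> (\<forall>z. 0 \<le> G t \<omega> z \<and> G t \<omega> z \<le> B) \<and>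
        (\<exists>r\<in>R. \<forall>z. G t \<omega> z \<le> e * \<rho> r z \<and> \<rho> r z \<le> e * G t \<omega> z)"
      and \<sigma>2: "\<forall>t\<in>{1..T}. \<sigma>2 t \<omega> = (\<integral>z. G t \<omega> z * (\<phi> z)\<^sup>2 \<partial>P)"
      and c2: "\<forall>t\<in>{1..T}. c \<le> \<sigma>h t \<omega>" for \<omega>
  proof -
    have x0: "0 \<le> x s \<omega>" for s unfolding x_def using nn by simp
    \<comment> \<open>When the total stays below the threshold so do all partial sums: on this event
      nothing is stopped and \<open>W\<close> is the full plug-in error.\<close>
    have Js: "(\<Sum>r=1..s. x r \<omega>) \<le> \<delta> ^ 4" if "s \<in> {1..T}" for s
      using that by (intro order_trans[OF sum_mono2 J]) (auto simp: x0)
    have W_eq: "W \<omega> = (\<Sum>s=1..T. w s \<omega> * \<bar>(\<psi> s \<omega> (Z s \<omega>))\<^sup>2 - (\<phi> (Z s \<omega>))\<^sup>2\<bar>)"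
      unfolding W_def by (intro sum.cong) (use Js in auto)
    have V_int: "integrable P (\<lambda>z. G t \<omega> z * (\<phi> z)\<^sup>2)" if t: "t \<in> {1..T}" for t
    proof (rule Bochner_Integration.integrable_bound)
      show "integrable P (\<lambda>z. B * (\<phi> z)\<^sup>2)" using \<phi>2_int by simp
      show "(\<lambda>z. G t \<omega> z * (\<phi> z)\<^sup>2) \<in> borel_measurable P"
        by (rule borel_measurable_times) (use G t in simp_all)
      show "AE z in P. norm (G t \<omega> z * (\<phi> z)\<^sup>2) \<le> norm (B * (\<phi> z)\<^sup>2)"
        using G t B by (intro AE_I2) (simp add: abs_mult mult_right_mono)
    qed
    have V0: "0 \<le> \<sigma>2 t \<omega>" if t: "t \<in> {1..T}" for t
      using \<sigma>2 t G by (simp add: Bochner_Integration.integral_nonneg)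
    have V_le: "\<sigma>2 t \<omega> \<le> B * q" if t: "t \<in> {1..T}" for t
    proof -
      have "(\<integral>z. G t \<omega> z * (\<phi> z)\<^sup>2 \<partial>P) \<le> (\<integral>z. B * (\<phi> z)\<^sup>2 \<partial>P)"
        by (rule integral_mono[OF V_int[OF t]]) (use \<phi>2_int G t in \<open>simp_all add: mult_right_mono\<close>)
      also have "\<dots> \<le> B * q" using \<phi>2_q B by (simp add: mult_left_mono)
      finally show ?thesis using \<sigma>2 t by simp
    qed
    \<comment> \<open>Triangle inequality through \<open>Sg\<close>, the average with the true
      influence function and the current policy. \<open>Sg\<close> against \<open>\<sigma>2\<close>
      is concentration transferred from a cover element; \<open>\<sigma>h\<close> against
      \<open>Sg\<close> is the plug-in error.\<close>
    have key: "\<bar>\<sigma>h t \<omega> - \<sigma>2 t \<omega>\<bar> \<le> \<kappa> * \<sigma>2 t \<omega> + E (t - 1) \<omega>" if t: "t \<in> {1..T}" "t \<noteq> 1" for t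
    proof -
      define n where "n = t - 1"
      have n: "1 \<le> n" "n \<le> T" using t by (auto simp: n_def)
      obtain r where r: "r \<in> R" "\<And>z. G t \<omega> z \<le> e * \<rho> r z" "\<And>z. \<rho> r z \<le> e * G t \<omega> z"
        using G t(1) by blast
      have Gb: "0 \<le> G t \<omega> z" "G t \<omega> z \<le> B" for z using G t(1) by auto
      define Sg where "Sg = 1 / real n * (\<Sum>s=1..n. w s \<omega> * (G t \<omega> (Z s \<omega>) * (\<phi> (Z s \<omega>))\<^sup>2))"
      define Sr where "Sr = 1 / real n * (\<Sum>s=1..n. w s \<omega> * f r (Z s \<omega>))"
      have fi: "integrable P (f r)" by (rule P.square_integrable_imp_integrable[OF f_meas[OF r(1)] f2_int[OF r(1)]])
      have S_le: "1 / real n * (\<Sum>s=1..n. w s \<omega> * u (Z s \<omega>)) \<le> e * (1 / real n * (\<Sum>s=1..n. w s \<omega> * v (Z s \<omega>)))"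
        if "\<And>z. u z \<le> e * v z" for u v :: "'z \<Rightarrow> real"
      proof -
        have "(\<Sum>s=1..n. w s \<omega> * u (Z s \<omega>)) \<le> (\<Sum>s=1..n. w s \<omega> * (e * v (Z s \<omega>)))"
          by (intro sum_mono mult_left_mono that w_nonneg)
        also have "\<dots> = e * (\<Sum>s=1..n. w s \<omega> * v (Z s \<omega>))"
          by (simp add: sum_distrib_left mult_ac)
        finally have "1 / real n * (\<Sum>s=1..n. w s \<omega> * u (Z s \<omega>)) \<le> 1 / real n * (e * (\<Sum>s=1..n. w s \<omega> * v (Z s \<omega>)))"
          by (rule mult_left_mono) simp
        then show ?thesis by (simp add: mult_ac)
      qed
      have S1: "Sg \<le> e * Sr" unfolding Sg_def Sr_def
        by (rule S_le) (use mult_right_mono[OF r(2)] in \<open>simp add: f_def mult.assoc[symmetric]\<close>)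
      have S2: "Sr \<le> e * Sg" unfolding Sg_def Sr_def
        by (rule S_le) (use mult_right_mono[OF r(3)] in \<open>simp add: f_def mult.assoc[symmetric]\<close>)
      have V: "\<sigma>2 t \<omega> = (\<integral>z. G t \<omega> z * (\<phi> z)\<^sup>2 \<partial>P)" using \<sigma>2 t by simp
      have "\<sigma>2 t \<omega> \<le> (\<integral>z. e * f r z \<partial>P)" unfolding V
      proof (rule integral_mono[OF V_int[OF t(1)]])
        show "integrable P (\<lambda>z. e * f r z)" using fi by simp
        show "G t \<omega> z * (\<phi> z)\<^sup>2 \<le> e * f r z" for z
          using mult_right_mono[OF r(2), of "(\<phi> z)\<^sup>2" z] by (simp add: f_def mult.assoc)
      qed
      then have V1: "\<sigma>2 t \<omega> \<le> e * (\<integral>z. f r z \<partial>P)" by simp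
      have "(\<integral>z. f r z \<partial>P) \<le> (\<integral>z. e * (G t \<omega> z * (\<phi> z)\<^sup>2) \<partial>P)"
      proof (rule integral_mono[OF fi])
        show "integrable P (\<lambda>z. e * (G t \<omega> z * (\<phi> z)\<^sup>2))" using V_int[OF t(1)] by simp
        show "f r z \<le> e * (G t \<omega> z * (\<phi> z)\<^sup>2)" for z
          using mult_right_mono[OF r(3), of "(\<phi> z)\<^sup>2" z] by (simp add: f_def mult.assoc)
      qed
      then have V2: "(\<integral>z. f r z \<partial>P) \<le> e * \<sigma>2 t \<omega>" unfolding V by simp
      have 1: "\<bar>Sg - \<sigma>2 t \<omega>\<bar> \<le> \<kappa> * \<sigma>2 t \<omega> + e * D n r \<omega>"
        unfolding \<kappa>_def D_def Sr_def[symmetric]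
        by (rule multiplicative_transfer[OF e(1) S1 S2 V1 V2 V0[OF t(1)]])
      have "\<bar>\<sigma>h t \<omega> - Sg\<bar> = 1 / real n * \<bar>\<Sum>s=1..n. w s \<omega> * (G t \<omega> (Z s \<omega>) * ((\<psi> s \<omega> (Z s \<omega>))\<^sup>2 - (\<phi> (Z s \<omega>))\<^sup>2))\<bar>"
      proof -
        have "\<sigma>h t \<omega> = 1 / real n * (\<Sum>s=1..n. w s \<omega> * (G t \<omega> (Z s \<omega>) * (\<psi> s \<omega> (Z s \<omega>))\<^sup>2))"
          unfolding \<sigma>h[OF t(1)] n_def if_not_P[OF t(2)] ..
        then have "\<sigma>h t \<omega> - Sg = 1 / real n * (\<Sum>s=1..n. w s \<omega> * (G t \<omega> (Z s \<omega>) * ((\<psi> s \<omega> (Z s \<omega>))\<^sup>2 - (\<phi> (Z s \<omega>))\<^sup>2)))"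
          unfolding Sg_def by (simp only: right_diff_distrib sum_subtractf)
        then show ?thesis by (simp add: abs_mult)
      qed
      also have "\<dots> \<le> 1 / real n * (\<Sum>s=1..n. B * (w s \<omega> * \<bar>(\<psi> s \<omega> (Z s \<omega>))\<^sup>2 - (\<phi> (Z s \<omega>))\<^sup>2\<bar>))"
      proof (intro mult_left_mono order_trans[OF sum_abs] sum_mono)
        fix s
        have "\<bar>w s \<omega> * (G t \<omega> (Z s \<omega>) * ((\<psi> s \<omega> (Z s \<omega>))\<^sup>2 - (\<phi> (Z s \<omega>))\<^sup>2))\<bar>
            = G t \<omega> (Z s \<omega>) * (w s \<omega> * \<bar>(\<psi> s \<omega> (Z s \<omega>))\<^sup>2 - (\<phi> (Z s \<omega>))\<^sup>2\<bar>)"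
          using Gb(1) w_nonneg by (simp add: abs_mult)
        also have "\<dots> \<le> B * (w s \<omega> * \<bar>(\<psi> s \<omega> (Z s \<omega>))\<^sup>2 - (\<phi> (Z s \<omega>))\<^sup>2\<bar>)"
          using Gb(2) w_nonneg by (intro mult_right_mono) auto
        finally show "\<bar>w s \<omega> * (G t \<omega> (Z s \<omega>) * ((\<psi> s \<omega> (Z s \<omega>))\<^sup>2 - (\<phi> (Z s \<omega>))\<^sup>2))\<bar> \<le> \<dots>" .
      qed simp
      also have "\<dots> \<le> 1 / real n * (B * W \<omega>)"
        unfolding W_eq sum_distrib_left[symmetric] using n B w_nonneg
        by (intro mult_left_mono sum_mono2) auto
      finally have 2: "\<bar>\<sigma>h t \<omega> - Sg\<bar> \<le> B / real n * W \<omega>" by simp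
      have "D n r \<omega> \<le> (\<Sum>r\<in>R. D n r \<omega>)" by (rule member_le_sum[OF r(1) _ R]) (rule D0)
      then have "e * D n r \<omega> \<le> e * (\<Sum>r\<in>R. D n r \<omega>)" using e by (intro mult_left_mono) auto
      then have "\<bar>\<sigma>h t \<omega> - \<sigma>2 t \<omega>\<bar> \<le> \<kappa> * \<sigma>2 t \<omega> + (e * (\<Sum>r\<in>R. D n r \<omega>) + B / real n * W \<omega>)"
        using 1 2 by linarith
      moreover have "E n \<omega> = e * (\<Sum>r\<in>R. D n r \<omega>) + B / real n * W \<omega>" using n by (simp add: E_def)
      ultimately show ?thesis unfolding n_def[symmetric] by (simp only:)
    qed
    have term_le: "\<bar>\<sigma>2 (Suc j) \<omega> / \<sigma>h (Suc j) \<omega> - 1\<bar> \<le> (if j = 0 then B * q / s1 + 1 else 0) + (\<kappa> + E j \<omega> / c) / (1 - \<kappa>)"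
      if j: "j < T" for j
    proof -
      have t: "Suc j \<in> {1..T}" using j by auto
      have nonneg: "0 \<le> (\<kappa> + E j \<omega> / c) / (1 - \<kappa>)" using \<kappa> E0 c by simp
      show ?thesis
      proof (cases "j = 0")
        case True
        \<comment> \<open>The first estimate carries no information from data, so the ratio is
          bounded crudely; division by \<open>T\<close> makes this single term negligible.\<close>
        have "\<sigma>2 1 \<omega> / s1 \<le> B * q / s1" "0 \<le> \<sigma>2 1 \<omega> / s1"
          using V_le[OF t] V0[OF t] s1 True by (simp_all add: divide_right_mono)
        then have "\<bar>\<sigma>2 1 \<omega> / s1 - 1\<bar> \<le> B * q / s1 + 1" by linarith
        then show ?thesis using True nonneg \<sigma>h[OF t] by simp
      next
        case False
        then show ?thesis
          using ratio_deviation_le[OF c(1) _ _ \<kappa> E0, of "\<sigma>h (Suc j) \<omega>" "\<sigma>2 (Suc j) \<omega>" j \<omega>] key[OF t] c2 t by simp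
      qed
    qed
    have "\<bar>1 / real T * (\<Sum>t=1..T. \<sigma>2 t \<omega> / \<sigma>h t \<omega>) - 1\<bar> = 1 / real T * \<bar>\<Sum>j<T. \<sigma>2 (Suc j) \<omega> / \<sigma>h (Suc j) \<omega> - 1\<bar>"
    proof -
      have "1 / real T * (\<Sum>t=1..T. \<sigma>2 t \<omega> / \<sigma>h t \<omega>) - 1 = 1 / real T * (\<Sum>j<T. \<sigma>2 (Suc j) \<omega> / \<sigma>h (Suc j) \<omega> - 1)"
        using T by (simp add: sum.atLeast1_atMost_eq sum_subtractf field_simps)
      then show ?thesis by (simp add: abs_mult)
    qed
    also have "\<dots> \<le> 1 / real T * (\<Sum>j<T. (if j = 0 then B * q / s1 + 1 else 0) + (\<kappa> + E j \<omega> / c) / (1 - \<kappa>))"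
      by (intro mult_left_mono order_trans[OF sum_abs] sum_mono term_le) auto
    also have "(\<Sum>j<T. (if j = 0 then B * q / s1 + 1 else 0) + (\<kappa> + E j \<omega> / c) / (1 - \<kappa>))
        = (B * q / s1 + 1) + (real T * \<kappa> + (\<Sum>j<T. E j \<omega>) / c) / (1 - \<kappa>)"
      using T by (simp add: sum.distrib sum_divide_distrib[symmetric])
    also have "1 / real T * \<dots> = (B * q / s1 + 1) / real T + \<kappa> / (1 - \<kappa>) + U \<omega> / ((1 - \<kappa>) * c)"
    proof -
      have "1 / real T * ((real T * \<kappa> + (\<Sum>j<T. E j \<omega>) / c) / (1 - \<kappa>)) = \<kappa> / (1 - \<kappa>) + U \<omega> / ((1 - \<kappa>) * c)"
        using T c(1) \<kappa>(2) unfolding U_def by (simp add: divide_simps) 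
      moreover have "1 / real T * (B * q / s1 + 1) = (B * q / s1 + 1) / real T"
        by (simp only: times_divide_eq_left mult_1_left)
      ultimately show ?thesis by (subst distrib_left) (simp only: add.assoc)
    qed
    finally show ?thesis .
  qed
  show ?thesis
  proof (rule that[OF U_int U0 U_le])
    show "AE \<omega> in M. (\<Sum>s=1..T. a s \<omega> ^ 4 + b s \<omega> ^ 4 + k s \<omega> ^ 4 + (y s \<omega>)\<^sup>2 / sqrt (real T)) \<le> \<delta> ^ 4 \<longrightarrow>
      \<bar>1 / real T * (\<Sum>t=1..T. \<sigma>2 t \<omega> / \<sigma>h t \<omega>) - 1\<bar>
        \<le> (B * q / s1 + 1) / real T + \<kappa> / (1 - \<kappa>) + U \<omega> / ((1 - \<kappa>) * c)"
      unfolding x_def[symmetric] using G \<sigma>2 c(2) by eventually_elim (use dev in blast)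
  qed
qed

end

section \<open>Consistency of the variance estimates\<close>

lemma measurable_history:
  assumes "s \<in> {1..t}" and X: "\<And>s. s \<in> {1..t} \<Longrightarrow> X s \<in> M \<rightarrow>\<^sub>M N"
  shows "X s \<in> history M X N t \<rightarrow>\<^sub>M N"
proof -
  have "(\<lambda>\<omega>. \<lambda>s\<in>{1..t}. X s \<omega>) \<in> space M \<rightarrow> space (PiM {1..t} (\<lambda>_. N))"
    using measurable_space[OF X] by (auto simp: space_PiM)
  then have "(\<lambda>\<omega>. \<lambda>s\<in>{1..t}. X s \<omega>) \<in> history M X N t \<rightarrow>\<^sub>M PiM {1..t} (\<lambda>_. N)"
    unfolding history_def sigma_of_def by (rule measurable_vimage_algebra1)
  from measurable_compose[OF this measurable_component_singleton[OF assms(1)]] show ?thesis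
    using assms(1) by simp
qed

text \<open>The history is the smallest sigma-algebra making the first \<open>t\<close> observations
  measurable. With \<open>L\<close> the sample space or a longer history this gives inclusion and
  monotonicity.\<close>

lemma sets_history_subset:
  assumes X: "\<And>s. s \<in> {1..t} \<Longrightarrow> X s \<in> L \<rightarrow>\<^sub>M N" and sp: "space L = space M"
  shows "sets (history M X N t) \<subseteq> sets L"
proof -
  have "(\<lambda>\<omega>. \<lambda>s\<in>{1..t}. X s \<omega>) \<in> L \<rightarrow>\<^sub>M PiM {1..t} (\<lambda>_. N)"
    using X by (intro measurable_restrict) auto
  then show ?thesis
    unfolding history_def sigma_of_def using sets_image_in_sets[OF sp] by blast
qed

lemma space_history [simp]: "space (history M X N t) = space M"
  by (simp add: history_def)

lemma subalgebra_history:
  "(\<And>s. s \<in> {1..t} \<Longrightarrow> X s \<in> M \<rightarrow>\<^sub>M N) \<Longrightarrow> subalgebra M (history M X N t)"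
  unfolding subalgebra_def using sets_history_subset[of t X M N M] by simp

lemma sets_history_mono:
  assumes "s \<le> t" and X: "\<And>s. s \<in> {1..t} \<Longrightarrow> X s \<in> M \<rightarrow>\<^sub>M N"
  shows "sets (history M X N s) \<subseteq> sets (history M X N t)"
proof (rule sets_history_subset)
  fix r assume "r \<in> {1..s}"
  then have "r \<in> {1..t}" using assms(1) by auto
  then show "X r \<in> history M X N t \<rightarrow>\<^sub>M N" by (rule measurable_history[OF _ X])
qed simp

text \<open>A positive number over zero is infinite in the extended quotient, so finiteness yields
  positivity of \<open>p\<close>; where both densities vanish, the real quotient is 0 by
  convention.\<close>

lemma sup_ratio_leD:
  assumes "sup_ratio pe p \<le> ennreal B" and "0 \<le> B" "0 \<le> pe c a" "0 \<le> p c a"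
  shows "0 < pe c a \<Longrightarrow> 0 < p c a" and "pe c a / p c a \<le> B"
proof -
  have "ennreal (pe c a) / ennreal (p c a) \<le> sup_ratio pe p"
    unfolding sup_ratio_def by (rule SUP_upper2[where i = c], simp, rule SUP_upper2[where i = a]) simp_all
  then have le: "ennreal (pe c a) / ennreal (p c a) \<le> ennreal B" using assms(1) by (rule order_trans)
  show pos: "0 < p c a" if "0 < pe c a"
  proof (rule ccontr)
    assume "\<not> 0 < p c a"
    then have "ennreal (pe c a) / ennreal (p c a) = \<top>"
      using that assms(4) by (simp add: ennreal_divide_zero)
    then show False using le by (simp add: top_unique)
  qed
  show "pe c a / p c a \<le> B"
  proof (cases "p c a = 0")
    case False
    then show ?thesis using le assms by (simp add: divide_ennreal ennreal_le_iff)
  qed (use assms in simp)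
qed

text \<open>The term at 0 vanishes because \<open>1 / 0 = 0\<close>, which leaves a harmonic sum;
  each further term is at most the increment of the logarithm.\<close>

lemma sum_inverse_le_ln:
  assumes "1 \<le> T"
  shows "(\<Sum>n<T. 1 / real n) \<le> 1 + ln (real T)"
proof -
  have "(\<Sum>n<Suc m. 1 / real n) \<le> 1 + ln (real m)" if "1 \<le> m" for m
    using that
  proof (induction m rule: dec_induct)
    case (step m)
    then have m: "0 < real m" by simp
    have "ln (real m / real (Suc m)) \<le> real m / real (Suc m) - 1"
      using m by (intro ln_le_minus_one) simp
    also have "\<dots> = - (1 / real (Suc m))" by (simp add: field_simps)
    finally have "1 / real (Suc m) \<le> ln (real (Suc m)) - ln (real m)"
      using m by (simp add: ln_div)
    then show ?case using step.IH by simp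
  qed simp
  from this[OF assms] show ?thesis using assms by (simp add: order_trans[rotated])
qed

text \<open>Up to logarithms the exponents of \<open>T\<close> are -1/8, 3/8 - 7/8 = -1/2 and 1/8 -
  1 + 3/4 = -1/8. The factor \<open>T powr (-1/8)\<close> is the chosen \<open>\<tau>\<close>, and
  \<open>N\<close> bounds the size of the cover, constant because its scale is fixed.\<close>

lemma deviation_rate_tendsto:
  "(\<lambda>T. e * N * (real T powr (-1/8) + (K * real T powr (1/8)) ^ 3 * q * (1 + ln (real T)) / (real T * real T powr (-1/8)))
    + K * real T powr (1/8) * (1 + ln (real T)) / real T * (48 * q * real T powr (3/4))) \<longlonglongrightarrow> 0"
  for e N K q :: real
proof -
  have 1: "(\<lambda>T. real T powr (-1/8)) \<longlonglongrightarrow> 0" by real_asymp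
  have 2: "(\<lambda>T. (real T powr (1/8)) ^ 3 * (1 + ln (real T)) / (real T * real T powr (-1/8))) \<longlonglongrightarrow> 0" by real_asymp
  have 3: "(\<lambda>T. real T powr (1/8) * (1 + ln (real T)) / real T * real T powr (3/4)) \<longlonglongrightarrow> 0" by real_asymp
  have "(\<lambda>T. e * N * (real T powr (-1/8) + K ^ 3 * q * ((real T powr (1/8)) ^ 3 * (1 + ln (real T)) / (real T * real T powr (-1/8))))
    + K * (48 * q) * (real T powr (1/8) * (1 + ln (real T)) / real T * real T powr (3/4))) \<longlonglongrightarrow> e * N * (0 + K ^ 3 * q * 0) + K * (48 * q) * 0"
    by (intro tendsto_intros 1 2 3)
  then show ?thesis by (simp add: power_mult_distrib mult_ac)
qed

lemma tendsto_in_prob_add_zero: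
  assumes "prob_space M" and X: "tendsto_in_prob M X 0" and Y: "tendsto_in_prob M Y 0"
  shows "tendsto_in_prob M (\<lambda>n \<omega>. X n \<omega> + Y n \<omega>) 0"
proof -
  interpret prob_space M by fact
  have [measurable]: "X n \<in> borel_measurable M" "Y n \<in> borel_measurable M" for n
    using X Y by (auto simp: tendsto_in_prob_def)
  let ?P = "\<lambda>V d n. prob {\<omega>\<in>space M. d < \<bar>V n \<omega>\<bar>}"
  have lim: "?P V d \<longlonglongrightarrow> 0" if "tendsto_in_prob M V 0" "0 < d" for V d
    using that by (simp add: tendsto_in_prob_def)
  have "?P (\<lambda>n \<omega>. X n \<omega> + Y n \<omega>) d \<longlonglongrightarrow> 0" if "0 < d" for d
  proof (rule tendsto_sandwich[OF _ _ tendsto_const])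
    show "(\<lambda>n. ?P X (d/2) n + ?P Y (d/2) n) \<longlonglongrightarrow> 0"
      by (rule tendsto_add_zero[OF lim[OF X] lim[OF Y]]) (use that in simp_all)
    have "?P (\<lambda>n \<omega>. X n \<omega> + Y n \<omega>) d n
        \<le> prob ({\<omega>\<in>space M. d/2 < \<bar>X n \<omega>\<bar>} \<union> {\<omega>\<in>space M. d/2 < \<bar>Y n \<omega>\<bar>})" for n
      by (rule finite_measure_mono) auto
    moreover have "prob ({\<omega>\<in>space M. d/2 < \<bar>X n \<omega>\<bar>} \<union> {\<omega>\<in>space M. d/2 < \<bar>Y n \<omega>\<bar>})
        \<le> ?P X (d/2) n + ?P Y (d/2) n" for n
      by (rule measure_Un_le) measurable
    ultimately show "\<forall>\<^sub>F n in sequentially. ?P (\<lambda>n \<omega>. X n \<omega> + Y n \<omega>) d n \<le> ?P X (d/2) n + ?P Y (d/2) n"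
      by (intro always_eventually allI) (rule order_trans)
  qed simp
  then show ?thesis by (simp add: tendsto_in_prob_def)
qed

theorem theorem4:
  fixes M :: "'w measure" and PC :: "'c measure" and MA :: "'a measure"
    and \<mu> :: "'c \<Rightarrow> 'a measure" and PY :: "'c \<Rightarrow> 'a \<Rightarrow> real measure"
    and pe :: "'c \<Rightarrow> 'a \<Rightarrow> real"
    and p :: "nat \<Rightarrow> nat \<Rightarrow> 'w \<Rightarrow> 'c \<Rightarrow> 'a \<Rightarrow> real"
    and C :: "nat \<Rightarrow> nat \<Rightarrow> 'w \<Rightarrow> 'c" and A :: "nat \<Rightarrow> nat \<Rightarrow> 'w \<Rightarrow> 'a"
    and Y :: "nat \<Rightarrow> nat \<Rightarrow> 'w \<Rightarrow> real"
    and l :: "'th::real_normed_vector \<Rightarrow> 'up::real_normed_vector \<Rightarrow> 'c \<times> 'a \<times> real \<Rightarrow> real"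
    and m :: "'th \<Rightarrow> 'c \<times> 'a \<times> real \<Rightarrow> real"
    and \<theta>0 :: 'th and \<eta>0 :: 'up
    and \<iota> :: "'th \<Rightarrow> 'h::{real_inner, complete_space}" and \<alpha>0 :: 'h
    and \<theta>hat :: "nat \<Rightarrow> nat \<Rightarrow> 'w \<Rightarrow> 'th" and \<eta>hat :: "nat \<Rightarrow> nat \<Rightarrow> 'w \<Rightarrow> 'up"
    and \<alpha>hat :: "nat \<Rightarrow> nat \<Rightarrow> 'w \<Rightarrow> 'th" and \<psi>hat :: "nat \<Rightarrow> nat \<Rightarrow> 'w \<Rightarrow> real"
    and s1 :: real and PolT :: "nat \<Rightarrow> ('c \<Rightarrow> 'a \<Rightarrow> real) set" and q :: real
  defines "Z \<equiv> \<lambda>T t \<omega>. (C T t \<omega>, A T t \<omega>, Y T t \<omega>)"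
  defines "F \<equiv> \<lambda>T. history M (Z T) (obs_space PC MA)"
  defines "Pe \<equiv> eval_law PC MA \<mu> PY pe"
  defines "w \<equiv> \<lambda>T t \<omega>. pe (C T t \<omega>) (A T t \<omega>) / p T t \<omega> (C T t \<omega>) (A T t \<omega>)"
  defines "\<phi> \<equiv> \<lambda>T t \<omega>. influence Pe l m \<theta>0 \<eta>0 \<iota> \<alpha>0 (Z T t \<omega>)"
  defines "\<phi>hat \<equiv> \<lambda>T t \<omega>. influence_hat l m (\<theta>hat T t \<omega>) (\<eta>hat T t \<omega>) (\<alpha>hat T t \<omega>) (\<psi>hat T t \<omega>)"
  defines "\<sigma>2 \<equiv> \<lambda>T t. cond_variance M (F T (t - 1)) (\<lambda>\<omega>. w T t \<omega> * \<phi> T t \<omega>)"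
  defines "\<sigma>hat2 \<equiv> \<lambda>T t \<omega>. if t = 1 then s1 else
    1 / (real t - 1) * (\<Sum>s = 1..t - 1.
      (pe (C T s \<omega>) (A T s \<omega>))\<^sup>2
        / (p T t \<omega> (C T s \<omega>) (A T s \<omega>) * p T s \<omega> (C T s \<omega>) (A T s \<omega>))
      * (\<phi>hat T s \<omega> (Z T s \<omega>))\<^sup>2)"
  assumes prob_M: "prob_space M"
    and prob_PC: "prob_space PC"
    and space_PC: "space PC = UNIV"
    and space_MA: "space MA = UNIV"
    and kernel_Y: "(\<lambda>(c, a). PY c a) \<in> PC \<Otimes>\<^sub>M MA \<rightarrow>\<^sub>M prob_algebra borel"
    and eval_density: "cond_density PC MA \<mu> pe"
    and policy_density: "\<And>T t. t \<in> {1..T} \<Longrightarrow> random_cond_density (F T (t - 1)) PC MA \<mu> (p T t)"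
    and data: "\<And>T. data_generating M PC MA \<mu> PY (F T) (p T) (C T) (A T) (Y T) T"
    and overlap: "\<And>T. overlap M PC \<mu> pe (p T) T"
    and meas_m: "(\<lambda>(\<theta>, z). m \<theta> z) \<in> borel_measurable (borel \<Otimes>\<^sub>M obs_space PC MA)"
    and meas_l: "\<And>\<theta> \<eta>. l \<theta> \<eta> \<in> borel_measurable (obs_space PC MA)"
    and regular: "regularity Pe l m \<theta>0 \<eta>0"
    and envelope: "envelope Pe l m \<theta>0 \<eta>0"
    and completion: "is_energy_completion (hessian Pe l \<theta>0 \<eta>0) \<iota>"
    and riesz: "is_riesz_representer Pe m \<theta>0 \<iota> \<alpha>0"
    and adapted_theta: "\<And>T t. t \<in> {1..T} \<Longrightarrow> \<theta>hat T t \<in> F T (t - 1) \<rightarrow>\<^sub>M borel"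
    and adapted_eta: "\<And>T t. t \<in> {1..T} \<Longrightarrow> \<eta>hat T t \<in> F T (t - 1) \<rightarrow>\<^sub>M borel"
    and adapted_alpha: "\<And>T t. t \<in> {1..T} \<Longrightarrow> \<alpha>hat T t \<in> F T (t - 1) \<rightarrow>\<^sub>M borel"
    and adapted_psi: "\<And>T t. t \<in> {1..T} \<Longrightarrow> \<psi>hat T t \<in> F T (t - 1) \<rightarrow>\<^sub>M borel"
    and adapted_phi: "\<And>T t. t \<in> {1..T} \<Longrightarrow>
          (\<lambda>(\<omega>, z). \<phi>hat T t \<omega> z) \<in> borel_measurable (F T (t - 1) \<Otimes>\<^sub>M obs_space PC MA)"
    and rate_theta: "little_o_prob M (\<lambda>T \<omega>. 1 / real T * (\<Sum>t = 1..T. norm (\<theta>hat T t \<omega> - \<theta>0) ^ 4)) (\<lambda>T. real T powr (-1))"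
    and rate_eta: "little_o_prob M (\<lambda>T \<omega>. 1 / real T * (\<Sum>t = 1..T. norm (\<eta>hat T t \<omega> - \<eta>0) ^ 4)) (\<lambda>T. real T powr (-1))"
    and rate_alpha: "little_o_prob M (\<lambda>T \<omega>. 1 / real T * (\<Sum>t = 1..T. cont_ext \<iota> norm (\<iota> (\<alpha>hat T t \<omega>) - \<alpha>0) ^ 4))
          (\<lambda>T. real T powr (-1))"
    and lindeberg: "\<And>\<epsilon>. 0 < \<epsilon> \<Longrightarrow> tendsto_in_prob M (\<lambda>T \<omega>. 1 / real T * (\<Sum>t = 1..T.
          real_cond_exp M (F T (t - 1))
            (\<lambda>\<omega>'. (w T t \<omega>')\<^sup>2 * (\<phi> T t \<omega>')\<^sup>2
                  * indicator {\<omega>''. \<epsilon> * sqrt (real T) < \<bar>w T t \<omega>'' * \<phi> T t \<omega>''\<bar>} \<omega>') \<omega>)) 0"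
    and weights: "AE \<omega> in M. big_O_ennreal (\<lambda>T. SUP t\<in>{1..T}. sup_ratio pe (p T t \<omega>)) (\<lambda>T. real T powr (1/3))"
    and rate_psi: "little_o_prob M (\<lambda>T \<omega>. 1 / real T * (\<Sum>s = 1..T. (\<psi>hat T s \<omega> - Psi Pe m \<theta>0)\<^sup>2)) (\<lambda>T. real T powr (-1/2))"
    and bounded_psi: "bounded_in_prob M (\<lambda>T \<omega>. SUP s\<in>{1..T}. \<bar>\<psi>hat T s \<omega>\<bar>)"
    and s1_pos: "0 < s1"
    and sigma_lower: "\<exists>c>0. \<forall>T. AE \<omega> in M. \<forall>t\<in>{1..T}. c < min (sqrt (\<sigma>2 T t \<omega>)) (sqrt (\<sigma>hat2 T t \<omega>))"
    and class_density: "\<And>T \<pi>. 1 \<le> T \<Longrightarrow> \<pi> \<in> PolT T \<Longrightarrow> cond_density PC MA \<mu> \<pi>"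
    and class_separable: "\<And>T. 1 \<le> T \<Longrightarrow> pointwise_separable (PolT T)"
    and in_class: "\<And>T. AE \<omega> in M. \<forall>t\<in>{1..T}. p T t \<omega> \<in> PolT T"
    and q_ge: "0 \<le> q" and q_less: "q < 2"
    and entropy: "\<exists>K. \<forall>T\<ge>1. \<forall>\<epsilon>\<in>{0<..<1}.
          elog (ereal_of_enat (covering_number \<epsilon> (log_class (PolT T))))
          \<le> ereal (K * (if q = 0 then ln (exp 1 / \<epsilon>) else \<epsilon> powr (- q)))"
    and class_weights: "big_O_ennreal (\<lambda>T. SUP \<pi>\<in>PolT T. sup_ratio pe \<pi>) (\<lambda>T. real T powr (1/8))"
  shows "tendsto_in_prob M (\<lambda>T \<omega>. 1 / real T * (\<Sum>t = 1..T. \<sigma>2 T t \<omega> / \<sigma>hat2 T t \<omega>)) 1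
    \<and> little_o_prob M (\<lambda>T \<omega>. 1 / real T * (\<Sum>t = 1..T. \<sigma>2 T t \<omega> / \<sigma>hat2 T t \<omega>) - 1) (\<lambda>_. 1)
    \<and> (\<exists>b>0. \<forall>T\<ge>1. AE \<omega> in M. b \<le> (MIN t\<in>{1..T}. \<sigma>hat2 T t \<omega>))"
proof -
  interpret prob_space M by (rule prob_M)
  let ?N = "obs_space PC MA"
  have polE: "policy \<mu> pe \<in> PC \<rightarrow>\<^sub>M prob_algebra MA"
    and pe_meas: "(\<lambda>(c, a). pe c a) \<in> borel_measurable (PC \<Otimes>\<^sub>M MA)" and pe0: "\<And>c a. 0 \<le> pe c a"
    using eval_density unfolding cond_density_def by auto
  have prob_Pe: "prob_space Pe" and sets_Pe: "sets Pe = sets ?N"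
    unfolding Pe_def
    using nn_integral_eval_law(2,3)[OF prob_PC kernel_Y polE measurable_const[of 0]] by simp_all
  interpret Pe: prob_space Pe by (rule prob_Pe)
  have mPe: "borel_measurable Pe = (borel_measurable ?N :: (_ \<Rightarrow> real) set)"
    by (rule measurable_cong_sets[OF sets_Pe refl])
  have m0: "m \<theta>0 \<in> borel_measurable Pe"
    unfolding mPe using measurable_compose[of "\<lambda>z. (\<theta>0, z)" ?N, OF _ meas_m] by simp
  have l0: "l \<theta> \<eta> \<in> borel_measurable Pe" for \<theta> \<eta>
    unfolding mPe by (rule meas_l)
  let ?ph = "influence Pe l m \<theta>0 \<eta>0 \<iota> \<alpha>0"
  obtain Q \<delta> where \<delta>: "0 < \<delta>" "\<delta> \<le> 1" and Q: "Q \<in> borel_measurable Pe" "integrable Pe (\<lambda>z. Q z ^ 4)" "\<And>z. 1 \<le> Q z"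
    and phQ: "\<And>z. \<bar>?ph z\<bar> \<le> Q z"
    and hat_bd: "\<And>\<theta> \<eta> \<alpha> \<psi> z. norm (\<theta> - \<theta>0) \<le> \<delta> \<Longrightarrow> norm (\<eta> - \<eta>0) \<le> \<delta> \<Longrightarrow> cont_ext \<iota> norm (\<iota> \<alpha> - \<alpha>0) \<le> \<delta> \<Longrightarrow>
       \<bar>influence_hat l m \<theta> \<eta> \<alpha> \<psi> z - ?ph z\<bar>
       \<le> Q z * (norm (\<theta> - \<theta>0) + norm (\<eta> - \<eta>0) + cont_ext \<iota> norm (\<iota> \<alpha> - \<alpha>0) + \<bar>\<psi> - Psi Pe m \<theta>0\<bar>)"
    and ph_meas: "?ph \<in> borel_measurable Pe" and ph_mean: "(\<integral>z. ?ph z \<partial>Pe) = 0"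
    and al_cont: "continuous_on UNIV (\<lambda>\<alpha>. cont_ext \<iota> norm (\<iota> \<alpha> - \<alpha>0))" and N0: "\<And>x. 0 \<le> cont_ext \<iota> norm x"
    using influence_properties[OF prob_Pe m0 l0 regular envelope completion] by metis
  define q4 where "q4 = (\<integral>z. Q z ^ 4 \<partial>Pe)"
  have ph2: "integrable Pe (\<lambda>z. (?ph z)\<^sup>2)"
  proof (rule Bochner_Integration.integrable_bound[OF Q(2)])
    show "(\<lambda>z. (?ph z)\<^sup>2) \<in> borel_measurable Pe" using ph_meas by measurable
    show "AE z in Pe. norm ((?ph z)\<^sup>2) \<le> norm (Q z ^ 4)"
    proof (rule AE_I2)
      fix z
      have "(?ph z)\<^sup>2 \<le> (Q z)\<^sup>2" using power_mono[OF phQ[of z], of 2] by simp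
      also have "\<dots> \<le> Q z ^ 4" using Q(3)[of z] by (intro power_increasing) auto
      finally show "norm ((?ph z)\<^sup>2) \<le> norm (Q z ^ 4)" by simp
    qed
  qed

  \<comment> \<open>Filtration, policy weights and measurability\<close>
  have C_M: "C T t \<in> M \<rightarrow>\<^sub>M PC" and A_M: "A T t \<in> M \<rightarrow>\<^sub>M MA" and Y_M: "Y T t \<in> borel_measurable M" if "t \<in> {1..T}" for T t
    using data[of T] that unfolding data_generating_def by blast+
  have Z_M: "Z T t \<in> M \<rightarrow>\<^sub>M ?N" if "t \<in> {1..T}" for T t
    unfolding Z_def obs_space_def using C_M[OF that] A_M[OF that] Y_M[OF that] by measurable
  have F_sub: "subalgebra M (F T t)" if "t \<le> T" for T t
    unfolding F_def by (rule subalgebra_history, rule Z_M) (use that in auto)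
  have F_mono: "sets (F T s) \<subseteq> sets (F T t)" if "s \<le> t" "t \<le> T" for T s t
    unfolding F_def by (rule sets_history_mono[OF that(1)], rule Z_M) (use that in auto)
  have Z_F: "Z T s \<in> F T t \<rightarrow>\<^sub>M ?N" if "s \<in> {1..t}" "t \<le> T" for T s t
    unfolding F_def by (rule measurable_history[OF that(1)], rule Z_M) (use that in auto)
  have space_F: "space (F T t) = space M" for T t unfolding F_def by simp
  have F_M: "f \<in> M \<rightarrow>\<^sub>M L" if "f \<in> F T t \<rightarrow>\<^sub>M L" "t \<le> T" for f L T t
    by (rule measurable_from_subalg[OF F_sub that(1)]) (rule that(2))
  have p_meas: "(\<lambda>(\<omega>, c, a). p T t \<omega> c a) \<in> borel_measurable (F T (t - 1) \<Otimes>\<^sub>M PC \<Otimes>\<^sub>M MA)"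
    and p0: "\<And>\<omega> c a. 0 \<le> p T t \<omega> c a" if "t \<in> {1..T}" for T t
    using policy_density[OF that] unfolding random_cond_density_def by auto
  have id_F: "(\<lambda>\<omega>. \<omega>) \<in> L \<rightarrow>\<^sub>M F T t" if "sets (F T t) \<subseteq> sets L" "space L = space M" for L T t
    using that measurable_ident_subalgebra[of L "F T t"] by (simp add: subalgebra_def space_F)
  have obs_parts: "(\<lambda>z. fst z) \<in> ?N \<rightarrow>\<^sub>M PC" "(\<lambda>z. fst (snd z)) \<in> ?N \<rightarrow>\<^sub>M MA"
    unfolding obs_space_def by measurable
  \<comment> \<open>The weight of round \<open>t\<close> as a function of an arbitrary observation:
    at the observation of round \<open>t\<close> it is \<open>w\<close>, at earlier observations it
    is the reweighting factor inside \<open>\<sigma>hat2\<close>.\<close>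
  define G where "G T t \<omega> z = pe (fst z) (fst (snd z)) / p T t \<omega> (fst z) (fst (snd z))" for T t \<omega> and z :: "'c \<times> 'a \<times> real"
  have pe_obs: "(\<lambda>z. pe (fst z) (fst (snd z))) \<in> borel_measurable ?N"
    using measurable_compose[of "\<lambda>z. (fst z, fst (snd z))" ?N, OF _ pe_meas] obs_parts by simp
  have G_meas: "(\<lambda>x. G T t (fst x) (snd x)) \<in> borel_measurable (F T (t - 1) \<Otimes>\<^sub>M ?N)" if t: "t \<in> {1..T}" for T t
  proof -
    have "(\<lambda>x. pe (fst (snd x)) (fst (snd (snd x)))) \<in> borel_measurable (F T (t - 1) \<Otimes>\<^sub>M ?N)"
      using measurable_compose[OF measurable_snd pe_obs] by simp
    moreover have "(\<lambda>x. p T t (fst x) (fst (snd x)) (fst (snd (snd x)))) \<in> borel_measurable (F T (t - 1) \<Otimes>\<^sub>M ?N)"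
      using measurable_compose[of "\<lambda>x. (fst x, fst (snd x), fst (snd (snd x)))" "F T (t - 1) \<Otimes>\<^sub>M ?N", OF _ p_meas[OF t]]
        measurable_compose[OF measurable_snd obs_parts(1), of "F T (t - 1)"] measurable_compose[OF measurable_snd obs_parts(2), of "F T (t - 1)"]
      by simp
    ultimately show ?thesis unfolding G_def by (rule borel_measurable_divide)
  qed
  have w_G: "w T t \<omega> = G T t \<omega> (Z T t \<omega>)" for T t \<omega> by (simp add: w_def G_def Z_def)
  have G_ZL: "(\<lambda>\<omega>. G T t \<omega> (Z T s \<omega>)) \<in> borel_measurable L"
    if "t \<in> {1..T}" "sets (F T (t - 1)) \<subseteq> sets L" "space L = space M" "Z T s \<in> L \<rightarrow>\<^sub>M ?N" for T t s L
    using measurable_compose[OF measurable_Pair[OF id_F[OF that(2,3)] that(4)] G_meas[OF that(1)]] by simp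
  have FM: "sets (F T t) \<subseteq> sets M" if "t \<le> T" for T t using F_sub[OF that] by (simp add: subalgebra_def)
  have G_ZM: "(\<lambda>\<omega>. G T t \<omega> (Z T s \<omega>)) \<in> borel_measurable M" if "t \<in> {1..T}" "s \<in> {1..T}" for T t s
    by (rule G_ZL[OF that(1) FM refl Z_M[OF that(2)]]) (use that in auto)
  have w_F: "w T t \<in> borel_measurable (F T t)" if "t \<in> {1..T}" for T t
    unfolding w_G[abs_def] by (rule G_ZL[OF that F_mono space_F Z_F]) (use that in auto)
  have w0: "0 \<le> w T t \<omega>" if "t \<in> {1..T}" for T t \<omega>
    unfolding w_def using pe0 p0[OF that] by simp
  have hat_ZM: "(\<lambda>\<omega>. \<phi>hat T s \<omega> (Z T s \<omega>)) \<in> borel_measurable M" if "s \<in> {1..T}" for T s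
    using measurable_compose[OF measurable_Pair[OF id_F[OF FM refl] Z_M[OF that]] adapted_phi[OF that]] that by auto
  have \<sigma>h: "\<sigma>hat2 T t \<omega> = (if t = 1 then s1 else
      1 / real (t - 1) * (\<Sum>s=1..t-1. w T s \<omega> * (G T t \<omega> (Z T s \<omega>) * (\<phi>hat T s \<omega> (Z T s \<omega>))\<^sup>2)))"
    if "t \<in> {1..T}" for T t \<omega>
    using that by (simp add: \<sigma>hat2_def w_def G_def Z_def power2_eq_square mult_ac of_nat_diff)
  have \<sigma>h_M: "\<sigma>hat2 T t \<in> borel_measurable M" if t: "t \<in> {1..T}" for T t
  proof -
    have "(\<lambda>\<omega>. 1 / real (t - 1) * (\<Sum>s=1..t-1. w T s \<omega> * (G T t \<omega> (Z T s \<omega>) * (\<phi>hat T s \<omega> (Z T s \<omega>))\<^sup>2))) \<in> borel_measurable M"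
    proof (intro borel_measurable_times borel_measurable_const borel_measurable_sum borel_measurable_power)
      fix s assume "s \<in> {1..t-1}"
      then have s: "s \<in> {1..T}" "s \<le> T" using t by auto
      show "w T s \<in> borel_measurable M" by (rule F_M[OF w_F[OF s(1)] s(2)])
      show "(\<lambda>\<omega>. G T t \<omega> (Z T s \<omega>)) \<in> borel_measurable M" by (rule G_ZM[OF t s(1)])
      show "(\<lambda>\<omega>. \<phi>hat T s \<omega> (Z T s \<omega>)) \<in> borel_measurable M" by (rule hat_ZM[OF s(1)])
    qed
    then show ?thesis using \<sigma>h[OF t] by (cases "t = 1") (simp_all add: \<sigma>hat2_def[abs_def])
  qed
  let ?avg = "\<lambda>T \<omega>. 1 / real T * (\<Sum>t = 1..T. \<sigma>2 T t \<omega> / \<sigma>hat2 T t \<omega>)"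
  have avg_M: "?avg T \<in> borel_measurable M" for T
  proof (intro borel_measurable_times borel_measurable_const borel_measurable_sum borel_measurable_divide)
    fix t assume t: "t \<in> {1..T}"
    show "\<sigma>hat2 T t \<in> borel_measurable M" by (rule \<sigma>h_M[OF t])
    show "\<sigma>2 T t \<in> borel_measurable M"
      unfolding \<sigma>2_def cond_variance_def by (rule borel_measurable_cond_exp2)
  qed

  \<comment> \<open>Lower bound on the variance estimates\<close>
  obtain c0 where c0: "0 < c0" "\<And>T. AE \<omega> in M. \<forall>t\<in>{1..T}. c0 < min (sqrt (\<sigma>2 T t \<omega>)) (sqrt (\<sigma>hat2 T t \<omega>))"
    using sigma_lower by blast
  have low: "AE \<omega> in M. \<forall>t\<in>{1..T}. c0\<^sup>2 \<le> \<sigma>hat2 T t \<omega>" for T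
    using c0(2)[of T]
  proof eventually_elim
    case (elim \<omega>)
    show ?case
    proof
      fix t assume "t \<in> {1..T}"
      then have "c0 < sqrt (\<sigma>hat2 T t \<omega>)" using elim by simp
      \<comment> \<open>The real \<open>sqrt\<close> is odd, so positivity of the root is what
        excludes a negative argument when the square is simplified.\<close>
      then have "c0\<^sup>2 < (sqrt (\<sigma>hat2 T t \<omega>))\<^sup>2" "0 < sqrt (\<sigma>hat2 T t \<omega>)"
        using c0(1) by (simp_all add: power_strict_mono del: real_sqrt_gt_0_iff)
      then show "c0\<^sup>2 \<le> \<sigma>hat2 T t \<omega>" by simp
    qed
  qed
  have min_low: "\<exists>b>0. \<forall>T\<ge>1. AE \<omega> in M. b \<le> (MIN t\<in>{1..T}. \<sigma>hat2 T t \<omega>)"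
  proof (intro exI[of _ "c0\<^sup>2"] conjI allI impI)
    fix T :: nat assume "1 \<le> T"
    then show "AE \<omega> in M. c0\<^sup>2 \<le> (MIN t\<in>{1..T}. \<sigma>hat2 T t \<omega>)"
      using low[of T] by (auto simp: Min_ge_iff elim!: eventually_mono)
  qed (use c0 in simp)

  \<comment> \<open>Deterministic bound on the weights over the class\<close>
  obtain K0 T0 where K0: "\<And>T. T0 \<le> T \<Longrightarrow> (SUP \<pi>\<in>PolT T. sup_ratio pe \<pi>) \<le> ennreal (K0 * real T powr (1/8))"
    using class_weights unfolding big_O_ennreal_def eventually_sequentially by blast
  \<comment> \<open>The constant behind the rate could be negative; the maximum makes the bound
    \<open>B\<close> nonnegative.\<close>
  define K where "K = max K0 1"
  define B where "B T = K * real T powr (1/8)" for T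
  have B0: "0 \<le> B T" for T unfolding B_def K_def by simp
  have class_bd: "sup_ratio pe \<pi> \<le> ennreal (B T)" if "T0 \<le> T" "\<pi> \<in> PolT T" for T \<pi>
  proof -
    have "sup_ratio pe \<pi> \<le> (SUP \<pi>\<in>PolT T. sup_ratio pe \<pi>)" by (rule SUP_upper[OF that(2)])
    also have "\<dots> \<le> ennreal (K0 * real T powr (1/8))" by (rule K0[OF that(1)])
    also have "\<dots> \<le> ennreal (B T)" unfolding B_def K_def by (intro ennreal_leI mult_right_mono) auto
    finally show ?thesis .
  qed
  have \<pi>0: "0 \<le> \<pi> c a" if "1 \<le> T" "\<pi> \<in> PolT T" for T \<pi> c a
    using class_density[OF that] by (simp add: cond_density_def)

  \<comment> \<open>Estimation errors on a common scale\<close>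
  define th et al ps where "th T s \<omega> = norm (\<theta>hat T s \<omega> - \<theta>0)" and "et T s \<omega> = norm (\<eta>hat T s \<omega> - \<eta>0)"
    and "al T s \<omega> = cont_ext \<iota> norm (\<iota> (\<alpha>hat T s \<omega>) - \<alpha>0)" and "ps T s \<omega> = \<psi>hat T s \<omega> - Psi Pe m \<theta>0" for T s \<omega>
  have est_meas: "th T s \<in> borel_measurable (F T (s - 1))" "et T s \<in> borel_measurable (F T (s - 1))"
    "al T s \<in> borel_measurable (F T (s - 1))" "ps T s \<in> borel_measurable (F T (s - 1))" if s: "s \<in> {1..T}" for T s
  proof -
    show "th T s \<in> borel_measurable (F T (s - 1))"
      unfolding th_def by (rule measurable_compose[OF adapted_theta[OF s] borel_measurable_continuous_onI]) (intro continuous_intros)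
    show "et T s \<in> borel_measurable (F T (s - 1))"
      unfolding et_def by (rule measurable_compose[OF adapted_eta[OF s] borel_measurable_continuous_onI]) (intro continuous_intros)
    show "al T s \<in> borel_measurable (F T (s - 1))"
      unfolding al_def by (rule measurable_compose[OF adapted_alpha[OF s] borel_measurable_continuous_onI[OF al_cont]])
    show "ps T s \<in> borel_measurable (F T (s - 1))"
      unfolding ps_def using adapted_psi[OF s] by simp
  qed
  \<comment> \<open>Dividing the averages by their rates turns the four assumptions into sums:
    fourth powers without normalization, and squares over the root of \<open>T\<close>. Stopping
    acts on this quantity.\<close>
  define X where "X T \<omega> = (\<Sum>s=1..T. th T s \<omega> ^ 4 + et T s \<omega> ^ 4 + al T s \<omega> ^ 4 + (ps T s \<omega>)\<^sup>2 / sqrt (real T))" for T \<omega>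
  have X_M: "X T \<in> borel_measurable M" for T
    unfolding X_def
  proof (rule borel_measurable_sum)
    fix s assume s: "s \<in> {1..T}"
    then have sT: "s - 1 \<le> T" by auto
    note [measurable] = F_M[OF est_meas(1)[OF s] sT] F_M[OF est_meas(2)[OF s] sT] F_M[OF est_meas(3)[OF s] sT] F_M[OF est_meas(4)[OF s] sT]
    show "(\<lambda>\<omega>. th T s \<omega> ^ 4 + et T s \<omega> ^ 4 + al T s \<omega> ^ 4 + (ps T s \<omega>)\<^sup>2 / sqrt (real T)) \<in> borel_measurable M" by measurable
  qed
  have X_lim: "(\<lambda>T. measure M {\<omega>\<in>space M. d < X T \<omega>}) \<longlonglongrightarrow> 0" if d: "0 < d" for d
  proof -
    define R where "R T \<omega> = (1 / real T * (\<Sum>t = 1..T. norm (\<theta>hat T t \<omega> - \<theta>0) ^ 4)) / real T powr (-1)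
        + (1 / real T * (\<Sum>t = 1..T. norm (\<eta>hat T t \<omega> - \<eta>0) ^ 4)) / real T powr (-1)
        + (1 / real T * (\<Sum>t = 1..T. cont_ext \<iota> norm (\<iota> (\<alpha>hat T t \<omega>) - \<alpha>0) ^ 4)) / real T powr (-1)
        + (1 / real T * (\<Sum>s = 1..T. (\<psi>hat T s \<omega> - Psi Pe m \<theta>0)\<^sup>2)) / real T powr (-1/2)" for T \<omega>
    have R: "tendsto_in_prob M R 0"
      unfolding R_def
      by (intro tendsto_in_prob_add_zero[OF prob_M] rate_theta[unfolded little_o_prob_def]
          rate_eta[unfolded little_o_prob_def] rate_alpha[unfolded little_o_prob_def] rate_psi[unfolded little_o_prob_def])
    then have [measurable]: "R T \<in> borel_measurable M" for T by (simp add: tendsto_in_prob_def)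
    have X_eq: "X T \<omega> = R T \<omega>" if "1 \<le> T" for T \<omega>
    proof -
      have 1: "1 / real T / real T powr (-1) = 1" using that by (simp add: powr_minus)
      have 2: "1 / real T / real T powr (-1/2) = 1 / sqrt (real T)"
        using that by (simp add: powr_minus powr_half_sqrt real_div_sqrt field_simps)
      have e: "1 / real T * u / v = (1 / real T / v) * u" for u v by simp
      show ?thesis
        unfolding X_def R_def e 1 2 th_def et_def al_def ps_def
        by (simp add: sum.distrib sum_divide_distrib)
    qed
    have bound: "measure M {\<omega>\<in>space M. d < X T \<omega>} \<le> measure M {\<omega>\<in>space M. d < \<bar>R T \<omega>\<bar>}" if "1 \<le> T" for T
      by (rule finite_measure_mono) (auto simp: X_eq[OF that])
    have lim: "(\<lambda>T. measure M {\<omega>\<in>space M. d < \<bar>R T \<omega>\<bar>}) \<longlonglongrightarrow> 0"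
      using R d by (simp add: tendsto_in_prob_def)
    show ?thesis
      by (rule tendsto_sandwich[OF _ _ tendsto_const lim])
        (use bound in \<open>auto intro!: eventually_sequentiallyI[of 1]\<close>)
  qed

  \<comment> \<open>Bound at a fixed horizon\<close>
  obtain KE where KE: "\<And>T \<epsilon>. 1 \<le> T \<Longrightarrow> \<epsilon> \<in> {0<..<1} \<Longrightarrow>
      elog (ereal_of_enat (covering_number \<epsilon> (log_class (PolT T))))
          \<le> ereal (KE * (if q = 0 then ln (exp 1 / \<epsilon>) else \<epsilon> powr (- q)))"
    using entropy by blast

  \<comment> \<open>Neither \<open>e\<close> nor \<open>n\<close> varies with \<open>T\<close>: the
    scale \<open>\<epsilon>\<close> is chosen beforehand and the entropy constant is uniform in the
    horizon.\<close>
  have horizon: "\<exists>U. integrable M U \<and> (\<forall>\<omega>. 0 \<le> U \<omega>) \<and>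
      (\<integral>\<omega>. U \<omega> \<partial>M) \<le> e * n * (real T powr (-1/8) + B T ^ 3 * q4 * (1 + ln (real T)) / (real T * real T powr (-1/8)))
        + B T * (1 + ln (real T)) / real T * (48 * q4 * real T powr (3/4)) \<and>
      (AE \<omega> in M. X T \<omega> \<le> \<delta> ^ 4 \<longrightarrow> \<bar>?avg T \<omega> - 1\<bar>
        \<le> (B T * q4 / s1 + 1) / real T + (e\<^sup>2 - 1) / (1 - (e\<^sup>2 - 1)) + U \<omega> / ((1 - (e\<^sup>2 - 1)) * c0\<^sup>2))"
    if T: "1 \<le> T" "T0 \<le> T" and \<epsilon>: "\<epsilon> \<in> {0<..<1}" and e: "e = exp (2 * \<epsilon>)" "e\<^sup>2 < 2"
      and n: "n = exp (KE * (if q = 0 then ln (exp 1 / \<epsilon>) else \<epsilon> powr (- q)))" for T \<epsilon> e n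
  proof -
    \<comment> \<open>Membership in the class converts the class bound into one for the random
      policies, at all contexts and actions simultaneously, and gives positivity wherever
      \<open>pe\<close> is positive.\<close>
    have good: "AE \<omega> in M. \<forall>t\<in>{1..T}. \<forall>c a. (0 < pe c a \<longrightarrow> 0 < p T t \<omega> c a) \<and> pe c a / p T t \<omega> c a \<le> B T"
      using in_class[of T]
    proof eventually_elim
      case (elim \<omega>)
      show ?case
      proof (intro ballI allI)
        fix t c a assume t: "t \<in> {1..T}"
        then have "sup_ratio pe (p T t \<omega>) \<le> ennreal (B T)" using elim by (intro class_bd T) auto
        from sup_ratio_leD[OF this B0 pe0 p0[OF t]]
        show "(0 < pe c a \<longrightarrow> 0 < p T t \<omega> c a) \<and> pe c a / p T t \<omega> c a \<le> B T" by blast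
      qed
    qed
    \<comment> \<open>Densities are known to be nonnegative for rounds within the horizon, while the
      locale wants nonnegative weights at every index; the absolute value supplies this without
      changing the relevant rounds.\<close>
    have wabs: "\<bar>w T t \<omega>\<bar> = w T t \<omega>" if "t \<in> {1..T}" for t \<omega> using w0[OF that] by simp
    interpret R: weighted_rounds M "F T" "Z T" "\<lambda>t \<omega>. \<bar>w T t \<omega>\<bar>" Pe T "B T"
    proof unfold_locales
      show "Z T t \<in> F T t \<rightarrow>\<^sub>M Pe" if "t \<in> {1..T}" for t
        using Z_F[of t t T] that by (simp add: measurable_cong_sets[OF refl sets_Pe])
      show "(\<lambda>\<omega>. \<bar>w T t \<omega>\<bar>) \<in> borel_measurable (F T t)" if "t \<in> {1..T}" for t
        using w_F[OF that] by simp
      show "AE \<omega> in M. \<bar>w T t \<omega>\<bar> \<le> B T" if "t \<in> {1..T}" for t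
        unfolding wabs[OF that] unfolding w_def using good by eventually_elim (use that in blast)
      fix t and f :: "_ \<Rightarrow> ennreal"
      assume t: "t \<in> {1..T}" and f: "f \<in> borel_measurable (F T (t - 1) \<Otimes>\<^sub>M Pe)"
      have f': "f \<in> borel_measurable (F T (t - 1) \<Otimes>\<^sub>M ?N)"
        using f by (simp add: measurable_cong_sets[OF sets_pair_measure_cong[OF refl sets_Pe] refl])
      have dg: "distr M PC (C T t) = PC"
        "prob_space.indep_set M (sets (F T (t - 1))) (sets (sigma_of M (C T t) PC))"
        "has_cond_law M (sigma_join M (F T (t - 1)) (C T t) PC) (A T t) MA (\<lambda>\<omega>. policy \<mu> (p T t \<omega>) (C T t \<omega>))"
        "has_cond_law M (sigma_of M (\<lambda>\<omega>. (C T t \<omega>, A T t \<omega>)) (PC \<Otimes>\<^sub>M MA)) (Y T t) borel (\<lambda>\<omega>. PY (C T t \<omega>) (A T t \<omega>))"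
        "cond_indep_of M (sigma_of M (\<lambda>\<omega>. (C T t \<omega>, A T t \<omega>)) (PC \<Otimes>\<^sub>M MA)) (Y T t) borel (F T (t - 1))"
        using data[of T] t unfolding data_generating_def by blast+
      have pos: "AE \<omega> in M. \<forall>c a. 0 < pe c a \<longrightarrow> 0 < p T t \<omega> c a"
        using good by eventually_elim (use t in blast)
      have sub: "subalgebra M (F T (t - 1))" by (rule F_sub) (use t in auto)
      show "(\<integral>\<^sup>+\<omega>. ennreal \<bar>w T t \<omega>\<bar> * f (\<omega>, Z T t \<omega>) \<partial>M) = (\<integral>\<^sup>+\<omega>. \<integral>\<^sup>+z. f (\<omega>, z) \<partial>Pe \<partial>M)"
        unfolding wabs[OF t] unfolding w_def Z_def Pe_def
        by (rule one_round_change_of_measure[OF prob_M prob_PC space_PC space_MA sub C_M[OF t] A_M[OF t] Y_M[OF t]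
              dg kernel_Y eval_density policy_density[OF t] pos f'])
    qed (use F_sub F_mono prob_Pe in auto)
    have G_bd: "AE \<omega> in M. \<forall>t\<in>{1..T}. \<forall>z. 0 \<le> G T t \<omega> z \<and> G T t \<omega> z \<le> B T"
      using good by eventually_elim (use pe0 p0 in \<open>auto simp: G_def\<close>)
    have meas_FPe: "borel_measurable (F T (t - 1) \<Otimes>\<^sub>M Pe) = (borel_measurable (F T (t - 1) \<Otimes>\<^sub>M ?N) :: (_ \<Rightarrow> real) set)" for t
      by (rule measurable_cong_sets[OF sets_pair_measure_cong[OF refl sets_Pe] refl])
    have \<sigma>2: "AE \<omega> in M. \<forall>t\<in>{1..T}. \<sigma>2 T t \<omega> = (\<integral>z. G T t \<omega> z * (?ph z)\<^sup>2 \<partial>Pe)"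
    proof (rule AE_finite_allI)
      fix t assume t: "t \<in> {1..T}"
      have "AE \<omega> in M. cond_variance M (F T (t - 1)) (\<lambda>\<omega>. \<bar>w T t \<omega>\<bar> * ?ph (Z T t \<omega>)) \<omega>
          = (\<integral>z. (\<lambda>x. G T t (fst x) (snd x)) (\<omega>, z) * (?ph z)\<^sup>2 \<partial>Pe)"
      proof (rule R.cond_variance_weighted[OF t ph_meas ph2 ph_mean])
        show "(\<lambda>x. G T t (fst x) (snd x)) \<in> borel_measurable (F T (t - 1) \<Otimes>\<^sub>M Pe)"
          unfolding meas_FPe by (rule G_meas[OF t])
        show "\<bar>w T t \<omega>\<bar> = G T t (fst (\<omega>, Z T t \<omega>)) (snd (\<omega>, Z T t \<omega>))" for \<omega>
          unfolding wabs[OF t] by (simp add: w_G)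
        show "AE \<omega> in M. \<forall>z. 0 \<le> G T t (fst (\<omega>, z)) (snd (\<omega>, z)) \<and> G T t (fst (\<omega>, z)) (snd (\<omega>, z)) \<le> B T"
          using G_bd by eventually_elim (use t in simp)
      qed
      then show "AE \<omega> in M. \<sigma>2 T t \<omega> = (\<integral>z. G T t \<omega> z * (?ph z)\<^sup>2 \<partial>Pe)"
        unfolding \<sigma>2_def \<phi>_def wabs[OF t] by simp
    qed simp
    have \<epsilon>_nonneg: "0 \<le> \<epsilon>" using \<epsilon> by simp
    obtain R where "R \<subseteq> PolT T" "finite R" "real (card R) \<le> exp (KE * (if q = 0 then ln (exp 1 / \<epsilon>) else \<epsilon> powr (- q)))"
      and cover: "\<And>\<pi>. \<pi> \<in> PolT T \<Longrightarrow> \<exists>r\<in>R. \<forall>c a. \<pi> c a \<le> exp (2 * \<epsilon>) * r c a \<and> r c a \<le> exp (2 * \<epsilon>) * \<pi> c a"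
      by (rule finite_multiplicative_cover[OF KE[OF T(1) \<epsilon>] \<epsilon>_nonneg]) (erule \<pi>0[OF T(1)], rule that)
    then have R: "R \<subseteq> PolT T" "finite R" "real (card R) \<le> n" unfolding n by simp_all
    define \<rho> where "\<rho> r z = pe (fst z) (fst (snd z)) / r (fst z) (fst (snd z))" for r and z :: "'c \<times> 'a \<times> real"
    have e1: "1 \<le> e" using \<epsilon> by (simp add: e)
    have \<rho>_meas: "\<rho> r \<in> borel_measurable Pe" if "r \<in> R" for r
    proof -
      have "(\<lambda>(c, a). r c a) \<in> borel_measurable (PC \<Otimes>\<^sub>M MA)"
        using class_density[OF T(1)] that R(1) unfolding cond_density_def by blast
      then have "(\<lambda>z. r (fst z) (fst (snd z))) \<in> borel_measurable ?N"
        using measurable_compose[of "\<lambda>z. (fst z, fst (snd z))" ?N "PC \<Otimes>\<^sub>M MA" "\<lambda>(c, a). r c a" borel] obs_parts by simp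
      then show ?thesis unfolding mPe \<rho>_def by (rule borel_measurable_divide[OF pe_obs])
    qed
    have \<rho>_bd: "0 \<le> \<rho> r z \<and> \<rho> r z \<le> B T" if "r \<in> R" for r z
    proof -
      have r: "r \<in> PolT T" using that R(1) by auto
      show ?thesis unfolding \<rho>_def
        using sup_ratio_leD(2)[OF class_bd[OF T(2) r] B0 pe0 \<pi>0[OF T(1) r]] pe0 \<pi>0[OF T(1) r] by simp
    qed
    \<comment> \<open>Comparability of two densities passes to their reciprocals with the same
      factor; a zero denominator on the left makes that side 0.\<close>
    have ratio_mono: "x / u \<le> e * (x / v)" if "0 \<le> x" "0 \<le> u" "0 \<le> v" "v \<le> e * u" "u \<le> e * v" for x u v :: real
    proof (cases "u = 0")
      case False
      then have u: "0 < u" using that by simp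
      then have v: "0 < v" using that e1 by (cases "v = 0") auto
      have "x * v \<le> x * (e * u)" using that by (intro mult_left_mono) auto
      then show ?thesis using u v by (simp add: field_simps)
    qed (use that e1 in simp)
    have Gcov: "AE \<omega> in M. \<forall>t\<in>{1..T}. G T t \<omega> \<in> borel_measurable Pe \<and> (\<forall>z. 0 \<le> G T t \<omega> z \<and> G T t \<omega> z \<le> B T) \<and>
      (\<exists>r\<in>R. \<forall>z. G T t \<omega> z \<le> e * \<rho> r z \<and> \<rho> r z \<le> e * G T t \<omega> z)"
      using G_bd in_class[of T] AE_space
    proof eventually_elim
      case (elim \<omega>)
      show ?case
      proof (intro ballI conjI)
        fix t assume t: "t \<in> {1..T}"
        show "G T t \<omega> \<in> borel_measurable Pe"
          unfolding mPe using measurable_compose[OF measurable_Pair1' G_meas[OF t], of \<omega>] elim(3) by (simp add: space_F)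
        show "\<forall>z. 0 \<le> G T t \<omega> z \<and> G T t \<omega> z \<le> B T" using elim(1) t by blast
        have "p T t \<omega> \<in> PolT T" using elim(2) t by blast
        from cover[OF this] obtain r where r1: "r \<in> R"
          "\<forall>c a. p T t \<omega> c a \<le> exp (2 * \<epsilon>) * r c a \<and> r c a \<le> exp (2 * \<epsilon>) * p T t \<omega> c a" ..
        then have r: "r \<in> R" "\<And>c a. p T t \<omega> c a \<le> e * r c a" "\<And>c a. r c a \<le> e * p T t \<omega> c a"
          unfolding e by simp_all
        have r0: "0 \<le> r c a" for c a using \<pi>0[OF T(1)] r(1) R(1) by blast
        have "G T t \<omega> z \<le> e * \<rho> r z \<and> \<rho> r z \<le> e * G T t \<omega> z" for z
          unfolding G_def \<rho>_def using r r0 pe0 p0[OF t] by (intro conjI ratio_mono) auto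
        then show "\<exists>r\<in>R. \<forall>z. G T t \<omega> z \<le> e * \<rho> r z \<and> \<rho> r z \<le> e * G T t \<omega> z" using r(1) by blast
      qed
    qed
    have \<psi>_meas: "(\<lambda>(\<omega>, z). \<phi>hat T s \<omega> z) \<in> borel_measurable (F T (s - 1) \<Otimes>\<^sub>M Pe)" if "s \<in> {1..T}" for s
      unfolding meas_FPe by (rule adapted_phi[OF that])
    have \<sigma>h': "\<sigma>hat2 T t \<omega> = (if t = 1 then s1 else
      1 / real (t - 1) * (\<Sum>s=1..t-1. \<bar>w T s \<omega>\<bar> * (G T t \<omega> (Z T s \<omega>) * (\<phi>hat T s \<omega> (Z T s \<omega>))\<^sup>2)))"
      if t: "t \<in> {1..T}" for t \<omega>
    proof -
      have "(\<Sum>s=1..t-1. \<bar>w T s \<omega>\<bar> * (G T t \<omega> (Z T s \<omega>) * (\<phi>hat T s \<omega> (Z T s \<omega>))\<^sup>2))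
          = (\<Sum>s=1..t-1. w T s \<omega> * (G T t \<omega> (Z T s \<omega>) * (\<phi>hat T s \<omega> (Z T s \<omega>))\<^sup>2))"
        by (rule sum.cong[OF refl], subst wabs) (use t in auto)
      then show ?thesis using \<sigma>h[OF t] by simp
    qed
    define H where "H = (\<Sum>n<T. 1 / real n)"
    \<comment> \<open>This value for the free scale vanishes in the limit, yet slowly enough for the
      variance term, which is divided by it, to vanish too.\<close>
    have \<tau>: "0 < real T powr (-1/8)" using T by simp
    have hb: "\<bar>\<phi>hat T s \<omega> z - ?ph z\<bar> \<le> Q z * (th T s \<omega> + et T s \<omega> + al T s \<omega> + \<bar>ps T s \<omega>\<bar>)"
      if "s \<in> {1..T}" "th T s \<omega> \<le> \<delta>" "et T s \<omega> \<le> \<delta>" "al T s \<omega> \<le> \<delta>" for s \<omega> z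
      unfolding \<phi>hat_def th_def et_def al_def ps_def
      by (rule hat_bd) (use that in \<open>simp_all add: th_def et_def al_def\<close>)
    have nn: "0 \<le> th T s \<omega>" "0 \<le> et T s \<omega>" "0 \<le> al T s \<omega>" for s \<omega>
      by (simp_all add: th_def et_def al_def N0)
    interpret W: estimated_rounds M "F T" "Z T" "\<lambda>t \<omega>. \<bar>w T t \<omega>\<bar>" Pe T "B T"
        ?ph Q "\<phi>hat T" "th T" "et T" "al T" "ps T" \<delta>
      by unfold_locales (rule ph_meas Q phQ \<psi>_meas est_meas nn \<delta> T B0 hb; assumption)+
    have c2: "0 < c0\<^sup>2" using c0(1) by simp
    obtain U where U: "integrable M U" "\<And>\<omega>. 0 \<le> U \<omega>"
      "(\<integral>\<omega>. U \<omega> \<partial>M) \<le> e * real (card R) * (real T powr (-1/8) + B T ^ 3 * q4 * H / (real T * real T powr (-1/8))) + B T * H / real T * (48 * q4 * real T powr (3/4))"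
      "AE \<omega> in M. X T \<omega> \<le> \<delta> ^ 4 \<longrightarrow> \<bar>?avg T \<omega> - 1\<bar>
        \<le> (B T * q4 / s1 + 1) / real T + (e\<^sup>2 - 1) / (1 - (e\<^sup>2 - 1)) + U \<omega> / ((1 - (e\<^sup>2 - 1)) * c0\<^sup>2)"
      using W.ratio_average_deviation[OF \<rho>_meas \<rho>_bd R(2) Gcov e1 e(2) \<sigma>2 \<sigma>h' c2 low s1_pos \<tau>]
      unfolding X_def q4_def H_def by blast
    have H_le: "H \<le> 1 + ln (real T)" unfolding H_def by (rule sum_inverse_le_ln[OF T(1)])
    have H0: "0 \<le> H" unfolding H_def by (simp add: sum_nonneg)
    have q0: "0 \<le> q4" unfolding q4_def by (rule Bochner_Integration.integral_nonneg) simp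
    have ln0: "0 \<le> ln (real T)" using T(1) by simp
    have "e * real (card R) * (real T powr (-1/8) + B T ^ 3 * q4 * H / (real T * real T powr (-1/8))) + B T * H / real T * (48 * q4 * real T powr (3/4))
      \<le> e * n * (real T powr (-1/8) + B T ^ 3 * q4 * (1 + ln (real T)) / (real T * real T powr (-1/8))) + B T * (1 + ln (real T)) / real T * (48 * q4 * real T powr (3/4))"
      using e1 R(3) H_le H0 q0 B0[of T] ln0
      by (intro add_mono mult_mono divide_right_mono order_refl mult_nonneg_nonneg add_nonneg_nonneg divide_nonneg_nonneg) auto
    from order_trans[OF U(3) this] show ?thesis using U by (intro exI[of _ U] conjI allI)
  qed

  \<comment> \<open>Passage to the limit\<close>
  have main: "(\<lambda>T. measure M {\<omega>\<in>space M. \<epsilon> < \<bar>?avg T \<omega> - 1\<bar>}) \<longlonglongrightarrow> 0" if \<epsilon>: "0 < \<epsilon>" for \<epsilon>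
  proof -
    \<comment> \<open>Budget for \<open>\<epsilon>\<close>: a third for the cover, a third for the
      first round, a sixth for \<open>U\<close>. From \<open>\<kappa> \<le> 1/2\<close> and
      \<open>\<kappa> \<le> \<epsilon> / 6\<close> the cover term
      \<open>\<kappa> / (1 - \<kappa>)\<close> stays within its third.\<close>
    define \<kappa> where "\<kappa> = min (1/2) (\<epsilon> / 6)"
    have \<kappa>: "0 < \<kappa>" "\<kappa> \<le> 1/2" "\<kappa> \<le> \<epsilon> / 6" using \<epsilon> by (auto simp: \<kappa>_def)
    \<comment> \<open>Solves \<open>exp (4 * \<epsilon>0) = 1 + \<kappa>\<close>, so that the
      relative error \<open>e\<^sup>2 - 1\<close> of the transfer equals
      \<open>\<kappa>\<close>.\<close>
    define \<epsilon>0 where "\<epsilon>0 = ln (1 + \<kappa>) / 4"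
    have \<epsilon>0: "\<epsilon>0 \<in> {0<..<1}" using \<kappa> ln_add_one_self_le_self[of \<kappa>] by (simp add: \<epsilon>0_def)
    define e where "e = exp (2 * \<epsilon>0)"
    have e2: "e\<^sup>2 = 1 + \<kappa>" using \<kappa>(1) by (simp add: e_def \<epsilon>0_def exp_double[symmetric])
    have \<kappa>3: "\<kappa> / (1 - \<kappa>) \<le> \<epsilon> / 3"
    proof -
      have "\<epsilon> * (1/2) \<le> \<epsilon> * (1 - \<kappa>)" using \<kappa> \<epsilon> by (intro mult_left_mono) auto
      then have "\<kappa> * 3 \<le> \<epsilon> * (1 - \<kappa>)" using \<kappa> by linarith
      then show ?thesis using \<kappa> by (simp add: divide_le_eq)
    qed
    define n where "n = exp (KE * (if q = 0 then ln (exp 1 / \<epsilon>0) else \<epsilon>0 powr (- q)))"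
    define v where "v T = e * n * (real T powr (-1/8) + B T ^ 3 * q4 * (1 + ln (real T)) / (real T * real T powr (-1/8)))
        + B T * (1 + ln (real T)) / real T * (48 * q4 * real T powr (3/4))" for T
    define u0 where "u0 = \<epsilon> / 6 * ((1 - \<kappa>) * c0\<^sup>2)"
    have u0: "0 < u0" using \<epsilon> \<kappa> c0(1) by (simp add: u0_def)
    have v_lim: "v \<longlonglongrightarrow> 0" unfolding v_def B_def by (rule deviation_rate_tendsto)
    have "(\<lambda>T. (B T * q4 / s1 + 1) / real T) \<longlonglongrightarrow> 0"
    proof -
      have 1: "(\<lambda>T. real T powr (1/8) / real T) \<longlonglongrightarrow> 0" by real_asymp
      have 2: "(\<lambda>T. 1 / real T) \<longlonglongrightarrow> 0" by real_asymp
      have "(\<lambda>T. K * q4 / s1 * (real T powr (1/8) / real T) + 1 / real T) \<longlonglongrightarrow> K * q4 / s1 * 0 + 0"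
        by (intro tendsto_intros 1 2)
      then show ?thesis by (simp add: B_def add_divide_distrib mult_ac)
    qed
    then have ev: "\<forall>\<^sub>F T in sequentially. (B T * q4 / s1 + 1) / real T < \<epsilon> / 3"
      using \<epsilon> by (intro order_tendstoD(2)) auto
    have bound: "\<forall>\<^sub>F T in sequentially. measure M {\<omega>\<in>space M. \<epsilon> < \<bar>?avg T \<omega> - 1\<bar>}
        \<le> measure M {\<omega>\<in>space M. \<delta> ^ 4 < X T \<omega>} + v T / u0"
      using ev eventually_ge_at_top[of "max 1 T0"]
    proof eventually_elim
      case (elim T)
      have T: "1 \<le> T" "T0 \<le> T" using elim(2) by auto
      have e22: "e\<^sup>2 < 2" using e2 \<kappa> by simp
      obtain U where U: "integrable M U" "\<And>\<omega>. 0 \<le> U \<omega>" "(\<integral>\<omega>. U \<omega> \<partial>M) \<le> v T"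
        "AE \<omega> in M. X T \<omega> \<le> \<delta> ^ 4 \<longrightarrow> \<bar>?avg T \<omega> - 1\<bar>
          \<le> (B T * q4 / s1 + 1) / real T + \<kappa> / (1 - \<kappa>) + U \<omega> / ((1 - \<kappa>) * c0\<^sup>2)"
        using horizon[OF T \<epsilon>0 e_def e22 n_def] unfolding v_def e2 by auto
      have [measurable]: "U \<in> borel_measurable M" using U(1) by simp
      note [measurable] = X_M avg_M
      \<comment> \<open>Off the two exceptional events the parts of the budget add up to at most
        \<open>\<epsilon>\<close>. The first event is controlled by the rates of the estimators, the
        second by Markov's inequality.\<close>
      have "measure M {\<omega>\<in>space M. \<epsilon> < \<bar>?avg T \<omega> - 1\<bar>}
          \<le> measure M ({\<omega>\<in>space M. \<delta> ^ 4 < X T \<omega>} \<union> {\<omega>\<in>space M. u0 \<le> U \<omega>})"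
      proof (rule finite_measure_mono_AE)
        show "AE \<omega> in M. \<omega> \<in> {\<omega>\<in>space M. \<epsilon> < \<bar>?avg T \<omega> - 1\<bar>} \<longrightarrow>
            \<omega> \<in> {\<omega>\<in>space M. \<delta> ^ 4 < X T \<omega>} \<union> {\<omega>\<in>space M. u0 \<le> U \<omega>}"
          using U(4)
        proof eventually_elim
          case elim2: (elim \<omega>)
          show ?case
          proof (rule impI, rule ccontr)
            assume w: "\<omega> \<in> {\<omega>\<in>space M. \<epsilon> < \<bar>?avg T \<omega> - 1\<bar>}"
              and "\<omega> \<notin> {\<omega>\<in>space M. \<delta> ^ 4 < X T \<omega>} \<union> {\<omega>\<in>space M. u0 \<le> U \<omega>}"
            then have X: "X T \<omega> \<le> \<delta> ^ 4" and Uu: "U \<omega> < u0" by auto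
            have "U \<omega> / ((1 - \<kappa>) * c0\<^sup>2) \<le> \<epsilon> / 6"
              using Uu \<kappa> c0(1) by (simp add: u0_def pos_divide_le_eq)
            then have "\<bar>?avg T \<omega> - 1\<bar> \<le> \<epsilon>" using elim2 X elim(1) \<kappa>3 \<epsilon> by linarith
            then show False using w by auto
          qed
        qed
      qed measurable
      also have "\<dots> \<le> measure M {\<omega>\<in>space M. \<delta> ^ 4 < X T \<omega>} + measure M {\<omega>\<in>space M. u0 \<le> U \<omega>}"
        by (rule measure_Un_le) measurable
      also have "measure M {\<omega>\<in>space M. u0 \<le> U \<omega>} \<le> (\<integral>\<omega>. U \<omega> \<partial>M) / u0"
        by (rule integral_Markov_inequality_measure[OF U(1) sets.top]) (use U(2) u0 in auto)
      also have "(\<integral>\<omega>. U \<omega> \<partial>M) / u0 \<le> v T / u0" using U(3) u0 by (simp add: divide_right_mono)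
      finally show ?case by simp
    qed
    have "(\<lambda>T. measure M {\<omega>\<in>space M. \<delta> ^ 4 < X T \<omega>} + v T / u0) \<longlonglongrightarrow> 0 + 0 / u0"
      by (intro tendsto_intros X_lim v_lim) (use \<delta> u0 in auto)
    then show ?thesis
      by (intro tendsto_sandwich[OF _ bound tendsto_const]) auto
  qed
  have conv: "tendsto_in_prob M ?avg 1"
    unfolding tendsto_in_prob_def using avg_M main by blast
  moreover have "little_o_prob M (\<lambda>T \<omega>. ?avg T \<omega> - 1) (\<lambda>_. 1)"
  proof -
    have "(\<lambda>\<omega>. ?avg T \<omega> - 1) \<in> borel_measurable M" for T
      by (intro borel_measurable_diff avg_M borel_measurable_const)
    then show ?thesis using main unfolding little_o_prob_def tendsto_in_prob_def by simp
  qed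
  ultimately show ?thesis using min_low by blast
qed

end
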